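(* Let $p$ be a prime number, assume that $\mathbb{F}_p\subseteq R$, and let $M$ be an $RG$-module. Then, for any $x\in H^*(G,M)$, $$\operatorname{height}\operatorname{ann}_{R^G}(x)\ \ge\ \inf\{\operatorname{height} I_R(P)\mid P \text{ a } p\text{-subgroup of } G,\ x\big|_P\neq 0\}.$$
   Context: $G$ is a finite group and $R$ is a commutative ring on which $G$ acts by ring automorphisms $r\mapsto g(r)$; $R^G$ is the subring of $G$-invariants. $RG$ denotes the skew group ring: the free left $R$-module with basis $G$ and multiplication $rg\cdot r'g'=r\,g(r')\,gg'$. Modules are left modules. For an $RG$-module $M$ and $r\in R^G$, multiplication by $r$ on $M$ is $G$-equivariant, hence induces an endomorphism of the group cohomology $H^*(G,M)$; this makes $H^*(G,M)$ an $R^G$-module, and $\operatorname{ann}_{R^G}(x)$ is the annihilator of $x$ in $R^G$. For a subgroup $P\le G$, $x\big|_P=\operatorname{res}^G_P(x)\in H^*(P,M)$ is the restriction of $x$. For a subgroup $H\le G$, $I_R(H)$ is the ideal of $R$ generated by all elements $h(r)-r$ with $h\in H$, $r\in R$. The height of an ideal is the infimum of the heights of the prime ideals containing it, and $\inf\emptyset=\infty$ (so the unit ideal has height $\infty$). *)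

theory Defs
  imports "HOL-Algebra.Algebra" "HOL-Library.Extended_Nat"
begin

section \<open>Heights of ideals in a commutative ring\<close>

definition prime_height :: "('a, 'b) ring_scheme \<Rightarrow> 'a set \<Rightarrow> enat" where
  "prime_height R Q =
    (SUP n \<in> {n. \<exists>q :: nat \<Rightarrow> 'a set. (\<forall>i\<le>n. primeideal (q i) R) \<and>
                  (\<forall>i<n. q i \<subset> q (Suc i)) \<and> q n = Q}. enat n)"

text \<open>The infimum of the empty set in \<^typ>\<open>enat\<close> is \<open>\<infinity>\<close>, so the unit ideal has height \<open>\<infinity>\<close>.\<close>

definition height :: "('a, 'b) ring_scheme \<Rightarrow> 'a set \<Rightarrow> enat" where
  "height R I = (INF Q \<in> {Q. primeideal Q R \<and> I \<subseteq> Q}. prime_height R Q)"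


section \<open>Left modules and skew group rings\<close>

text \<open>The library locale \<^locale>\<open>module\<close> is restricted to commutative base rings.\<close>

locale left_module = S?: ring S + M?: abelian_group M
  for S :: "('s, 'c) ring_scheme" (structure) and M :: "('s, 'm, 'd) module_scheme" (structure) +
  assumes smult_closed:
      "\<lbrakk>a \<in> carrier S; x \<in> carrier M\<rbrakk> \<Longrightarrow> a \<odot>\<^bsub>M\<^esub> x \<in> carrier M"
    and smult_l_distr:
      "\<lbrakk>a \<in> carrier S; b \<in> carrier S; x \<in> carrier M\<rbrakk> \<Longrightarrow>
        (a \<oplus>\<^bsub>S\<^esub> b) \<odot>\<^bsub>M\<^esub> x = a \<odot>\<^bsub>M\<^esub> x \<oplus>\<^bsub>M\<^esub> b \<odot>\<^bsub>M\<^esub> x"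
    and smult_r_distr:
      "\<lbrakk>a \<in> carrier S; x \<in> carrier M; y \<in> carrier M\<rbrakk> \<Longrightarrow>
        a \<odot>\<^bsub>M\<^esub> (x \<oplus>\<^bsub>M\<^esub> y) = a \<odot>\<^bsub>M\<^esub> x \<oplus>\<^bsub>M\<^esub> a \<odot>\<^bsub>M\<^esub> y"
    and smult_assoc:
      "\<lbrakk>a \<in> carrier S; b \<in> carrier S; x \<in> carrier M\<rbrakk> \<Longrightarrow>
        (a \<otimes>\<^bsub>S\<^esub> b) \<odot>\<^bsub>M\<^esub> x = a \<odot>\<^bsub>M\<^esub> (b \<odot>\<^bsub>M\<^esub> x)"
    and smult_one: "x \<in> carrier M \<Longrightarrow> \<one>\<^bsub>S\<^esub> \<odot>\<^bsub>M\<^esub> x = x"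

text \<open>\<open>skew_basis G R r g\<close> is the element \<open>r g\<close> of the skew group ring.\<close>

definition skew_basis ::
  "('g, 'c) monoid_scheme \<Rightarrow> ('r, 'd) ring_scheme \<Rightarrow> 'r \<Rightarrow> 'g \<Rightarrow> ('g \<Rightarrow> 'r)" where
  "skew_basis G R r g = (\<lambda>h \<in> carrier G. if h = g then r else \<zero>\<^bsub>R\<^esub>)"

text \<open>For a finite group \<open>G\<close>, a function \<open>a\<close> from \<open>G\<close> to \<open>R\<close> encodes the formal sum of the
  \<open>a(g) g\<close>. The product is the biadditive extension of \<open>(r g) (r' g') = (r g(r')) (g g')\<close>:
  the coefficient of the product at \<open>k\<close> collects the pairs \<open>(g, g')\<close> with \<open>g g' = k\<close>.\<close>

definition skew_group_ring ::
  "('g, 'c) monoid_scheme \<Rightarrow> ('r, 'd) ring_scheme \<Rightarrow> ('g \<Rightarrow> 'r \<Rightarrow> 'r) \<Rightarrow> ('g \<Rightarrow> 'r) ring" where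
  "skew_group_ring G R \<phi> =
    \<lparr>carrier = carrier G \<rightarrow>\<^sub>E carrier R,
     monoid.mult = (\<lambda>a b. \<lambda>k \<in> carrier G.
       \<Oplus>\<^bsub>R\<^esub> g \<in> carrier G. a g \<otimes>\<^bsub>R\<^esub> \<phi> g (b (inv\<^bsub>G\<^esub> g \<otimes>\<^bsub>G\<^esub> k))),
     one = skew_basis G R \<one>\<^bsub>R\<^esub> \<one>\<^bsub>G\<^esub>,
     ring.zero = (\<lambda>k \<in> carrier G. \<zero>\<^bsub>R\<^esub>),
     add = (\<lambda>a b. \<lambda>k \<in> carrier G. a k \<oplus>\<^bsub>R\<^esub> b k)\<rparr>"

text \<open>The actions of \<open>G\<close> and of \<open>R\<close> on a module over the skew group ring.\<close>

definition group_act ::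
  "('g, 'c) monoid_scheme \<Rightarrow> ('r, 'd) ring_scheme \<Rightarrow> ('g \<Rightarrow> 'r, 'm, 'e) module_scheme \<Rightarrow>
    'g \<Rightarrow> 'm \<Rightarrow> 'm" where
  "group_act G R M g m = skew_basis G R \<one>\<^bsub>R\<^esub> g \<odot>\<^bsub>M\<^esub> m"

definition scalar_act ::
  "('g, 'c) monoid_scheme \<Rightarrow> ('r, 'd) ring_scheme \<Rightarrow> ('g \<Rightarrow> 'r, 'm, 'e) module_scheme \<Rightarrow>
    'r \<Rightarrow> 'm \<Rightarrow> 'm" where
  "scalar_act G R M r m = skew_basis G R r \<one>\<^bsub>G\<^esub> \<odot>\<^bsub>M\<^esub> m"


section \<open>Invariants and the ideals \<open>I\<^sub>R(H)\<close>\<close>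

definition invariant_ring ::
  "('g, 'c) monoid_scheme \<Rightarrow> ('r, 'd) ring_scheme \<Rightarrow> ('g \<Rightarrow> 'r \<Rightarrow> 'r) \<Rightarrow> ('r, 'd) ring_scheme" where
  "invariant_ring G R \<phi> =
    R\<lparr>carrier := {r \<in> carrier R. \<forall>g \<in> carrier G. \<phi> g r = r}\<rparr>"

definition moving_ideal ::
  "('r, 'd) ring_scheme \<Rightarrow> ('g \<Rightarrow> 'r \<Rightarrow> 'r) \<Rightarrow> 'g set \<Rightarrow> 'r set" where
  "moving_ideal R \<phi> H = Idl\<^bsub>R\<^esub> {\<phi> h r \<ominus>\<^bsub>R\<^esub> r | h r. h \<in> H \<and> r \<in> carrier R}"


section \<open>Group cohomology\<close>

text \<open>Cohomology of a group \<open>G\<close> with coefficients in an abelian group \<open>A\<close> (written additively)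
  on which \<open>G\<close> acts through \<open>act\<close>, computed from the homogeneous standard resolution:
  an \<open>n\<close>-cochain is a \<open>G\<close>-equivariant function from the \<open>(n+1)\<close>-fold power of \<open>G\<close> to \<open>A\<close>.
  Tuples are lists. Groups of cochains and of cohomology classes are written multiplicatively,
  so that the library's quotients and direct sums of groups apply; in particular the zero class
  is the unit of the respective group.\<close>

definition tuples :: "('g, 'c) monoid_scheme \<Rightarrow> nat \<Rightarrow> 'g list set" where
  "tuples G n = {gs. length gs = Suc n \<and> set gs \<subseteq> carrier G}"

definition cochains ::
  "('g, 'c) monoid_scheme \<Rightarrow> ('m, 'd) ring_scheme \<Rightarrow> ('g \<Rightarrow> 'm \<Rightarrow> 'm) \<Rightarrow> nat \<Rightarrow>
    ('g list \<Rightarrow> 'm) monoid" where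
  "cochains G A act n =
    \<lparr>carrier = {f \<in> tuples G n \<rightarrow>\<^sub>E carrier A.
       \<forall>g \<in> carrier G. \<forall>gs \<in> tuples G n. f (map (\<lambda>h. g \<otimes>\<^bsub>G\<^esub> h) gs) = act g (f gs)},
     monoid.mult = (\<lambda>f f'. \<lambda>gs \<in> tuples G n. f gs \<oplus>\<^bsub>A\<^esub> f' gs),
     one = (\<lambda>gs \<in> tuples G n. \<zero>\<^bsub>A\<^esub>)\<rparr>"

definition omit :: "nat \<Rightarrow> 'a list \<Rightarrow> 'a list" where
  "omit i xs = take i xs @ drop (Suc i) xs"

definition coboundary_map ::
  "('g, 'c) monoid_scheme \<Rightarrow> ('m, 'd) ring_scheme \<Rightarrow> nat \<Rightarrow> ('g list \<Rightarrow> 'm) \<Rightarrow> ('g list \<Rightarrow> 'm)" where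
  "coboundary_map G A n f =
    (\<lambda>gs \<in> tuples G (Suc n).
      \<Oplus>\<^bsub>A\<^esub> i \<in> {..Suc n}. if even i then f (omit i gs) else \<ominus>\<^bsub>A\<^esub> f (omit i gs))"

definition cocycles ::
  "('g, 'c) monoid_scheme \<Rightarrow> ('m, 'd) ring_scheme \<Rightarrow> ('g \<Rightarrow> 'm \<Rightarrow> 'm) \<Rightarrow> nat \<Rightarrow>
    ('g list \<Rightarrow> 'm) monoid" where
  "cocycles G A act n = (cochains G A act n)
    \<lparr>carrier := kernel (cochains G A act n) (cochains G A act (Suc n)) (coboundary_map G A n)\<rparr>"

fun coboundaries ::
  "('g, 'c) monoid_scheme \<Rightarrow> ('m, 'd) ring_scheme \<Rightarrow> ('g \<Rightarrow> 'm \<Rightarrow> 'm) \<Rightarrow> nat \<Rightarrow>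
    ('g list \<Rightarrow> 'm) set" where
  "coboundaries G A act 0 = {\<one>\<^bsub>cochains G A act 0\<^esub>}"
| "coboundaries G A act (Suc n) = coboundary_map G A n ` carrier (cochains G A act n)"

definition cohomology_group ::
  "('g, 'c) monoid_scheme \<Rightarrow> ('m, 'd) ring_scheme \<Rightarrow> ('g \<Rightarrow> 'm \<Rightarrow> 'm) \<Rightarrow> nat \<Rightarrow>
    ('g list \<Rightarrow> 'm) set monoid" where
  "cohomology_group G A act n = cocycles G A act n Mod coboundaries G A act n"

text \<open>The total cohomology is the direct sum of the groups in all degrees; its elements are not
  assumed to be homogeneous.\<close>

definition total_cohomology ::
  "('g, 'c) monoid_scheme \<Rightarrow> ('m, 'd) ring_scheme \<Rightarrow> ('g \<Rightarrow> 'm \<Rightarrow> 'm) \<Rightarrow>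
    (nat \<Rightarrow> ('g list \<Rightarrow> 'm) set) monoid" where
  "total_cohomology G A act = sum_group UNIV (cohomology_group G A act)"

text \<open>The map on total cohomology, with values in the cohomology of \<open>H\<close>, that a family \<open>F\<close>
  of maps on cochains induces. The cosets united on the right-hand side coincide if \<open>F\<close> is a
  homomorphism of cochain complexes.\<close>

definition induced_map ::
  "('h, 'c) monoid_scheme \<Rightarrow> ('m, 'd) ring_scheme \<Rightarrow> ('h \<Rightarrow> 'm \<Rightarrow> 'm) \<Rightarrow>
    (nat \<Rightarrow> ('g list \<Rightarrow> 'm) \<Rightarrow> ('h list \<Rightarrow> 'm)) \<Rightarrow>
    (nat \<Rightarrow> ('g list \<Rightarrow> 'm) set) \<Rightarrow> (nat \<Rightarrow> ('h list \<Rightarrow> 'm) set)" where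
  "induced_map H A act F x =
    (\<lambda>n. \<Union>f \<in> x n. coboundaries H A act n #>\<^bsub>cocycles H A act n\<^esub> F n f)"

definition cohomology_scalar ::
  "('g, 'c) monoid_scheme \<Rightarrow> ('r, 'd) ring_scheme \<Rightarrow> ('g \<Rightarrow> 'r, 'm, 'e) module_scheme \<Rightarrow>
    'r \<Rightarrow> (nat \<Rightarrow> ('g list \<Rightarrow> 'm) set) \<Rightarrow> (nat \<Rightarrow> ('g list \<Rightarrow> 'm) set)" where
  "cohomology_scalar G R M r =
    induced_map G M (group_act G R M) (\<lambda>n f. \<lambda>gs \<in> tuples G n. scalar_act G R M r (f gs))"

definition cohomology_annihilator ::
  "('g, 'c) monoid_scheme \<Rightarrow> ('r, 'd) ring_scheme \<Rightarrow> ('g \<Rightarrow> 'r \<Rightarrow> 'r) \<Rightarrow>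
    ('g \<Rightarrow> 'r, 'm, 'e) module_scheme \<Rightarrow> (nat \<Rightarrow> ('g list \<Rightarrow> 'm) set) \<Rightarrow> 'r set" where
  "cohomology_annihilator G R \<phi> M x =
    {r \<in> carrier (invariant_ring G R \<phi>).
      cohomology_scalar G R M r x = \<one>\<^bsub>total_cohomology G M (group_act G R M)\<^esub>}"

definition restriction ::
  "('g, 'c) monoid_scheme \<Rightarrow> ('m, 'd) ring_scheme \<Rightarrow> ('g \<Rightarrow> 'm \<Rightarrow> 'm) \<Rightarrow> 'g set \<Rightarrow>
    (nat \<Rightarrow> ('g list \<Rightarrow> 'm) set) \<Rightarrow> (nat \<Rightarrow> ('g list \<Rightarrow> 'm) set)" where
  "restriction G A act P =
    induced_map (G\<lparr>carrier := P\<rparr>) A act (\<lambda>n f. restrict f (tuples (G\<lparr>carrier := P\<rparr>) n))"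

end

theory Submission
  imports Defs
begin

text \<open>Let \<open>q\<close> be a prime of \<open>R\<^sup>G\<close> containing the annihilator of \<open>x\<close>, let \<open>Q\<close> be a prime of \<open>R\<close>
  over \<open>q\<close>, and let \<open>P\<close> be a Sylow \<open>p\<close>-subgroup of the inertia group \<open>I\<close> of \<open>Q\<close>. Then \<open>Q\<close>
  contains \<open>I\<^sub>R(P)\<close>, and by incomparability the height of \<open>Q\<close> is at most that of \<open>q\<close>. It remains
  to see that \<open>x\<close> does not restrict to zero on \<open>P\<close>. Otherwise, by transfer, the relative trace of
  every \<open>P\<close>-invariant \<open>r\<close> annihilates \<open>x\<close> and so lies in \<open>Q\<close>. Take \<open>r\<close> to be the norm over \<open>P\<close> of
  \<open>t\<close>: its relative trace is the sum over \<open>G/P\<close> of the conjugates of the norm, each of which is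
  multiplicative in \<open>t\<close>. The conjugates that coincide with the norm itself modulo \<open>Q\<close> are exactly
  those from \<open>I/P\<close>, whose number is prime to \<open>p\<close>, which contradicts the linear independence of
  characters with values in \<open>R/Q\<close>.\<close>

section \<open>Prime ideals\<close>

text \<open>Independence of characters needs multiplicative functions, whereas a relative trace is
  only additive in its argument. The norm over \<open>P\<close> bridges this: it makes a
  \<open>P\<close>-invariant of every \<open>t\<close> in \<open>R\<close>, at the price of an
  exponent. Since \<open>P\<close> acts trivially on \<open>R/Q\<close>, the norm is the
  \<open>|P|\<close>-th power modulo \<open>Q\<close>; it is a power of \<open>p\<close>, so
  injectivity of Frobenius removes it again. A Sylow subgroup of the inertia group balances two
  demands: it is small enough for \<open>moving_ideal R \<phi> P\<close> to lie in \<open>Q\<close>,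
  and large enough for its index in the inertia group to stay nonzero in \<open>R/Q\<close>. Norms
  over all of \<open>G\<close> also do the work of integral equations in lying over and
  incomparability. The obstacle in the transfer is that triviality on \<open>P\<close> gives a
  primitive on tuples from \<open>P\<close> only, while summing over cosets needs a
  \<open>P\<close>-equivariant primitive on tuples from \<open>G\<close>. A
  \<open>P\<close>-equivariant map from \<open>G\<close> to \<open>P\<close> and a prism homotopy
  provide it.\<close>

lemma (in ideal) minus_mem: "a \<in> I \<Longrightarrow> b \<in> I \<Longrightarrow> a \<ominus> b \<in> I"
  by (simp add: a_minus_def)

lemma (in primeideal) finprod_mem_iff:
  assumes "finite A" "f \<in> A \<rightarrow> carrier R"
  shows "finprod R f A \<in> I \<longleftrightarrow> (\<exists>a\<in>A. f a \<in> I)"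
  using assms
proof (induction A)
  case empty
  have "\<one> \<notin> I" using one_imp_carrier I_notcarr by blast
  then show ?case by simp
next
  case (insert a A)
  have c: "f a \<in> carrier R" "finprod R f A \<in> carrier R"
    using insert.prems by (auto intro!: finprod_closed)
  have "f a \<otimes> finprod R f A \<in> I \<longleftrightarrow> f a \<in> I \<or> finprod R f A \<in> I"
    using c I_prime I_l_closed I_r_closed by blast
  moreover have "finprod R f (insert a A) = f a \<otimes> finprod R f A"
    using insert by (intro finprod_insert) auto
  ultimately show ?case using insert by auto
qed

lemma (in primeideal) pow_mem:
  assumes "x \<in> carrier R" "x [^] (n::nat) \<in> I"
  shows "x \<in> I"
  using assms(2)
proof (induction n)
  case 0
  then have "\<one> \<in> I" by simp
  then show ?case using one_imp_carrier I_notcarr by blast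
next
  case (Suc n)
  then show ?case using I_prime[of "x [^] n" x] assms(1) by auto
qed

text \<open>If \<open>I\<close> lies in no single member, the induction hypothesis yields for each
  \<open>Q\<close> an element \<open>a Q\<close> of \<open>I\<close> that lies in \<open>Q\<close>
  and in no other member. Then \<open>a Q\<close> plus the product of the remaining
  \<open>a Q'\<close> is in \<open>I\<close> but in no member at all.\<close>

lemma (in cring) prime_avoidance:
  assumes "ideal I R" "finite A" "\<And>Q. Q \<in> A \<Longrightarrow> primeideal Q R" "I \<subseteq> \<Union>A"
  shows "\<exists>Q\<in>A. I \<subseteq> Q"
  using assms(2-)
proof (induction A rule: finite_psubset_induct)
  case (psubset A)
  interpret I: ideal I R by fact
  show ?case
  proof (rule ccontr)
    assume contra: "\<not> (\<exists>Q\<in>A. I \<subseteq> Q)"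
    have "\<exists>a\<in>I. a \<notin> \<Union>(A - {Q})" if "Q \<in> A" for Q
    proof (rule ccontr)
      assume "\<not> ?thesis"
      then have "I \<subseteq> \<Union>(A - {Q})" by blast
      then have "\<exists>Q'\<in>A - {Q}. I \<subseteq> Q'"
        using that psubset.prems(1) by (intro psubset.IH) auto
      then show False using contra by blast
    qed
    then obtain a where a: "a Q \<in> I" "a Q \<notin> \<Union>(A - {Q})" if "Q \<in> A" for Q
      by metis
    have aQ: "a Q \<in> Q" if "Q \<in> A" for Q
      using a[OF that] psubset.prems(2) by blast
    have ac: "a Q \<in> carrier R" if "Q \<in> A" for Q
      using a[OF that] I.Icarr by blast
    obtain Q where Q: "Q \<in> A"
      using psubset.prems(2) I.zero_closed by blast
    then interpret Q: primeideal Q R by (rule psubset.prems)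
    show False
    \<comment> \<open>If \<open>Q\<close> were alone, \<open>b\<close> below would be the empty
      product 1, which need not lie in \<open>I\<close>.\<close>
    proof (cases "A = {Q}")
      case True
      then show False using psubset.prems(2) contra by blast
    next
      case False
      define b where "b = finprod R a (A - {Q})"
      have fin: "finite (A - {Q})" using psubset.hyps by simp
      have fc: "a \<in> (A - {Q}) \<rightarrow> carrier R" using ac by blast
      have bc: "b \<in> carrier R" unfolding b_def using fc by (rule finprod_closed)
      have bQ: "b \<notin> Q"
        unfolding b_def Q.finprod_mem_iff[OF fin fc] using a Q by blast
      have bQ': "b \<in> Q'" if "Q' \<in> A" "Q' \<noteq> Q" for Q'
      proof -
        interpret Q': primeideal Q' R using that psubset.prems by blast
        show ?thesis unfolding b_def Q'.finprod_mem_iff[OF fin fc] using that aQ by blast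
      qed
      obtain Q1 where Q1: "Q1 \<in> A - {Q}" using False Q by blast
      have bI: "b \<in> I"
      proof -
        have "b = a Q1 \<otimes> finprod R a (A - {Q} - {Q1})"
          unfolding b_def using fin fc Q1
          by (subst finprod_insert[symmetric]) (auto simp: insert_absorb)
        moreover have "finprod R a (A - {Q} - {Q1}) \<in> carrier R"
          using fc by (intro finprod_closed) auto
        ultimately show ?thesis using I.I_r_closed a Q1 by simp
      qed
      have "a Q \<oplus> b \<in> I" using bI a Q I.a_closed by simp
      then obtain Q' where Q': "Q' \<in> A" "a Q \<oplus> b \<in> Q'" using psubset.prems(2) by blast
      interpret Q': primeideal Q' R using Q' psubset.prems by blast
      show False
      proof (cases "Q' = Q")
        case True
        then have "(a Q \<oplus> b) \<ominus> a Q \<in> Q" using Q' aQ[OF Q] Q.minus_mem by simp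
        moreover have "(a Q \<oplus> b) \<ominus> a Q = b" using ac Q bc by algebra
        ultimately show False using bQ by simp
      next
        case False
        then have "(a Q \<oplus> b) \<ominus> b \<in> Q'" using Q' bQ' Q'.minus_mem by simp
        moreover have "(a Q \<oplus> b) \<ominus> b = a Q" using ac Q bc by algebra
        ultimately show False using a[OF Q] Q' False by auto
      qed
    qed
  qed
qed

text \<open>Zorn: stability under \<open>K\<close> passes to unions of chains. \<open>K\<close> is a
  parameter because lying over uses the lemma twice, once with the maps of the group and once with
  \<open>K = {}\<close> to reach a prime.\<close>

lemma (in ring) exists_maximal_stable_ideal:
  assumes "ideal J R" "J \<inter> S = {}" "\<And>f. f \<in> K \<Longrightarrow> f ` J \<subseteq> J"
  obtains I where "ideal I R" "J \<subseteq> I" "I \<inter> S = {}" "\<And>f. f \<in> K \<Longrightarrow> f ` I \<subseteq> I"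
    "\<And>I'. ideal I' R \<Longrightarrow> I \<subseteq> I' \<Longrightarrow> I' \<inter> S = {} \<Longrightarrow> (\<And>f. f \<in> K \<Longrightarrow> f ` I' \<subseteq> I') \<Longrightarrow> I' = I"
proof -
  let ?\<I> = "{I. ideal I R \<and> J \<subseteq> I \<and> I \<inter> S = {} \<and> (\<forall>f\<in>K. f ` I \<subseteq> I)}"
  have "\<exists>I\<in>?\<I>. \<forall>I'\<in>?\<I>. I \<subseteq> I' \<longrightarrow> I' = I"
  proof (rule subset_Zorn)
    fix C assume C: "subset.chain ?\<I> C"
    show "\<exists>U\<in>?\<I>. \<forall>Y\<in>C. Y \<subseteq> U"
    proof (cases "C = {}")
      case True
      then show ?thesis using assms by blast
    next
      case False
      have sub: "C \<subseteq> ?\<I>" using C unfolding pred_on.chain_def by blast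
      then have "subset.chain {I. ideal I R} C"
        using C unfolding pred_on.chain_def by auto
      from chain_Union_is_ideal[OF this] have "ideal (\<Union>C) R" using False by simp
      moreover have "J \<subseteq> \<Union>C" using sub False by blast
      moreover have "\<forall>f\<in>K. f ` \<Union>C \<subseteq> \<Union>C"
        using sub by fastforce
      moreover have "\<Union>C \<inter> S = {}" using sub by fastforce
      ultimately have "\<Union>C \<in> ?\<I>" by simp
      then show ?thesis by (rule bexI[rotated]) (simp add: Union_upper)
    qed
  qed
  then obtain I where I: "I \<in> ?\<I>" "\<forall>I'\<in>?\<I>. I \<subseteq> I' \<longrightarrow> I' = I" ..
  show ?thesis
  proof (rule that[of I])
    fix I' assume I': "ideal I' R" "I \<subseteq> I'" "I' \<inter> S = {}" "\<And>f. f \<in> K \<Longrightarrow> f ` I' \<subseteq> I'"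
    moreover have "J \<subseteq> I'" using I(1) I'(2) by auto
    ultimately have "I' \<in> ?\<I>" by simp
    with I(2) I'(2) show "I' = I" by (simp only: Ball_def)
  qed (use I(1) in auto)
qed

text \<open>The two products have the same image in \<open>R Quot I\<close>, where their factors
  coincide.\<close>

lemma (in ideal) finprod_minus_mem:
  assumes "cring R" "f \<in> A \<rightarrow> carrier R" "h \<in> A \<rightarrow> carrier R"
    "\<And>a. a \<in> A \<Longrightarrow> f a \<ominus> h a \<in> I"
  shows "finprod R f A \<ominus> finprod R h A \<in> I"
proof -
  interpret cring R by fact
  interpret hom: ring_hom_cring R "R Quot I" "(+>) I"
    using rcos_ring_hom_cring[OF assms(1)] .
  have "finprod (R Quot I) ((+>) I \<circ> f) A = finprod (R Quot I) ((+>) I \<circ> h) A"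
  proof (rule hom.S.finprod_cong')
    show "(+>) I \<circ> h \<in> A \<rightarrow> carrier (R Quot I)"
      using assms(3) hom.hom_closed by fastforce
    show "((+>) I \<circ> f) a = ((+>) I \<circ> h) a" if "a \<in> A" for a
    proof -
      have "f a \<in> carrier R" "h a \<in> carrier R" using assms that by auto
      from quotient_eq_iff_same_a_r_cos[OF is_ideal this] show ?thesis
        using assms(4)[OF that] by simp
    qed
  qed simp
  then have "I +> finprod R f A = I +> finprod R h A"
    using assms by (simp add: hom.hom_finprod comp_def)
  then show ?thesis
    using quotient_eq_iff_same_a_r_cos[OF is_ideal, of "finprod R f A" "finprod R h A"] assms
    by (simp add: finprod_closed)
qed

section \<open>Finite groups acting on commutative rings\<close>

locale finite_ring_action = G: group G + cring R
  for G :: "('g, 'c) monoid_scheme" and R :: "('r, 'd) ring_scheme" (structure)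
    and \<phi> :: "'g \<Rightarrow> 'r \<Rightarrow> 'r" +
  assumes finite_group: "finite (carrier G)"
    and act_hom: "g \<in> carrier G \<Longrightarrow> \<phi> g \<in> ring_hom R R"
    and act_one: "r \<in> carrier R \<Longrightarrow> \<phi> \<one>\<^bsub>G\<^esub> r = r"
    and act_mult: "g \<in> carrier G \<Longrightarrow> h \<in> carrier G \<Longrightarrow> r \<in> carrier R \<Longrightarrow>
      \<phi> (g \<otimes>\<^bsub>G\<^esub> h) r = \<phi> g (\<phi> h r)"
begin

abbreviation fixed :: "'r set" where
  "fixed \<equiv> carrier (invariant_ring G R \<phi>)"

lemma fixed_iff: "r \<in> fixed \<longleftrightarrow> r \<in> carrier R \<and> (\<forall>g\<in>carrier G. \<phi> g r = r)"
  by (simp add: invariant_ring_def)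

lemma act_hom_cring: "g \<in> carrier G \<Longrightarrow> ring_hom_cring R R (\<phi> g)"
  using act_hom is_cring by (intro ring_hom_cring.intro ring_hom_cring_axioms.intro)

lemma act_closed [simp, intro]: "g \<in> carrier G \<Longrightarrow> r \<in> carrier R \<Longrightarrow> \<phi> g r \<in> carrier R"
  using act_hom ring_hom_closed by fast

lemma act_inv_act [simp]:
  assumes "g \<in> carrier G" "r \<in> carrier R"
  shows "\<phi> (inv\<^bsub>G\<^esub> g) (\<phi> g r) = r" "\<phi> g (\<phi> (inv\<^bsub>G\<^esub> g) r) = r"
  using assms act_mult[of "inv\<^bsub>G\<^esub> g" g r] act_mult[of g "inv\<^bsub>G\<^esub> g" r] act_one by auto

lemma fixed_subcring: "subcring fixed R"
proof (rule subcringI)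
  show "subring fixed R"
  proof (rule subringI)
    fix a b assume "a \<in> fixed" "b \<in> fixed"
    then show "a \<oplus> b \<in> fixed" "a \<otimes> b \<in> fixed" "\<ominus> a \<in> fixed"
      using ring_hom_cring.hom_a_inv[OF act_hom_cring] ring_hom_mult[OF act_hom] ring_hom_add[OF act_hom]
      by (auto simp: fixed_iff)
  qed (auto simp: fixed_iff ring_hom_one[OF act_hom])
qed (auto simp: fixed_iff m_comm)

lemma invariant_ring_ops [simp]:
  "a \<oplus>\<^bsub>invariant_ring G R \<phi>\<^esub> b = a \<oplus> b"
  "a \<otimes>\<^bsub>invariant_ring G R \<phi>\<^esub> b = a \<otimes> b"
  "\<one>\<^bsub>invariant_ring G R \<phi>\<^esub> = \<one>"
  "\<zero>\<^bsub>invariant_ring G R \<phi>\<^esub> = \<zero>"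
  by (simp_all add: invariant_ring_def)

lemma cring_invariant_ring: "cring (invariant_ring G R \<phi>)"
proof -
  have "invariant_ring G R \<phi> = R\<lparr>carrier := fixed\<rparr>" by (simp add: invariant_ring_def)
  then show ?thesis using fixed_subcring subcring_iff[of fixed] by (metis subcringE(1))
qed

lemma primeideal_contract:
  assumes "primeideal Q R"
  shows "primeideal (Q \<inter> fixed) (invariant_ring G R \<phi>)"
proof -
  interpret RG: cring "invariant_ring G R \<phi>" by (rule cring_invariant_ring)
  interpret id: ring_hom_ring "invariant_ring G R \<phi>" R id
    using subcringE(1)[OF fixed_subcring]
    by (intro ring_hom_ringI2 RG.ring_axioms ring_axioms ring_hom_memI) auto
  have "{r \<in> fixed. id r \<in> Q} = Q \<inter> fixed" by auto
  then show ?thesis using id.primeideal_vimage[OF RG.is_cring assms] by simp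
qed

section \<open>Norms over subsets of the group\<close>

definition norm_over :: "'g set \<Rightarrow> 'r \<Rightarrow> 'r" where
  "norm_over P r = (\<Otimes>h\<in>P. \<phi> h r)"

lemma norm_over_closed:
  "P \<subseteq> carrier G \<Longrightarrow> r \<in> carrier R \<Longrightarrow> norm_over P r \<in> carrier R"
  unfolding norm_over_def by (intro finprod_closed) auto

text \<open>Left translation by \<open>g\<close> permutes the subgroup \<open>P\<close>, hence the
  factors of the norm.\<close>

lemma act_norm_over:
  assumes "subgroup P G" "g \<in> P" "r \<in> carrier R"
  shows "\<phi> g (norm_over P r) = norm_over P r"
proof -
  interpret P: subgroup P G by fact
  have g: "g \<in> carrier G" using assms P.subset by auto
  have P: "P = (\<lambda>h. g \<otimes>\<^bsub>G\<^esub> h) ` P"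
  proof
    show "(\<lambda>h. g \<otimes>\<^bsub>G\<^esub> h) ` P \<subseteq> P" using assms by auto
    show "P \<subseteq> (\<lambda>h. g \<otimes>\<^bsub>G\<^esub> h) ` P"
    proof
      fix h assume "h \<in> P"
      then have "h = g \<otimes>\<^bsub>G\<^esub> (inv\<^bsub>G\<^esub> g \<otimes>\<^bsub>G\<^esub> h)" "inv\<^bsub>G\<^esub> g \<otimes>\<^bsub>G\<^esub> h \<in> P"
        using assms g P.mem_carrier by (auto simp: G.m_assoc[symmetric])
      then show "h \<in> (\<lambda>h. g \<otimes>\<^bsub>G\<^esub> h) ` P" by blast
    qed
  qed
  have "norm_over P r = (\<Otimes>h\<in>(\<lambda>h. g \<otimes>\<^bsub>G\<^esub> h) ` P. \<phi> h r)"
    unfolding norm_over_def using P by simp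
  also have "\<dots> = (\<Otimes>h\<in>P. \<phi> (g \<otimes>\<^bsub>G\<^esub> h) r)"
    using assms g P.mem_carrier
    by (intro finprod_reindex) (auto simp: inj_on_def)
  also have "\<dots> = (\<Otimes>h\<in>P. \<phi> g (\<phi> h r))"
    using assms g P.mem_carrier by (intro finprod_cong') (auto simp: act_mult)
  also have "\<dots> = \<phi> g (norm_over P r)"
    unfolding norm_over_def using assms P.mem_carrier
    by (subst ring_hom_cring.hom_finprod[OF act_hom_cring[OF g]]) (auto simp: comp_def)
  finally show ?thesis by simp
qed

lemma norm_over_mult:
  assumes "P \<subseteq> carrier G" "r \<in> carrier R" "s \<in> carrier R"
  shows "norm_over P (r \<otimes> s) = norm_over P r \<otimes> norm_over P s"
proof -
  have "(\<Otimes>h\<in>P. \<phi> h (r \<otimes> s)) = (\<Otimes>h\<in>P. \<phi> h r \<otimes> \<phi> h s)"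
    using assms ring_hom_mult[OF act_hom] by (intro finprod_cong') (auto simp: subset_iff)
  also have "\<dots> = norm_over P r \<otimes> norm_over P s"
    unfolding norm_over_def using assms by (intro finprod_multf) auto
  finally show ?thesis by (simp add: norm_over_def)
qed

lemma norm_over_one: "P \<subseteq> carrier G \<Longrightarrow> norm_over P \<one> = \<one>"
  unfolding norm_over_def using ring_hom_one[OF act_hom] by (intro finprod_one_eqI) auto

lemma norm_over_mem_iff:
  assumes "primeideal Q R" "P \<subseteq> carrier G" "r \<in> carrier R"
  shows "norm_over P r \<in> Q \<longleftrightarrow> (\<exists>h\<in>P. \<phi> h r \<in> Q)"
  unfolding norm_over_def using assms finite_subset[OF _ finite_group]
  by (intro primeideal.finprod_mem_iff) auto

lemma norm_over_fixed: "r \<in> carrier R \<Longrightarrow> norm_over (carrier G) r \<in> fixed"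
  using act_norm_over[OF G.subgroup_self] norm_over_closed[of "carrier G"] by (simp add: fixed_iff)

lemma norm_over_const:
  assumes "P \<subseteq> carrier G" "r \<in> fixed"
  shows "norm_over P r = r [^] card P"
proof -
  have "(\<Otimes>h\<in>P. \<phi> h r) = (\<Otimes>h\<in>P. r)"
    using assms by (intro finprod_cong') (auto simp: fixed_iff)
  also have "\<dots> = r [^] card P" using assms by (intro finprod_const) (simp add: fixed_iff)
  finally show ?thesis by (simp add: norm_over_def)
qed

text \<open>Since \<open>g\<close> has finite order, its inverse is a power of \<open>g\<close> and
  therefore preserves \<open>Q\<close> as well.\<close>

lemma act_stable_imp_mem:
  assumes "g \<in> carrier G" "Q \<subseteq> carrier R" "\<phi> g ` Q \<subseteq> Q" "r \<in> carrier R" "\<phi> g r \<in> Q"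
  shows "r \<in> Q"
proof -
  have *: "\<phi> (g [^]\<^bsub>G\<^esub> (n::nat)) s \<in> Q" if "s \<in> Q" for n s
    using that
  proof (induction n arbitrary: s)
    case 0
    then show ?case using act_one assms by auto
  next
    case (Suc n)
    have "\<phi> (g [^]\<^bsub>G\<^esub> Suc n) s = \<phi> (g [^]\<^bsub>G\<^esub> n) (\<phi> g s)"
      using assms Suc.prems by (auto simp: act_mult)
    then show ?case using Suc assms by auto
  qed
  have "g [^]\<^bsub>G\<^esub> (order G - 1) \<otimes>\<^bsub>G\<^esub> g = \<one>\<^bsub>G\<^esub>"
    using G.pow_order_eq_1[OF assms(1)] G.order_gt_0_iff_finite finite_group
    by (metis G.nat_pow_Suc Suc_diff_1)
  then have "g [^]\<^bsub>G\<^esub> (order G - 1) = inv\<^bsub>G\<^esub> g"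
    using assms G.inv_equality G.inv_inv by (metis G.inv_closed G.inv_unique' G.nat_pow_closed)
  then have "\<phi> (inv\<^bsub>G\<^esub> g) (\<phi> g r) \<in> Q" using *[of "\<phi> g r" "order G - 1"] assms by simp
  then show ?thesis using assms by simp
qed

section \<open>Lying over, incomparability and comparison of heights\<close>

text \<open>Among the \<open>G\<close>-stable ideals that avoid the invariants outside
  \<open>q\<close>, a maximal one \<open>J\<close> already contains \<open>q\<close>; an ordinary
  maximal ideal \<open>Q\<close> over \<open>J\<close> avoiding the same set is prime and contracts
  to \<open>q\<close>. Stability is what lets norms be compared modulo \<open>J\<close>.\<close>

theorem lying_over:
  assumes "primeideal q (invariant_ring G R \<phi>)"
  obtains Q where "primeideal Q R" "Q \<inter> fixed = q"
proof -
  interpret q: primeideal q "invariant_ring G R \<phi>" by fact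
  have qf: "q \<subseteq> fixed" using q.a_subset .
  have fR: "fixed \<subseteq> carrier R" by (auto simp: fixed_iff)
  have one_q: "\<one> \<notin> q" using q.one_imp_carrier q.I_notcarr by auto
  define S where "S = fixed - q"
  have q_zero: "\<zero> \<in> q" using additive_subgroup.zero_closed[OF q.additive_subgroup_axioms] by simp
  obtain J where J: "ideal J R" "J \<inter> S = {}" "\<And>f. f \<in> \<phi> ` carrier G \<Longrightarrow> f ` J \<subseteq> J"
    and Jmax: "\<And>I. ideal I R \<Longrightarrow> J \<subseteq> I \<Longrightarrow> I \<inter> S = {} \<Longrightarrow>
      (\<And>f. f \<in> \<phi> ` carrier G \<Longrightarrow> f ` I \<subseteq> I) \<Longrightarrow> I = J"
  proof (rule exists_maximal_stable_ideal[of "{\<zero>}" S "\<phi> ` carrier G"])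
    show "ideal {\<zero>} R" by (rule zeroideal)
    show "{\<zero>} \<inter> S = {}" using q_zero by (auto simp: S_def)
    show "f ` {\<zero>} \<subseteq> {\<zero>}" if "f \<in> \<phi> ` carrier G" for f
      using that ring_hom_cring.hom_zero[OF act_hom_cring] by auto
  qed blast
  interpret J: ideal J R by fact
  have mem_sum: "x \<in> I <+>\<^bsub>R\<^esub> PIdl a \<longleftrightarrow> (\<exists>y\<in>I. \<exists>r\<in>carrier R. x = y \<oplus> r \<otimes> a)" for x a I
    unfolding set_add_def' cgenideal_def by blast
  have sum_ideal: "ideal (I <+>\<^bsub>R\<^esub> PIdl a) R" "I \<subseteq> I <+>\<^bsub>R\<^esub> PIdl a" "a \<in> I <+>\<^bsub>R\<^esub> PIdl a"
    if "ideal I R" "a \<in> carrier R" for I a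
  proof -
    interpret I: ideal I R by fact
    interpret P: ideal "PIdl a" R using that by (intro cgenideal_ideal)
    show "ideal (I <+>\<^bsub>R\<^esub> PIdl a) R" by (intro add_ideals I.is_ideal P.is_ideal)
    have z: "\<zero> \<in> I" "\<zero> \<in> PIdl a"
      using additive_subgroup.zero_closed[OF I.additive_subgroup_axioms]
        additive_subgroup.zero_closed[OF P.additive_subgroup_axioms] by auto
    have "x \<in> I <+>\<^bsub>R\<^esub> PIdl a" if "x \<in> I" for x
    proof -
      have "x \<oplus> \<zero> \<in> I <+>\<^bsub>R\<^esub> PIdl a" using that z unfolding set_add_def' by blast
      then show ?thesis using I.Icarr[OF that] by simp
    qed
    then show "I \<subseteq> I <+>\<^bsub>R\<^esub> PIdl a" by blast
    have "\<zero> \<oplus> a \<in> I <+>\<^bsub>R\<^esub> PIdl a"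
      using z cgenideal_self[OF that(2)] unfolding set_add_def' by blast
    then show "a \<in> I <+>\<^bsub>R\<^esub> PIdl a" using that(2) by simp
  qed
  have qJ: "q \<subseteq> J"
  proof
    fix a assume a: "a \<in> q"
    then have af: "a \<in> fixed" and aR: "a \<in> carrier R" using qf fR by auto
    \<comment> \<open>An invariant \<open>s = y + r a\<close> outside \<open>q\<close> would satisfy
      \<open>N(s) = s^|G|\<close> and \<open>N(r a) = N(r) a^|G|\<close>, two invariants congruent
      modulo \<open>J\<close>. The second lies in \<open>q\<close>, so a power of \<open>s\<close>
      would too.\<close>
    have "(J <+>\<^bsub>R\<^esub> PIdl a) \<inter> S = {}"
    proof (rule ccontr)
      assume "(J <+>\<^bsub>R\<^esub> PIdl a) \<inter> S \<noteq> {}"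
      then obtain y r where y: "y \<in> J" and r: "r \<in> carrier R" and s: "y \<oplus> r \<otimes> a \<in> S"
        using mem_sum by auto
      define s where "s = y \<oplus> r \<otimes> a"
      have sf: "s \<in> fixed" "s \<notin> q" "s \<in> carrier R" using s fR by (auto simp: S_def s_def)
      have yR: "y \<in> carrier R" using y J.Icarr by simp
      have N: "norm_over (carrier G) (r \<otimes> a) = norm_over (carrier G) r \<otimes> a [^] card (carrier G)"
        using r aR af by (simp add: norm_over_mult norm_over_const)
      \<comment> \<open>The exponent must be positive for the power of \<open>a\<close> to lie in
        \<open>q\<close>.\<close>
      have "card (carrier G) \<noteq> 0" using finite_group by auto
      then obtain n where n: "card (carrier G) = Suc n" using not0_implies_Suc by blast
      have fixed_mult: "u \<otimes> v \<in> fixed" if "u \<in> fixed" "v \<in> fixed" for u v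
        using subcringE(6)[OF fixed_subcring] that by blast
      have fixed_pow: "u [^] (m::nat) \<in> fixed" if "u \<in> fixed" for u m
        using that subcringE(3)[OF fixed_subcring] fixed_mult by (induction m) auto
      have q_mult: "u \<otimes> v \<in> q" if "u \<in> fixed" "v \<in> q" for u v
        using q.I_l_closed[of v u] that by simp
      have "a [^] card (carrier G) \<in> q"
        unfolding n using q_mult[OF fixed_pow[OF af] a, of n] by simp
      then have Nq: "norm_over (carrier G) (r \<otimes> a) \<in> q"
        unfolding N using q_mult norm_over_fixed r by simp
      \<comment> \<open>The factors differ by \<open>\<phi> g y\<close>, which is in
        \<open>J\<close> because \<open>J\<close> is \<open>G\<close>-stable.\<close>
      have "norm_over (carrier G) s \<ominus> norm_over (carrier G) (r \<otimes> a) \<in> J"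
        unfolding norm_over_def
      proof (rule J.finprod_minus_mem[OF is_cring])
        fix g assume g: "g \<in> carrier G"
        have "\<phi> g s \<ominus> \<phi> g (r \<otimes> a) = \<phi> g y"
        proof -
          have "\<phi> g s = \<phi> g y \<oplus> \<phi> g (r \<otimes> a)"
            unfolding s_def using g r aR yR by (intro ring_hom_add[OF act_hom]) auto
          moreover have "\<phi> g y \<in> carrier R" "\<phi> g (r \<otimes> a) \<in> carrier R" using g r aR yR by auto
          ultimately show ?thesis by algebra
        qed
        then show "\<phi> g s \<ominus> \<phi> g (r \<otimes> a) \<in> J" using J(3)[of "\<phi> g"] g y by auto
      qed (use sf r aR in auto)
      then have d: "s [^] card (carrier G) \<ominus> norm_over (carrier G) (r \<otimes> a) \<in> J"
        using norm_over_const[of "carrier G" s] sf by simp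
      have N2: "norm_over (carrier G) (r \<otimes> a) \<in> fixed" using norm_over_fixed r aR by simp
      then have "s [^] card (carrier G) \<ominus> norm_over (carrier G) (r \<otimes> a) \<in> fixed"
        using fixed_pow[OF sf(1)] subcringE(5,7)[OF fixed_subcring] unfolding a_minus_def by blast
      \<comment> \<open>An invariant element of \<open>J\<close> belongs to \<open>q\<close>, since
        \<open>J\<close> avoids \<open>S\<close>.\<close>
      with d J(2) have "s [^] card (carrier G) \<ominus> norm_over (carrier G) (r \<otimes> a) \<in> q"
        unfolding S_def by blast
      then have "(s [^] card (carrier G) \<ominus> norm_over (carrier G) (r \<otimes> a))
        \<oplus> norm_over (carrier G) (r \<otimes> a) \<in> q"
        using additive_subgroup.a_closed[OF q.additive_subgroup_axioms _ Nq] by simp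
      moreover have "(u \<ominus> v) \<oplus> v = u" if "u \<in> carrier R" "v \<in> carrier R" for u v
        using that by algebra
      ultimately have "s [^] card (carrier G) \<in> q" using sf N2 fR by auto
      moreover have "s [^]\<^bsub>invariant_ring G R \<phi>\<^esub> card (carrier G) = s [^] card (carrier G)"
        by (simp add: nat_pow_def)
      ultimately show False using q.pow_mem[of s "card (carrier G)"] sf by simp
    qed
    \<comment> \<open>Enlarging \<open>J\<close> by \<open>a\<close> keeps it stable because
      \<open>a\<close> is invariant: the group maps multiples of \<open>a\<close> to multiples of
      \<open>a\<close>.\<close>
    moreover have "f ` (J <+>\<^bsub>R\<^esub> PIdl a) \<subseteq> J <+>\<^bsub>R\<^esub> PIdl a" if f: "f \<in> \<phi> ` carrier G" for f
    proof
      fix x assume "x \<in> f ` (J <+>\<^bsub>R\<^esub> PIdl a)"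
      then obtain y r where y: "y \<in> J" and r: "r \<in> carrier R" and x: "x = f (y \<oplus> r \<otimes> a)"
        using mem_sum by auto
      obtain g where g: "g \<in> carrier G" "f = \<phi> g" using f by blast
      have "x = \<phi> g y \<oplus> \<phi> g r \<otimes> a"
        using x y r g aR af J.Icarr ring_hom_add[OF act_hom] ring_hom_mult[OF act_hom]
        by (simp add: fixed_iff)
      moreover have "\<phi> g y \<in> J" using J(3)[OF f] y g by auto
      moreover have "\<phi> g r \<in> carrier R" using r g by simp
      ultimately show "x \<in> J <+>\<^bsub>R\<^esub> PIdl a" unfolding mem_sum by blast
    qed
    ultimately have "J <+>\<^bsub>R\<^esub> PIdl a = J"
      using sum_ideal[OF J(1) aR] by (intro Jmax) auto
    then show "a \<in> J" using sum_ideal[OF J(1) aR] by simp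
  qed
  \<comment> \<open>Stability is now given up: with \<open>K = {}\<close>, an ideal maximal with
    respect to avoiding the multiplicative set \<open>S\<close> is prime.\<close>
  obtain Q where Q: "ideal Q R" "J \<subseteq> Q" "Q \<inter> S = {}"
    and Qmax: "\<And>I. ideal I R \<Longrightarrow> Q \<subseteq> I \<Longrightarrow> I \<inter> S = {} \<Longrightarrow> I = Q"
    by (rule exists_maximal_stable_ideal[of J S "{}"]) (use J in auto)
  interpret Q: ideal Q R by fact
  have "primeideal Q R"
  proof (rule primeidealI[OF Q(1) is_cring])
    have "\<one> \<in> S" using one_q subcringE(3)[OF fixed_subcring] by (simp add: S_def)
    then show "carrier R \<noteq> Q" using Q(3) by auto
    fix a b assume ab: "a \<in> carrier R" "b \<in> carrier R" "a \<otimes> b \<in> Q"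
    have meets: "\<exists>y\<in>Q. \<exists>r\<in>carrier R. y \<oplus> r \<otimes> c \<in> S" if "c \<in> carrier R" "c \<notin> Q" for c
    proof -
      have "(Q <+>\<^bsub>R\<^esub> PIdl c) \<inter> S \<noteq> {}"
        using Qmax[of "Q <+>\<^bsub>R\<^esub> PIdl c"] sum_ideal[OF Q(1) that(1)] that(2) by auto
      then show ?thesis using mem_sum by auto
    qed
    show "a \<in> Q \<or> b \<in> Q"
    proof (rule ccontr)
      assume "\<not> ?thesis"
      then obtain y r z t where yr: "y \<in> Q" "r \<in> carrier R" "y \<oplus> r \<otimes> a \<in> S"
        "z \<in> Q" "t \<in> carrier R" "z \<oplus> t \<otimes> b \<in> S"
        using meets ab by metis
      have yz: "y \<in> carrier R" "z \<in> carrier R" using yr Q.Icarr by auto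
      have eq: "(y \<oplus> r \<otimes> a) \<otimes> (z \<oplus> t \<otimes> b)
          = y \<otimes> (z \<oplus> t \<otimes> b) \<oplus> ((r \<otimes> a) \<otimes> z \<oplus> (r \<otimes> t) \<otimes> (a \<otimes> b))"
        using yr yz ab by algebra
      have "y \<otimes> (z \<oplus> t \<otimes> b) \<in> Q" "(r \<otimes> a) \<otimes> z \<in> Q" "(r \<otimes> t) \<otimes> (a \<otimes> b) \<in> Q"
        using yr yz ab by (auto intro: Q.I_l_closed Q.I_r_closed)
      then have "(y \<oplus> r \<otimes> a) \<otimes> (z \<oplus> t \<otimes> b) \<in> Q"
        unfolding eq by (intro additive_subgroup.a_closed[OF Q.additive_subgroup_axioms])
      moreover have "(y \<oplus> r \<otimes> a) \<otimes> (z \<oplus> t \<otimes> b) \<in> S"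
        using yr q.I_prime subcringE(6)[OF fixed_subcring] by (auto simp: S_def)
      ultimately show False using Q(3) by blast
    qed
  qed
  moreover have "Q \<inter> fixed = q" using qJ Q qf by (auto simp: S_def)
  ultimately show thesis by (rule that)
qed

text \<open>For \<open>r\<close> in \<open>Q2\<close> the norm over \<open>G\<close> is an invariant
  of \<open>Q2\<close>, hence in \<open>Q1\<close>, so some conjugate of \<open>r\<close> is in
  \<open>Q1\<close>. Prime avoidance makes one \<open>g\<close> work for all \<open>r\<close>. As
  \<open>Q1\<close> is contained in \<open>Q2\<close>, this \<open>g\<close> maps \<open>Q1\<close>
  into itself, and finite order turns that into \<open>Q2 \<subseteq> Q1\<close>.\<close>

theorem incomparability:
  assumes "primeideal Q1 R" "primeideal Q2 R" "Q1 \<subseteq> Q2" "Q2 \<inter> fixed \<subseteq> Q1"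
  shows "Q1 = Q2"
proof -
  interpret Q1: primeideal Q1 R by fact
  interpret Q2: primeideal Q2 R by fact
  let ?conj = "\<lambda>g. {r \<in> carrier R. \<phi> g r \<in> Q1}"
  have "\<exists>Q\<in>?conj ` carrier G. Q2 \<subseteq> Q"
  proof (rule prime_avoidance)
    show "primeideal Q R" if "Q \<in> ?conj ` carrier G" for Q
    proof -
      obtain g where g: "g \<in> carrier G" "Q = ?conj g" using \<open>Q \<in> ?conj ` carrier G\<close> by blast
      have "ring_hom_ring R R (\<phi> g)"
        using act_hom[OF g(1)] ring_axioms by (intro ring_hom_ring.intro ring_hom_ring_axioms.intro)
      then show ?thesis unfolding g(2) by (rule ring_hom_ring.primeideal_vimage[OF _ is_cring assms(1)])
    qed
    show "Q2 \<subseteq> \<Union> (?conj ` carrier G)"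
    proof
      fix r assume r: "r \<in> Q2"
      then have rR: "r \<in> carrier R" using Q2.Icarr by simp
      have "norm_over (carrier G) r \<in> Q2"
        using norm_over_mem_iff[OF assms(2), of "carrier G" r] rR r act_one[OF rR]
        by (metis G.one_closed order_refl)
      then have "norm_over (carrier G) r \<in> Q1" using assms(4) norm_over_fixed[OF rR] by blast
      then show "r \<in> \<Union> (?conj ` carrier G)"
        using norm_over_mem_iff[OF assms(1), of "carrier G" r] rR by auto
    qed
  qed (use finite_group Q2.is_ideal in auto)
  then obtain g where g: "g \<in> carrier G" "Q2 \<subseteq> ?conj g" by blast
  then have "\<phi> g ` Q1 \<subseteq> Q1" using assms(3) by blast
  then have "Q2 \<subseteq> Q1"
    using act_stable_imp_mem[OF g(1), of Q1] g(2) Q1.Icarr by blast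
  then show ?thesis using assms(3) by blast
qed

text \<open>By incomparability a strict chain of primes ending at \<open>Q\<close> stays strict
  after contraction, so every chain length that occurs above occurs below.\<close>

lemma prime_height_le_contract:
  assumes "primeideal Q R"
  shows "prime_height R Q \<le> prime_height (invariant_ring G R \<phi>) (Q \<inter> fixed)"
  unfolding prime_height_def
proof (rule SUP_subset_mono)
  show "{n. \<exists>q::nat \<Rightarrow> 'r set. (\<forall>i\<le>n. primeideal (q i) R) \<and> (\<forall>i<n. q i \<subset> q (Suc i)) \<and> q n = Q}
    \<subseteq> {n. \<exists>q::nat \<Rightarrow> 'r set. (\<forall>i\<le>n. primeideal (q i) (invariant_ring G R \<phi>)) \<and>
        (\<forall>i<n. q i \<subset> q (Suc i)) \<and> q n = Q \<inter> fixed}" (is "?A \<subseteq> ?B")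
  proof
    fix n assume "n \<in> ?A"
    then obtain q where q: "\<And>i. i \<le> n \<Longrightarrow> primeideal (q i) R"
      "\<And>i. i < n \<Longrightarrow> q i \<subset> q (Suc i)" "q n = Q" by auto
    have "q i \<inter> fixed \<subset> q (Suc i) \<inter> fixed" if "i < n" for i
      using incomparability[of "q i" "q (Suc i)"] q(1)[of i] q(1)[of "Suc i"] q(2)[OF that] that
      by auto
    then show "n \<in> ?B"
      using q primeideal_contract by (intro CollectI exI[of _ "\<lambda>i. q i \<inter> fixed"]) auto
  qed
qed simp

end

section \<open>Independence of characters and the Frobenius map\<close>

text \<open>The characters of the family may coincide, so the conclusion concerns the sum of the
  coefficients over one class of equal characters. If all agree with \<open>\<chi> b\<close>,
  evaluate at 1. Otherwise some \<open>\<chi> d\<close> differs from \<open>\<chi> b\<close> at some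
  \<open>u\<close>, and the usual subtraction eliminates \<open>d\<close> while rescaling the class
  of \<open>b\<close> by a nonzero factor.\<close>

lemma (in domain) dedekind_independence:
  fixes T :: "('t, 'u) monoid_scheme" and \<chi> :: "'i \<Rightarrow> 't \<Rightarrow> 'a"
  assumes T: "monoid T" and "finite A"
    and "\<And>a. a \<in> A \<Longrightarrow> c a \<in> carrier R"
    and "\<And>a. a \<in> A \<Longrightarrow> \<chi> a \<in> hom T R"
    and "\<And>a. a \<in> A \<Longrightarrow> \<chi> a \<one>\<^bsub>T\<^esub> = \<one>"
    and "\<And>t. t \<in> carrier T \<Longrightarrow> (\<Oplus>a\<in>A. c a \<otimes> \<chi> a t) = \<zero>"
    and "b \<in> A"
  shows "(\<Oplus>a\<in>{a \<in> A. \<forall>t\<in>carrier T. \<chi> a t = \<chi> b t}. c a) = \<zero>"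
  using assms(2-)
proof (induction A arbitrary: c rule: finite_psubset_induct)
  case (psubset A)
  interpret T: monoid T by fact
  have \<chi>c: "\<chi> a t \<in> carrier R" if "a \<in> A" "t \<in> carrier T" for a t
    using psubset.prems(2)[OF that(1)] that(2) by (auto simp: hom_def)
  have \<chi>m: "\<chi> a (u \<otimes>\<^bsub>T\<^esub> t) = \<chi> a u \<otimes> \<chi> a t" if "a \<in> A" "u \<in> carrier T" "t \<in> carrier T" for a t u
    using psubset.prems(2)[OF that(1)] that(2,3) by (auto simp: hom_def)
  note cc = psubset.prems(1)
  show ?case
  proof (cases "\<forall>a\<in>A. \<forall>t\<in>carrier T. \<chi> a t = \<chi> b t")
    case True
    then have A: "{a \<in> A. \<forall>t\<in>carrier T. \<chi> a t = \<chi> b t} = A" by blast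
    have "(\<Oplus>a\<in>A. c a) = (\<Oplus>a\<in>A. c a \<otimes> \<chi> a \<one>\<^bsub>T\<^esub>)"
      using psubset.prems(1,3) by (intro finsum_cong') auto
    then show ?thesis unfolding A using psubset.prems(4)[OF T.one_closed] by simp
  next
    case False
    then obtain d u where d: "d \<in> A" "u \<in> carrier T" "\<chi> d u \<noteq> \<chi> b u" by metis
    let ?B = "{a \<in> A. \<forall>t\<in>carrier T. \<chi> a t = \<chi> b t}"
    \<comment> \<open>These are the coefficients of the relation at \<open>u t\<close> minus
      \<open>\<chi> d u\<close> times the relation at \<open>t\<close>; the one at \<open>d\<close>
      vanishes.\<close>
    define c' where "c' a = c a \<otimes> (\<chi> a u \<ominus> \<chi> d u)" for a
    have c'c: "c' a \<in> carrier R" if "a \<in> A" for a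
      unfolding c'_def using that cc \<chi>c d by auto
    have sum: "(\<Oplus>a\<in>A - {d}. c' a \<otimes> \<chi> a t) = \<zero>" if t: "t \<in> carrier T" for t
    proof -
      have "(\<Oplus>a\<in>A. c' a \<otimes> \<chi> a t)
          = (\<Oplus>a\<in>A. c a \<otimes> \<chi> a (u \<otimes>\<^bsub>T\<^esub> t) \<oplus> (\<ominus> \<chi> d u) \<otimes> (c a \<otimes> \<chi> a t))"
      proof (rule finsum_cong')
        fix a assume a: "a \<in> A"
        show "c' a \<otimes> \<chi> a t = c a \<otimes> \<chi> a (u \<otimes>\<^bsub>T\<^esub> t) \<oplus> (\<ominus> \<chi> d u) \<otimes> (c a \<otimes> \<chi> a t)"
          unfolding c'_def \<chi>m[OF a d(2) t]
          using cc[OF a] \<chi>c[OF a t] \<chi>c[OF a d(2)] \<chi>c[OF d(1,2)] by algebra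
      qed (use cc \<chi>c d t in auto)
      also have "\<dots> = (\<Oplus>a\<in>A. c a \<otimes> \<chi> a (u \<otimes>\<^bsub>T\<^esub> t)) \<oplus> (\<Oplus>a\<in>A. (\<ominus> \<chi> d u) \<otimes> (c a \<otimes> \<chi> a t))"
        using cc \<chi>c d t by (intro finsum_addf) auto
      also have "(\<Oplus>a\<in>A. (\<ominus> \<chi> d u) \<otimes> (c a \<otimes> \<chi> a t)) = (\<ominus> \<chi> d u) \<otimes> (\<Oplus>a\<in>A. c a \<otimes> \<chi> a t)"
        using cc \<chi>c d t psubset.hyps by (intro finsum_rdistr[symmetric]) auto
      finally have "(\<Oplus>a\<in>A. c' a \<otimes> \<chi> a t) = \<zero>"
        using psubset.prems(4) \<chi>c d t by simp
      moreover have "(\<Oplus>a\<in>A. c' a \<otimes> \<chi> a t) = c' d \<otimes> \<chi> d t \<oplus> (\<Oplus>a\<in>A - {d}. c' a \<otimes> \<chi> a t)"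
        using c'c \<chi>c d t psubset.hyps
        by (subst finsum_insert[symmetric]) (auto simp: insert_absorb)
      moreover have "c' d = \<zero>" unfolding c'_def using \<chi>c d cc by (simp add: r_neg a_minus_def)
      moreover have "(\<Oplus>a\<in>A - {d}. c' a \<otimes> \<chi> a t) \<in> carrier R"
        using c'c \<chi>c t by (intro finsum_closed) auto
      ultimately show ?thesis using \<chi>c[OF d(1) t] by simp
    qed
    have bd: "b \<noteq> d" using d by blast
    have "(\<Oplus>a\<in>{a \<in> A - {d}. \<forall>t\<in>carrier T. \<chi> a t = \<chi> b t}. c' a) = \<zero>"
      by (rule psubset.IH) (use d bd psubset.prems sum c'c in auto)
    moreover have "{a \<in> A - {d}. \<forall>t\<in>carrier T. \<chi> a t = \<chi> b t} = ?B"
      using d by auto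
    \<comment> \<open>On the class of \<open>b\<close> the factor is the constant
      \<open>\<chi> b u \<ominus> \<chi> d u\<close>, which is nonzero and cancels in a
      domain.\<close>
    moreover have "(\<Oplus>a\<in>?B. c' a) = (\<Oplus>a\<in>?B. c a \<otimes> (\<chi> b u \<ominus> \<chi> d u))"
      using \<chi>c[OF d(1,2)] \<chi>c[OF psubset.prems(5) d(2)] cc d(2)
      by (intro finsum_cong') (auto simp: c'_def)
    moreover have "\<dots> = (\<Oplus>a\<in>?B. c a) \<otimes> (\<chi> b u \<ominus> \<chi> d u)"
      using \<chi>c[OF d(1,2)] \<chi>c[OF psubset.prems(5) d(2)] cc psubset.hyps
      by (intro finsum_ldistr[symmetric]) auto
    moreover have "\<chi> b u \<ominus> \<chi> d u \<noteq> \<zero>"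
      using \<chi>c[OF d(1,2)] \<chi>c[OF psubset.prems(5) d(2)] d(3) by (metis r_right_minus_eq)
    moreover have "(\<Oplus>a\<in>?B. c a) \<in> carrier R" using cc by (intro finsum_closed) auto
    moreover have "\<chi> b u \<ominus> \<chi> d u \<in> carrier R"
      using \<chi>c[OF d(1,2)] \<chi>c[OF psubset.prems(5) d(2)] by simp
    ultimately show ?thesis using integral[of "\<Oplus>a\<in>?B. c a" "\<chi> b u \<ominus> \<chi> d u"] by argo
  qed
qed

lemma (in cring) binomial:
  assumes a: "a \<in> carrier R" and b: "b \<in> carrier R"
  shows "(a \<oplus> b) [^] (n::nat) = (\<Oplus>i\<in>{..n}. [(n choose i)] \<cdot>\<^bsub>R\<^esub> (a [^] i \<otimes> b [^] (n - i)))"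
proof (induction n)
  case 0
  then show ?case by simp
next
  case (Suc n)
  define u where "u i = a [^] i \<otimes> b [^] (Suc n - i)" for i
  define t where "t i = [(n choose i)] \<cdot>\<^bsub>R\<^esub> (a [^] i \<otimes> b [^] (n - i))" for i
  have u: "[k] \<cdot>\<^bsub>R\<^esub> u i \<in> carrier R" for i and k :: nat
    unfolding u_def using a b by (intro add.nat_pow_closed) simp
  have u': "u i \<in> carrier R" for i unfolding u_def using a b by simp
  have t: "t i \<in> carrier R" for i
    unfolding t_def using a b by (intro add.nat_pow_closed) simp
  have A: "(\<Oplus>i\<in>{..n}. t i) \<otimes> a = (\<Oplus>i\<in>{..n}. [(n choose i)] \<cdot>\<^bsub>R\<^esub> u (Suc i))"
  proof -
    have "(\<Oplus>i\<in>{..n}. t i) \<otimes> a = (\<Oplus>i\<in>{..n}. t i \<otimes> a)"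
      using a t by (intro finsum_ldistr) auto
    also have "\<dots> = (\<Oplus>i\<in>{..n}. [(n choose i)] \<cdot>\<^bsub>R\<^esub> u (Suc i))"
    proof (rule finsum_cong')
      fix i
      have "a [^] i \<otimes> b [^] (n - i) \<otimes> a = u (Suc i)"
        unfolding u_def using a b by (simp add: m_ac)
      then show "t i \<otimes> a = [(n choose i)] \<cdot>\<^bsub>R\<^esub> u (Suc i)"
        unfolding t_def using a b by (simp add: add_pow_ldistr)
    qed (rule refl, rule Pi_I, rule u)
    finally show ?thesis .
  qed
  have B: "(\<Oplus>i\<in>{..n}. t i) \<otimes> b = (\<Oplus>i\<in>{..n}. [(n choose Suc i)] \<cdot>\<^bsub>R\<^esub> u (Suc i)) \<oplus> u 0"
  proof -
    have "(\<Oplus>i\<in>{..n}. t i) \<otimes> b = (\<Oplus>i\<in>{..n}. t i \<otimes> b)"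
      using b t by (intro finsum_ldistr) auto
    also have "\<dots> = (\<Oplus>i\<in>{..n}. [(n choose i)] \<cdot>\<^bsub>R\<^esub> u i)"
    proof (rule finsum_cong')
      fix i assume "i \<in> {..n}"
      then have "a [^] i \<otimes> b [^] (n - i) \<otimes> b = u i"
        unfolding u_def using a b by (simp add: m_assoc Suc_diff_le)
      then show "t i \<otimes> b = [(n choose i)] \<cdot>\<^bsub>R\<^esub> u i"
        unfolding t_def using a b by (simp add: add_pow_ldistr)
    qed (rule refl, rule Pi_I, rule u)
    \<comment> \<open>A zero term is added on top so that the range becomes \<open>{..Suc n}\<close>
      and the index can be shifted by one.\<close>
    also have "\<dots> = [(n choose Suc n)] \<cdot>\<^bsub>R\<^esub> u (Suc n) \<oplus> (\<Oplus>i\<in>{..n}. [(n choose i)] \<cdot>\<^bsub>R\<^esub> u i)"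
      using add.nat_pow_0[of "u (Suc n)"] u by (simp add: finsum_closed binomial_eq_0)
    also have "\<dots> = (\<Oplus>i\<in>{..Suc n}. [(n choose i)] \<cdot>\<^bsub>R\<^esub> u i)"
      using u by (intro finsum_Suc[symmetric]) auto
    also have "\<dots> = (\<Oplus>i\<in>{..n}. [(n choose Suc i)] \<cdot>\<^bsub>R\<^esub> u (Suc i)) \<oplus> [(n choose 0)] \<cdot>\<^bsub>R\<^esub> u 0"
      using u by (intro finsum_Suc2) auto
    also have "[(n choose 0)] \<cdot>\<^bsub>R\<^esub> u 0 = u 0" using u' by simp
    finally show ?thesis .
  qed
  have "(a \<oplus> b) [^] Suc n = (\<Oplus>i\<in>{..n}. t i) \<otimes> (a \<oplus> b)"
    using Suc by (simp add: t_def)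
  also have "\<dots> = (\<Oplus>i\<in>{..n}. t i) \<otimes> a \<oplus> (\<Oplus>i\<in>{..n}. t i) \<otimes> b"
    using a b t by (intro r_distr finsum_closed) auto
  also have "\<dots> = ((\<Oplus>i\<in>{..n}. [(n choose i)] \<cdot>\<^bsub>R\<^esub> u (Suc i)) \<oplus>
      (\<Oplus>i\<in>{..n}. [(n choose Suc i)] \<cdot>\<^bsub>R\<^esub> u (Suc i))) \<oplus> u 0"
    unfolding A B using u u' by (intro a_assoc[symmetric] finsum_closed) auto
  also have "(\<Oplus>i\<in>{..n}. [(n choose i)] \<cdot>\<^bsub>R\<^esub> u (Suc i)) \<oplus> (\<Oplus>i\<in>{..n}. [(n choose Suc i)] \<cdot>\<^bsub>R\<^esub> u (Suc i))
      = (\<Oplus>i\<in>{..n}. [(n choose i)] \<cdot>\<^bsub>R\<^esub> u (Suc i) \<oplus> [(n choose Suc i)] \<cdot>\<^bsub>R\<^esub> u (Suc i))"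
    using u by (intro finsum_addf[symmetric]) auto
  also have "\<dots> = (\<Oplus>i\<in>{..n}. [(Suc n choose Suc i)] \<cdot>\<^bsub>R\<^esub> u (Suc i))"
  proof (rule finsum_cong')
    fix i
    have "[(n choose i)] \<cdot>\<^bsub>R\<^esub> u (Suc i) \<oplus> [(n choose Suc i)] \<cdot>\<^bsub>R\<^esub> u (Suc i)
      = [((n choose i) + (n choose Suc i))] \<cdot>\<^bsub>R\<^esub> u (Suc i)"
      using u' by (intro add.nat_pow_mult)
    then show "[(n choose i)] \<cdot>\<^bsub>R\<^esub> u (Suc i) \<oplus> [(n choose Suc i)] \<cdot>\<^bsub>R\<^esub> u (Suc i)
        = [(Suc n choose Suc i)] \<cdot>\<^bsub>R\<^esub> u (Suc i)"
      by simp
  qed (rule refl, rule Pi_I, rule u)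
  also have "u 0 = [(Suc n choose 0)] \<cdot>\<^bsub>R\<^esub> u 0" using u' by simp
  also have "(\<Oplus>i\<in>{..n}. [(Suc n choose Suc i)] \<cdot>\<^bsub>R\<^esub> u (Suc i)) \<oplus> [(Suc n choose 0)] \<cdot>\<^bsub>R\<^esub> u 0
      = (\<Oplus>i\<in>{..Suc n}. [(Suc n choose i)] \<cdot>\<^bsub>R\<^esub> u i)"
    using u by (intro finsum_Suc2[symmetric]) auto
  finally show ?case by (simp only: u_def)
qed

text \<open>The binomial coefficients strictly between the ends are multiples of \<open>p\<close>,
  and \<open>p\<close> annihilates \<open>R\<close>.\<close>

lemma (in cring) frobenius_add:
  assumes p: "Factorial_Ring.prime p" and char: "[p] \<cdot>\<^bsub>R\<^esub> \<one> = \<zero>"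
    and a: "a \<in> carrier R" and b: "b \<in> carrier R"
  shows "(a \<oplus> b) [^] (p::nat) = a [^] p \<oplus> b [^] p"
proof -
  let ?t = "\<lambda>i. [(p choose i)] \<cdot>\<^bsub>R\<^esub> (a [^] i \<otimes> b [^] (p - i))"
  have t: "?t i \<in> carrier R" for i using a b by simp
  have p0: "0 < p" using p by (rule prime_gt_0_nat)
  have z: "?t i = \<zero>" if "i \<in> {..p} - {0, p}" for i
  proof -
    let ?v = "a [^] i \<otimes> b [^] (p - i)"
    have v: "?v \<in> carrier R" using a b by simp
    have "p dvd (p choose i)" using that p by (intro dvd_choose_prime) auto
    then obtain m where m: "p choose i = p * m" by (elim dvdE)
    have "[p] \<cdot>\<^bsub>R\<^esub> ?v = ([p] \<cdot>\<^bsub>R\<^esub> \<one>) \<otimes> ?v" using v by (simp add: add_pow_ldistr)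
    then have "[p] \<cdot>\<^bsub>R\<^esub> ?v = \<zero>" using char v by simp
    moreover have "?t i = [m] \<cdot>\<^bsub>R\<^esub> ([p] \<cdot>\<^bsub>R\<^esub> ?v)"
      unfolding m using v by (intro add.nat_pow_pow[symmetric])
    ultimately show ?thesis by simp
  qed
  have "(a \<oplus> b) [^] p = (\<Oplus>i\<in>{..p}. ?t i)" using a b by (rule binomial)
  also have "\<dots> = (\<Oplus>i\<in>{0, p}. ?t i)"
    using t z by (intro add.finprod_mono_neutral_cong_right) auto
  also have "\<dots> = ?t 0 \<oplus> (\<Oplus>i\<in>{p}. ?t i)"
    using t p0 by (intro finsum_insert) (simp_all only: finite.intros singleton_iff Pi_I less_irrefl not_False_eq_True)
  also have "(\<Oplus>i\<in>{p}. ?t i) = ?t p" using t[of p] by simp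
  also have "?t 0 \<oplus> ?t p = a [^] p \<oplus> b [^] p" using a b by (simp add: a_comm)
  finally show ?thesis .
qed

text \<open>If the \<open>p\<close>-th powers of two elements agree, additivity of Frobenius makes
  the \<open>p\<close>-th power of their difference zero, and a domain has no nilpotents;
  \<open>k\<close> such steps remove the exponent.\<close>

lemma (in domain) frobenius_power_inject:
  assumes p: "Factorial_Ring.prime p" and char: "[p] \<cdot>\<^bsub>R\<^esub> \<one> = \<zero>"
    and a: "a \<in> carrier R" and b: "b \<in> carrier R"
    and eq: "a [^] (p ^ k :: nat) = b [^] (p ^ k)"
  shows "a = b"
  using eq
proof (induction k)
  case 0
  then show ?case using a b by simp
next
  case (Suc k)
  let ?a = "a [^] (p ^ k)" and ?b = "b [^] (p ^ k)"
  have c: "?a \<in> carrier R" "?b \<in> carrier R" "?a \<ominus> ?b \<in> carrier R" using a b by auto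
  have "?a [^] p = ?b [^] p" using Suc.prems a b by (simp add: nat_pow_pow mult.commute)
  moreover have "?a = (?a \<ominus> ?b) \<oplus> ?b" using c by algebra
  then have "?a [^] p = (?a \<ominus> ?b) [^] p \<oplus> ?b [^] p"
    using frobenius_add[OF p char c(3,2)] by simp
  ultimately have "(?a \<ominus> ?b) [^] p = \<zero>"
    using c add.r_cancel_one'[of "?b [^] p" "(?a \<ominus> ?b) [^] p"] by simp
  then have "?a \<ominus> ?b = \<zero>"
    using primeideal.pow_mem[OF zeroprimeideal c(3), of p] by simp
  then show ?case using c Suc.IH by (simp add: r_right_minus_eq)
qed

section \<open>Transversals\<close>

text \<open>The choice depends on the right coset only, so it is constant on \<open>P #> g\<close>.
  Right cosets are used because cochains are equivariant under left translation.\<close>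

definition coset_rep :: "('g, 'c) monoid_scheme \<Rightarrow> 'g set \<Rightarrow> 'g \<Rightarrow> 'g" where
  "coset_rep G P g = (SOME u. u \<in> P #>\<^bsub>G\<^esub> g)"

definition transversal :: "('g, 'c) monoid_scheme \<Rightarrow> 'g set \<Rightarrow> 'g set" where
  "transversal G P = coset_rep G P ` carrier G"

locale finite_index_pair = group G + subgroup P G for G (structure) and P +
  assumes finite_carrier: "finite (carrier G)"
begin

lemma coset_rep_mem: "g \<in> carrier G \<Longrightarrow> coset_rep G P g \<in> P #> g"
  unfolding coset_rep_def by (rule someI[of _ g]) (rule rcos_self[OF _ subgroup_axioms])

lemma coset_rep_closed [simp, intro]: "g \<in> carrier G \<Longrightarrow> coset_rep G P g \<in> carrier G"
  using elemrcos_carrier[OF group_axioms _ coset_rep_mem] by blast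

lemma rcos_coset_rep: "g \<in> carrier G \<Longrightarrow> P #> coset_rep G P g = P #> g"
  using repr_independence[OF coset_rep_mem _ subgroup_axioms, of g] by simp

lemma coset_rep_eq_iff:
  assumes "g \<in> carrier G" "g' \<in> carrier G"
  shows "coset_rep G P g = coset_rep G P g' \<longleftrightarrow> P #> g = P #> g'"
  using rcos_coset_rep[OF assms(1)] rcos_coset_rep[OF assms(2)] unfolding coset_rep_def by metis

lemma coset_rep_mult [simp]:
  assumes "h \<in> P" "g \<in> carrier G"
  shows "coset_rep G P (h \<otimes> g) = coset_rep G P g"
proof -
  have "h \<otimes> g \<in> P #> g" using assms by (auto simp: r_coset_def)
  then show ?thesis
    using assms repr_independence[OF _ _ subgroup_axioms, of "h \<otimes> g" g]
    by (simp add: coset_rep_eq_iff mem_carrier)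
qed

lemma coset_rep_div: "g \<in> carrier G \<Longrightarrow> g \<otimes> inv (coset_rep G P g) \<in> P"
  using rcos_module_imp[OF group_axioms, of "coset_rep G P g" g] rcos_coset_rep rcos_self[OF _ subgroup_axioms]
  by auto

lemma transversal_subset: "transversal G P \<subseteq> carrier G"
  by (auto simp: transversal_def)

lemma transversal_finite: "finite (transversal G P)"
  using finite_carrier by (simp add: transversal_def)

lemma coset_rep_transversal [simp]: "s \<in> transversal G P \<Longrightarrow> coset_rep G P s = s"
  by (auto simp: transversal_def coset_rep_eq_iff rcos_coset_rep)

text \<open>Right translation by \<open>g\<close> permutes the right cosets, and \<open>w\<close> is
  a function of the coset. The multiplicative form covers sums too, through the additive monoid of a
  ring or module.\<close>

lemma finprod_transversal_translate:
  assumes "comm_monoid M" "w \<in> carrier G \<rightarrow> carrier M"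
    "\<And>h u. h \<in> P \<Longrightarrow> u \<in> carrier G \<Longrightarrow> w (h \<otimes> u) = w u" "g \<in> carrier G"
  shows "finprod M (\<lambda>s. w (s \<otimes> g)) (transversal G P) = finprod M w (transversal G P)"
proof -
  interpret M: comm_monoid M by fact
  let ?S = "transversal G P" and ?\<tau> = "\<lambda>s. coset_rep G P (s \<otimes> g)"
  have inj: "inj_on ?\<tau> ?S"
  proof (rule inj_onI)
    fix s s' assume s: "s \<in> ?S" "s' \<in> ?S" "?\<tau> s = ?\<tau> s'"
    then have sc: "s \<in> carrier G" "s' \<in> carrier G" using transversal_subset by auto
    then have "P #> (s \<otimes> g) = P #> (s' \<otimes> g)" using s(3) assms(4) by (simp add: coset_rep_eq_iff)
    then have "(P #> s) #> g #> inv g = (P #> s') #> g #> inv g"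
      using sc assms(4) by (simp add: coset_mult_assoc subset)
    then have "P #> s = P #> s'"
      using sc assms(4) by (simp add: coset_mult_assoc subset m_assoc)
    then have "coset_rep G P s = coset_rep G P s'" using sc by (simp add: coset_rep_eq_iff)
    then show "s = s'" using s by simp
  qed
  have "?\<tau> ` ?S \<subseteq> ?S"
  proof
    fix u assume "u \<in> ?\<tau> ` ?S"
    then obtain s where "s \<in> ?S" "u = ?\<tau> s" ..
    moreover from this have "s \<otimes> g \<in> carrier G" using transversal_subset assms(4) by blast
    ultimately show "u \<in> ?S" unfolding transversal_def by blast
  qed
  \<comment> \<open>The map sending \<open>s\<close> to the representative of the coset of
    \<open>s g\<close> is injective on a finite set, hence a permutation of it.\<close>
  then have surj: "?\<tau> ` ?S = ?S" by (rule endo_inj_surj[OF transversal_finite _ inj])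
  have w_rep: "w (coset_rep G P u) = w u" if u: "u \<in> carrier G" for u
  proof -
    have "w u = w ((u \<otimes> inv (coset_rep G P u)) \<otimes> coset_rep G P u)"
      using u by (simp add: m_assoc)
    also have "\<dots> = w (coset_rep G P u)" using u coset_rep_div by (intro assms) auto
    finally show ?thesis by simp
  qed
  have "finprod M w ?S = finprod M w (?\<tau> ` ?S)" using surj by simp
  also have "\<dots> = finprod M (\<lambda>s. w (?\<tau> s)) ?S"
    using inj assms(2,4) transversal_subset[THEN subsetD]
    by (intro M.finprod_reindex) (auto intro!: funcset_mem[OF assms(2)])
  also have "\<dots> = finprod M (\<lambda>s. w (s \<otimes> g)) ?S"
    using assms(4) transversal_subset[THEN subsetD] w_rep
    by (intro M.finprod_cong') (auto intro!: funcset_mem[OF assms(2)])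
  finally show ?thesis by simp
qed

text \<open>Every element factors uniquely as \<open>h s\<close> with \<open>h\<close> in
  \<open>P\<close> and \<open>s\<close> a representative, and for \<open>P \<subseteq> K\<close> it
  lies in \<open>K\<close> exactly when \<open>s\<close> does. With \<open>K\<close> the inertia
  group this counts the cosets inside it by a transversal of the whole group.\<close>

lemma card_transversal_Int:
  assumes "subgroup K G" "P \<subseteq> K"
  shows "card K = card P * card (transversal G P \<inter> K)"
proof -
  interpret K: subgroup K G by fact
  let ?S = "transversal G P"
  have "bij_betw (\<lambda>(h, s). h \<otimes> s) (P \<times> (?S \<inter> K)) K"
    unfolding bij_betw_def
  proof
    show "inj_on (\<lambda>(h, s). h \<otimes> s) (P \<times> (?S \<inter> K))"
    proof (rule inj_onI, clarify)
      fix h s h' s' assume a: "h \<in> P" "s \<in> ?S" "h' \<in> P" "s' \<in> ?S" and eq: "h \<otimes> s = h' \<otimes> s'"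
      then have "coset_rep G P s = coset_rep G P s'"
        using transversal_subset by (metis coset_rep_mult subsetD)
      then have "s = s'" using a by simp
      then show "h = h' \<and> s = s'"
        using eq a transversal_subset mem_carrier by (metis r_cancel subsetD)
    qed
    show "(\<lambda>(h, s). h \<otimes> s) ` (P \<times> (?S \<inter> K)) = K"
    proof
      show "(\<lambda>(h, s). h \<otimes> s) ` (P \<times> (?S \<inter> K)) \<subseteq> K" using assms by auto
      show "K \<subseteq> (\<lambda>(h, s). h \<otimes> s) ` (P \<times> (?S \<inter> K))"
      proof
        fix g assume g: "g \<in> K"
        then have gc: "g \<in> carrier G" by (rule K.mem_carrier)
        let ?h = "g \<otimes> inv (coset_rep G P g)"
        have h: "?h \<in> P" using coset_rep_div[OF gc] .
        have eq: "g = ?h \<otimes> coset_rep G P g"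
          using gc by (simp add: m_assoc del: coset_rep_mult)
        have "inv ?h = coset_rep G P g \<otimes> inv g" using gc by (simp add: inv_mult_group)
        then have "coset_rep G P g = inv ?h \<otimes> g" using gc by (simp add: m_assoc)
        also have "\<dots> \<in> K" using K.m_closed[OF K.m_inv_closed g] h assms(2) by blast
        finally have "coset_rep G P g \<in> ?S \<inter> K" using gc unfolding transversal_def by blast
        with h have "(?h, coset_rep G P g) \<in> P \<times> (?S \<inter> K)" by blast
        then have "(\<lambda>(h, s). h \<otimes> s) (?h, coset_rep G P g) \<in> (\<lambda>(h, s). h \<otimes> s) ` (P \<times> (?S \<inter> K))"
          by (rule imageI)
        then show "g \<in> (\<lambda>(h, s). h \<otimes> s) ` (P \<times> (?S \<inter> K))" using eq by simp
      qed
    qed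
  qed
  from bij_betw_same_card[OF this] show ?thesis by (simp add: card_cartesian_product)
qed

end

section \<open>Traces and inertia groups\<close>

context finite_ring_action
begin

text \<open>A transversal represents the right cosets, so its inverses represent \<open>G/P\<close>.\<close>

definition rel_trace :: "'g set \<Rightarrow> 'r \<Rightarrow> 'r" where
  "rel_trace P r = (\<Oplus>s\<in>transversal G P. \<phi> (inv\<^bsub>G\<^esub> s) r)"

lemma finite_index_pairI: "subgroup P G \<Longrightarrow> finite_index_pair G P"
  using finite_group G.group_axioms
  by (intro finite_index_pair.intro finite_index_pair_axioms.intro)

lemma rel_trace_closed:
  assumes "subgroup P G" "r \<in> carrier R"
  shows "rel_trace P r \<in> carrier R"
proof -
  interpret P: finite_index_pair G P using assms(1) by (rule finite_index_pairI)
  show ?thesis unfolding rel_trace_def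
    using assms(2) P.transversal_subset[THEN subsetD] by (intro finsum_closed) auto
qed

text \<open>Applying \<open>g\<close> turns the summand at \<open>s\<close> into the summand at
  \<open>s\<close> times the inverse of \<open>g\<close>; since \<open>r\<close> is
  \<open>P\<close>-invariant, the summands depend on the coset only and the sum is
  unchanged.\<close>

lemma rel_trace_fixed:
  assumes "subgroup P G" and r: "r \<in> carrier R" and rP: "\<And>h. h \<in> P \<Longrightarrow> \<phi> h r = r"
  shows "rel_trace P r \<in> fixed"
  unfolding fixed_iff
proof (intro conjI ballI)
  interpret P: finite_index_pair G P using assms(1) by (rule finite_index_pairI)
  note S = P.transversal_subset[THEN subsetD]
  show "rel_trace P r \<in> carrier R" using assms by (intro rel_trace_closed)
  fix g assume g: "g \<in> carrier G"
  let ?w = "\<lambda>u. \<phi> (inv\<^bsub>G\<^esub> u) r"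
  have "\<phi> g (rel_trace P r) = (\<Oplus>s\<in>transversal G P. \<phi> g (?w s))"
    unfolding rel_trace_def using r S
    by (subst ring_hom_cring.hom_finsum[OF act_hom_cring[OF g]]) (auto simp: comp_def)
  also have "\<dots> = (\<Oplus>s\<in>transversal G P. ?w (s \<otimes>\<^bsub>G\<^esub> inv\<^bsub>G\<^esub> g))"
    using r S g by (intro finsum_cong') (auto simp: G.inv_mult_group act_mult)
  also have "\<dots> = (\<Oplus>s\<in>transversal G P. ?w s)"
  proof (rule P.finprod_transversal_translate[of "add_monoid R" ?w, folded finsum_def])
    show "comm_monoid (add_monoid R)" by (rule add.comm_monoid_axioms)
    show "?w \<in> carrier G \<rightarrow> carrier (add_monoid R)" using r by auto
    show "inv\<^bsub>G\<^esub> g \<in> carrier G" using g by simp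
    fix h u assume hu: "h \<in> P" "u \<in> carrier G"
    then have h: "h \<in> carrier G" "inv\<^bsub>G\<^esub> h \<in> P" by auto
    then show "?w (h \<otimes>\<^bsub>G\<^esub> u) = ?w u"
      using hu r rP[OF h(2)] by (simp add: G.inv_mult_group act_mult)
  qed
  finally show "\<phi> g (rel_trace P r) = rel_trace P r" by (simp add: rel_trace_def)
qed

section \<open>Inertia groups of primes\<close>

text \<open>For an ideal \<open>Q\<close> these are the elements acting trivially on
  \<open>R/Q\<close>. The condition already forces \<open>\<phi> g\<close> to map \<open>Q\<close>
  into itself, so no separate stabiliser clause occurs.\<close>

definition inertia :: "'r set \<Rightarrow> 'g set" where
  "inertia Q = {g \<in> carrier G. \<forall>r\<in>carrier R. \<phi> g r \<ominus> r \<in> Q}"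

lemma inertia_subgroup:
  assumes "ideal Q R"
  shows "subgroup (inertia Q) G"
proof (rule G.subgroupI)
  interpret Q: ideal Q R by fact
  have Q0: "\<zero> \<in> Q" by (rule additive_subgroup.zero_closed[OF Q.additive_subgroup_axioms])
  note Qadd = additive_subgroup.a_closed[OF Q.additive_subgroup_axioms]
  show "inertia Q \<subseteq> carrier G" by (auto simp: inertia_def)
  have "\<phi> \<one>\<^bsub>G\<^esub> r \<ominus> r \<in> Q" if "r \<in> carrier R" for r
    using that Q0 act_one by (simp add: a_minus_def r_neg)
  then show "inertia Q \<noteq> {}" by (auto simp: inertia_def intro!: exI[of _ "\<one>\<^bsub>G\<^esub>"])
next
  interpret Q: ideal Q R by fact
  fix g assume g: "g \<in> inertia Q"
  then have gc: "g \<in> carrier G" by (simp add: inertia_def)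
  have "\<phi> (inv\<^bsub>G\<^esub> g) r \<ominus> r \<in> Q" if r: "r \<in> carrier R" for r
  proof -
    define s where "s = \<phi> (inv\<^bsub>G\<^esub> g) r"
    have s: "s \<in> carrier R" "\<phi> g s = r" using r gc by (auto simp: s_def)
    then have "r \<ominus> s \<in> Q" using g by (auto simp: inertia_def)
    moreover have "s \<ominus> r = \<zero> \<ominus> (r \<ominus> s)" using s(1) r by algebra
    ultimately show ?thesis
      using Q.minus_mem additive_subgroup.zero_closed[OF Q.additive_subgroup_axioms]
      by (simp add: s_def)
  qed
  then show "inv\<^bsub>G\<^esub> g \<in> inertia Q" using gc by (simp add: inertia_def)
next
  interpret Q: ideal Q R by fact
  fix g h assume gh: "g \<in> inertia Q" "h \<in> inertia Q"
  then have c: "g \<in> carrier G" "h \<in> carrier G" by (auto simp: inertia_def)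
  have "\<phi> (g \<otimes>\<^bsub>G\<^esub> h) r \<ominus> r \<in> Q" if r: "r \<in> carrier R" for r
  proof -
    have hr: "\<phi> h r \<in> carrier R" "\<phi> g (\<phi> h r) \<in> carrier R" using c r by auto
    have "\<phi> g (\<phi> h r) \<ominus> \<phi> h r \<in> Q" "\<phi> h r \<ominus> r \<in> Q"
      using gh r hr by (auto simp: inertia_def)
    then have "(\<phi> g (\<phi> h r) \<ominus> \<phi> h r) \<oplus> (\<phi> h r \<ominus> r) \<in> Q"
      by (rule additive_subgroup.a_closed[OF Q.additive_subgroup_axioms])
    moreover have "(\<phi> g (\<phi> h r) \<ominus> \<phi> h r) \<oplus> (\<phi> h r \<ominus> r) = \<phi> g (\<phi> h r) \<ominus> r"
      using hr r by algebra
    ultimately show ?thesis using c r by (simp add: act_mult)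
  qed
  then show "g \<otimes>\<^bsub>G\<^esub> h \<in> inertia Q" using c by (simp add: inertia_def)
qed

lemma moving_ideal_subset:
  assumes "ideal Q R" "P \<subseteq> inertia Q"
  shows "moving_ideal R \<phi> P \<subseteq> Q"
  unfolding moving_ideal_def using assms by (intro genideal_minimal) (auto simp: inertia_def)

text \<open>The reflection hypothesis says that the inverse of \<open>g\<close> maps
  \<open>Q\<close> into itself; by finite order so does \<open>g\<close>.\<close>

lemma act_mem_if_reflects:
  assumes "g \<in> carrier G" "Q \<subseteq> carrier R" "\<And>r. r \<in> carrier R \<Longrightarrow> \<phi> g r \<in> Q \<Longrightarrow> r \<in> Q"
    "r \<in> Q"
  shows "\<phi> g r \<in> Q"
proof -
  have ig: "inv\<^bsub>G\<^esub> g \<in> carrier G" using assms by simp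
  have "\<phi> (inv\<^bsub>G\<^esub> g) ` Q \<subseteq> Q"
  proof
    fix y assume "y \<in> \<phi> (inv\<^bsub>G\<^esub> g) ` Q"
    then obtain z where z: "z \<in> Q" "y = \<phi> (inv\<^bsub>G\<^esub> g) z" ..
    then have zc: "z \<in> carrier R" using assms(2) by blast
    then have "\<phi> g y = z" using z assms(1) by simp
    then show "y \<in> Q" using assms(3)[of y] z zc ig by simp
  qed
  moreover have "r \<in> carrier R" using assms by blast
  ultimately show ?thesis
    using act_stable_imp_mem[OF ig assms(2), of "\<phi> g r"] assms(1,4) by simp
qed

lemma quotient_char:
  assumes "primeideal Q R" and "[(n::nat)] \<cdot>\<^bsub>R\<^esub> \<one> = \<zero>"
  shows "[n] \<cdot>\<^bsub>R Quot Q\<^esub> \<one>\<^bsub>R Quot Q\<^esub> = \<zero>\<^bsub>R Quot Q\<^esub>"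
proof -
  interpret \<pi>: ring_hom_cring R "R Quot Q" "(+>) Q"
    using assms(1) by (rule primeideal.rcos_ring_hom_cring)
  have "Q +> ([k] \<cdot>\<^bsub>R\<^esub> \<one>) = [k] \<cdot>\<^bsub>R Quot Q\<^esub> \<one>\<^bsub>R Quot Q\<^esub>" for k :: nat
    by (induction k) simp_all
  then show ?thesis using assms(2) \<pi>.hom_zero by metis
qed

text \<open>Both sides of the last hypothesis vanish modulo \<open>Q\<close> for the same \<open>t\<close>, so \<open>g\<close> lies in the
  decomposition group; then the hypothesis compares \<open>p\<^sup>k\<close>-th powers, and the Frobenius map of
  \<open>R/Q\<close> is injective.\<close>

lemma mem_inertiaI:
  assumes Q: "primeideal Q R" and p: "Factorial_Ring.prime p" and char: "[p] \<cdot>\<^bsub>R\<^esub> \<one> = \<zero>"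
    and P: "subgroup P G" "P \<subseteq> inertia Q" "card P = p ^ k"
    and g: "g \<in> carrier G"
    and eq: "\<And>t. t \<in> carrier R \<Longrightarrow> Q +> \<phi> g (norm_over P t) = Q +> (t [^] (p ^ k))"
  shows "g \<in> inertia Q"
proof -
  interpret Q: primeideal Q R by fact
  interpret D: "domain" "R Quot Q" by (rule Q.quotient_is_domain)
  interpret \<pi>: ring_hom_cring R "R Quot Q" "(+>) Q" by (rule Q.rcos_ring_hom_cring)
  interpret P: subgroup P G by fact
  note coset_eq = quotient_eq_iff_same_a_r_cos[OF Q.is_ideal]
  have norm_closed: "norm_over P t \<in> carrier R" if "t \<in> carrier R" for t
    using that P.subset by (intro norm_over_closed)
  \<comment> \<open>The identity of \<open>P\<close> contributes the factor
    \<open>\<phi> g t\<close> to the image of the norm, so that image lies in \<open>Q\<close>, and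
    by \<open>eq\<close> a power of \<open>t\<close> does as well.\<close>
  have reflects: "t \<in> Q" if t: "t \<in> carrier R" "\<phi> g t \<in> Q" for t
  proof -
    have "\<phi> g (norm_over P t) = (\<Otimes>h\<in>P. \<phi> g (\<phi> h t))"
      unfolding norm_over_def using t P.mem_carrier
      by (subst ring_hom_cring.hom_finprod[OF act_hom_cring[OF g]]) (auto simp: comp_def)
    also have "\<dots> \<in> Q"
    proof -
      have "\<phi> g (\<phi> \<one>\<^bsub>G\<^esub> t) \<in> Q" using t by (simp add: act_one)
      then show ?thesis
        using t g P.mem_carrier finite_subset[OF P.subset finite_group] P.one_closed
        by (subst Q.finprod_mem_iff) auto
    qed
    finally have *: "\<phi> g (norm_over P t) \<in> Q" .
    have "\<phi> g (norm_over P t) \<ominus> t [^] (p ^ k) \<in> Q"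
      using eq[OF t(1)] coset_eq g t norm_closed by simp
    then have "\<phi> g (norm_over P t) \<ominus> (\<phi> g (norm_over P t) \<ominus> t [^] (p ^ k)) \<in> Q"
      by (rule Q.minus_mem[OF *])
    moreover have "\<phi> g (norm_over P t) \<ominus> (\<phi> g (norm_over P t) \<ominus> t [^] (p ^ k)) = t [^] (p ^ k)"
    proof -
      have "u \<ominus> (u \<ominus> v) = v" if "u \<in> carrier R" "v \<in> carrier R" for u v
        using that by algebra
      then show ?thesis using g t norm_closed by (metis act_closed nat_pow_closed)
    qed
    ultimately have "t [^] (p ^ k) \<in> Q" by simp
    then show ?thesis using Q.pow_mem t by blast
  qed
  have stable: "\<phi> g t \<in> Q" if "t \<in> Q" for t
    using g Q.a_subset reflects that by (rule act_mem_if_reflects)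
  \<comment> \<open>\<open>P\<close> acts trivially modulo \<open>Q\<close>, and by stability
    \<open>\<phi> g\<close> respects congruence modulo \<open>Q\<close>.\<close>
  have cong: "Q +> \<phi> g (\<phi> h t) = Q +> \<phi> g t" if "h \<in> P" "t \<in> carrier R" for h t
  proof -
    have h: "h \<in> carrier G" "\<phi> h t \<ominus> t \<in> Q" using P(2) that by (auto simp: inertia_def)
    interpret g: ring_hom_cring R R "\<phi> g" using g by (rule act_hom_cring)
    have "\<phi> g (\<phi> h t) \<ominus> \<phi> g t = \<phi> g (\<phi> h t \<ominus> t)"
      using that h by (simp add: a_minus_def)
    also have "\<dots> \<in> Q" using h by (intro stable)
    finally show ?thesis using coset_eq h g that by simp
  qed
  have "Q +> \<phi> g t = Q +> t" if t: "t \<in> carrier R" for t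
  proof (rule D.frobenius_power_inject[OF p])
    show "[p] \<cdot>\<^bsub>R Quot Q\<^esub> \<one>\<^bsub>R Quot Q\<^esub> = \<zero>\<^bsub>R Quot Q\<^esub>"
      using Q char by (rule quotient_char)
    show "Q +> \<phi> g t \<in> carrier (R Quot Q)" "Q +> t \<in> carrier (R Quot Q)"
      using t g by (auto intro: \<pi>.hom_closed)
    have "\<phi> g (norm_over P t) = (\<Otimes>h\<in>P. \<phi> g (\<phi> h t))"
      unfolding norm_over_def using t P.mem_carrier
      by (subst ring_hom_cring.hom_finprod[OF act_hom_cring[OF g]]) (auto simp: comp_def)
    also have "Q +> \<dots> = (\<Otimes>\<^bsub>R Quot Q\<^esub>h\<in>P. Q +> \<phi> g (\<phi> h t))"
      using t g P.mem_carrier by (subst \<pi>.hom_finprod) (auto simp: comp_def)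
    \<comment> \<open>All factors agree modulo \<open>Q\<close>, so the product becomes a
      \<open>p ^ k\<close>-th power and Frobenius can be undone.\<close>
    also have "\<dots> = (\<Otimes>\<^bsub>R Quot Q\<^esub>h\<in>P. Q +> \<phi> g t)"
      using t g cong by (intro D.finprod_cong') (auto intro: \<pi>.hom_closed)
    also have "\<dots> = (Q +> \<phi> g t) [^]\<^bsub>R Quot Q\<^esub> (p ^ k)"
      using t g P(3) by (subst D.finprod_const) (auto intro: \<pi>.hom_closed)
    finally have "(Q +> \<phi> g t) [^]\<^bsub>R Quot Q\<^esub> (p ^ k) = Q +> (t [^] (p ^ k))"
      using eq[OF t] by simp
    also have "\<dots> = (Q +> t) [^]\<^bsub>R Quot Q\<^esub> (p ^ k)"
      using t by (rule \<pi>.hom_pow)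
    finally show "(Q +> \<phi> g t) [^]\<^bsub>R Quot Q\<^esub> (p ^ k) = (Q +> t) [^]\<^bsub>R Quot Q\<^esub> (p ^ k)" .
  qed
  then show ?thesis using g coset_eq by (simp add: inertia_def)
qed

text \<open>Each representative \<open>s\<close> gives a character of the multiplicative monoid of
  \<open>R\<close>, the conjugate of the norm by the inverse of \<open>s\<close>, read modulo
  \<open>Q\<close>. If every trace of a norm were in \<open>Q\<close>, the sum of all these
  characters would vanish; independence would then make the size of one class of equal characters
  zero in \<open>R/Q\<close>. That size is the index of \<open>P\<close> in the inertia
  group.\<close>

lemma exists_rel_trace_notin:
  assumes Q: "primeideal Q R" and p: "Factorial_Ring.prime p" and char: "[p] \<cdot>\<^bsub>R\<^esub> \<one> = \<zero>"
  obtains P k r where "subgroup P G" "card P = p ^ k" "P \<subseteq> inertia Q" "r \<in> carrier R"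
    "\<And>h. h \<in> P \<Longrightarrow> \<phi> h r = r" "rel_trace P r \<notin> Q"
proof -
  interpret Q: primeideal Q R by fact
  interpret D: "domain" "R Quot Q" by (rule Q.quotient_is_domain)
  interpret \<pi>: ring_hom_cring R "R Quot Q" "(+>) Q" by (rule Q.rcos_ring_hom_cring)
  note coset_eq = quotient_eq_iff_same_a_r_cos[OF Q.is_ideal]
  let ?I = "inertia Q"
  have I: "subgroup ?I G" using Q.is_ideal by (rule inertia_subgroup)
  have finI: "finite ?I" using finite_subset[OF subgroup.subset[OF I] finite_group] .
  have cardI: "card ?I \<noteq> 0" using finI subgroup.one_closed[OF I] by auto
  \<comment> \<open>\<open>p ^ k\<close> is the full \<open>p\<close>-part of the order of the
    inertia group, so the cofactor \<open>m\<close> is prime to \<open>p\<close>.\<close>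
  define k where "k = multiplicity p (card ?I)"
  obtain m where m: "card ?I = p ^ k * m" "\<not> p dvd m"
    using multiplicity_decompose'[of "card ?I" p] cardI p unfolding k_def by (metis not_prime_unit)
  have "\<exists>P. subgroup P (G\<lparr>carrier := ?I\<rparr>) \<and> card P = p ^ k"
    using p subgroup.subgroup_is_group[OF I G.group_axioms] m finI
    by (intro sylow_thm[where m = m]) (auto simp: order_def)
  then obtain P where P': "subgroup P (G\<lparr>carrier := ?I\<rparr>)" and cardP: "card P = p ^ k" by blast
  have P: "subgroup P G" using G.incl_subgroup[OF I P'] .
  have PI: "P \<subseteq> ?I" using subgroup.subset[OF P'] by simp
  interpret P: finite_index_pair G P using P by (rule finite_index_pairI)
  let ?S = "transversal G P"
  note S = P.transversal_subset[THEN subsetD]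
  have cardS: "card (?S \<inter> ?I) = m"
    using P.card_transversal_Int[OF I PI] m(1) cardP p by simp
  have "\<exists>t\<in>carrier R. rel_trace P (norm_over P t) \<notin> Q"
  proof (rule ccontr)
    assume "\<not> ?thesis"
    then have all: "rel_trace P (norm_over P t) \<in> Q" if "t \<in> carrier R" for t using that by blast
    have nc: "norm_over P t \<in> carrier R" if "t \<in> carrier R" for t
      using that P.subset by (intro norm_over_closed)
    define \<chi> where "\<chi> s t = Q +> \<phi> (inv\<^bsub>G\<^esub> s) (norm_over P t)" for s t
    \<comment> \<open>\<open>b\<close> represents the coset \<open>P\<close> itself; it lies in
      \<open>P\<close> but need not be the identity.\<close>
    define b where "b = coset_rep G P \<one>\<^bsub>G\<^esub>"
    have bS: "b \<in> ?S" unfolding b_def transversal_def by blast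
    have bP: "b \<in> P"
      using P.coset_rep_mem[of "\<one>\<^bsub>G\<^esub>"] G.coset_mult_one[OF P.subset] by (simp add: b_def)
    note b = bS bP
    \<comment> \<open>The norm is invariant under \<open>b\<close>, and each of its factors is
      congruent to \<open>t\<close> modulo \<open>Q\<close>.\<close>
    have \<chi>_b: "\<chi> b t = Q +> (t [^] (p ^ k))" if t: "t \<in> carrier R" for t
    proof -
      have "\<chi> b t = Q +> norm_over P t"
        unfolding \<chi>_def using act_norm_over[OF P] b t by simp
      also have "\<dots> = (\<Otimes>\<^bsub>R Quot Q\<^esub>h\<in>P. Q +> \<phi> h t)"
        unfolding norm_over_def using t P.mem_carrier by (subst \<pi>.hom_finprod) (auto simp: comp_def)
      also have "\<dots> = (\<Otimes>\<^bsub>R Quot Q\<^esub>h\<in>P. Q +> t)"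
      proof (rule D.finprod_cong')
        show "Q +> \<phi> h t = Q +> t" if "h \<in> P" for h
          using coset_eq[of "\<phi> h t" t] PI that t P.mem_carrier by (auto simp: inertia_def)
      qed (use t in \<open>auto intro: \<pi>.hom_closed\<close>)
      also have "\<dots> = Q +> (t [^] (p ^ k))"
        using t cardP by (simp add: D.finprod_const \<pi>.hom_pow)
      finally show ?thesis .
    qed
    have "(\<Oplus>\<^bsub>R Quot Q\<^esub>s\<in>{s \<in> ?S. \<forall>t\<in>carrier R. \<chi> s t = \<chi> b t}. \<one>\<^bsub>R Quot Q\<^esub>) = \<zero>\<^bsub>R Quot Q\<^esub>"
    proof (rule D.dedekind_independence[of R])
      show "monoid R" by (rule monoid_axioms)
      show "\<chi> s \<in> hom R (R Quot Q)" if "s \<in> ?S" for s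
      proof (rule homI)
        fix t u assume "t \<in> carrier R" "u \<in> carrier R"
        then show "\<chi> s (t \<otimes> u) = \<chi> s t \<otimes>\<^bsub>R Quot Q\<^esub> \<chi> s u"
          unfolding \<chi>_def using S[OF that] nc ring_hom_mult[OF act_hom] P.subset
          by (simp add: norm_over_mult)
      qed (use S[OF that] nc in \<open>auto simp: \<chi>_def intro: \<pi>.hom_closed\<close>)
      show "\<chi> s \<one> = \<one>\<^bsub>R Quot Q\<^esub>" if "s \<in> ?S" for s
        unfolding \<chi>_def using S[OF that] ring_hom_one[OF act_hom] P.subset
        by (simp add: norm_over_one)
      show "(\<Oplus>\<^bsub>R Quot Q\<^esub>s\<in>?S. \<one>\<^bsub>R Quot Q\<^esub> \<otimes>\<^bsub>R Quot Q\<^esub> \<chi> s t) = \<zero>\<^bsub>R Quot Q\<^esub>"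
        if t: "t \<in> carrier R" for t
      proof -
        have "(\<Oplus>\<^bsub>R Quot Q\<^esub>s\<in>?S. \<one>\<^bsub>R Quot Q\<^esub> \<otimes>\<^bsub>R Quot Q\<^esub> \<chi> s t) = (\<Oplus>\<^bsub>R Quot Q\<^esub>s\<in>?S. \<chi> s t)"
          using t S nc by (intro D.finsum_cong') (auto simp: \<chi>_def intro: \<pi>.hom_closed)
        also have "\<dots> = Q +> rel_trace P (norm_over P t)"
          unfolding rel_trace_def \<chi>_def using t S nc by (subst \<pi>.hom_finsum) (auto simp: comp_def)
        also have "\<dots> = Q +> \<zero>"
          using coset_eq[of "rel_trace P (norm_over P t)" \<zero>] all[OF t] rel_trace_closed[OF P] nc t
          by (simp add: a_minus_def)
        finally show ?thesis using \<pi>.hom_zero by simp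
      qed
    qed (use P.transversal_finite b in auto)
    moreover have "{s \<in> ?S. \<forall>t\<in>carrier R. \<chi> s t = \<chi> b t} = ?S \<inter> ?I"
    proof (rule equalityI; rule subsetI)
      fix s assume s: "s \<in> {s \<in> ?S. \<forall>t\<in>carrier R. \<chi> s t = \<chi> b t}"
      then have sS: "s \<in> ?S" by simp
      then have sc: "s \<in> carrier G" by (rule S)
      \<comment> \<open>Together with \<open>\<chi>_b\<close>, equality of the two characters is
        precisely the last hypothesis of \<open>mem_inertiaI\<close>.\<close>
      have "inv\<^bsub>G\<^esub> s \<in> ?I"
        by (rule mem_inertiaI[OF Q p char P PI cardP]) (use sc s \<chi>_b in \<open>auto simp: \<chi>_def\<close>)
      then have "inv\<^bsub>G\<^esub> (inv\<^bsub>G\<^esub> s) \<in> ?I" by (rule subgroup.m_inv_closed[OF I])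
      then show "s \<in> ?S \<inter> ?I" using sc sS by simp
    next
      fix s assume s: "s \<in> ?S \<inter> ?I"
      then have sI: "inv\<^bsub>G\<^esub> s \<in> ?I" by (intro subgroup.m_inv_closed[OF I]) simp
      have "\<chi> s t = \<chi> b t" if t: "t \<in> carrier R" for t
      proof -
        have "\<chi> b t = Q +> norm_over P t"
          unfolding \<chi>_def using act_norm_over[OF P] b t by simp
        moreover have "\<chi> s t = Q +> norm_over P t"
          unfolding \<chi>_def using coset_eq[of "\<phi> (inv\<^bsub>G\<^esub> s) (norm_over P t)" "norm_over P t"]
            sI nc[OF t] by (auto simp: inertia_def)
        ultimately show ?thesis by simp
      qed
      then show "s \<in> {s \<in> ?S. \<forall>t\<in>carrier R. \<chi> s t = \<chi> b t}" using s by simp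
    qed
    \<comment> \<open>All coefficients are 1, so the vanishing sum is the size \<open>m\<close> of
      the class.\<close>
    ultimately have "[m] \<cdot>\<^bsub>R Quot Q\<^esub> \<one>\<^bsub>R Quot Q\<^esub> = \<zero>\<^bsub>R Quot Q\<^esub>"
      using D.add.finprod_const[of "\<one>\<^bsub>R Quot Q\<^esub>" "?S \<inter> ?I"] cardS by simp
    then have "[(u * m)] \<cdot>\<^bsub>R Quot Q\<^esub> \<one>\<^bsub>R Quot Q\<^esub> = \<zero>\<^bsub>R Quot Q\<^esub>" for u :: nat
      using D.add.nat_pow_pow[of "\<one>\<^bsub>R Quot Q\<^esub>" u m] by (simp add: mult.commute)
    moreover have "[(v * p + 1)] \<cdot>\<^bsub>R Quot Q\<^esub> \<one>\<^bsub>R Quot Q\<^esub> = \<one>\<^bsub>R Quot Q\<^esub>" for v :: nat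
    proof -
      have "[(v * p)] \<cdot>\<^bsub>R Quot Q\<^esub> \<one>\<^bsub>R Quot Q\<^esub> = \<zero>\<^bsub>R Quot Q\<^esub>"
        using D.add.nat_pow_pow[of "\<one>\<^bsub>R Quot Q\<^esub>" v p] quotient_char[OF Q char]
        by (simp add: mult.commute)
      then show ?thesis
        using D.add.nat_pow_mult[of "\<one>\<^bsub>R Quot Q\<^esub>" "v * p" 1] by simp
    qed
    \<comment> \<open>Both \<open>m\<close> and \<open>p\<close> vanish in \<open>R/Q\<close>, so a
      Bezout relation between them would make 1 vanish.\<close>
    moreover have "coprime m p" using prime_imp_coprime[OF p m(2)] by (simp add: coprime_commute)
    then obtain u v where "m * u = p * v + 1"
      using coprime_bezout_strong[of m p] not_prime_1 p by metis
    ultimately show False using D.one_not_zero by (metis mult.commute)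
  qed
  then obtain t where t: "t \<in> carrier R" "rel_trace P (norm_over P t) \<notin> Q" ..
  show thesis
    using that[OF P cardP PI _ _ t(2)] t(1) act_norm_over[OF P] norm_over_closed[OF P.subset] by simp
qed

end

section \<open>Cochains as functions on lists\<close>

text \<open>The coboundary formula on lists of all lengths at once, without a degree, so that
  identities can be proved by recursion on the head of the list.\<close>

definition list_coboundary :: "('m, 'd) ring_scheme \<Rightarrow> ('g list \<Rightarrow> 'm) \<Rightarrow> 'g list \<Rightarrow> 'm" where
  "list_coboundary A f gs =
    (\<Oplus>\<^bsub>A\<^esub>i\<in>{..<length gs}. if even i then f (omit i gs) else \<ominus>\<^bsub>A\<^esub> f (omit i gs))"

text \<open>The homotopy between the identity and the map that applies \<open>\<rho>\<close> to every entry.\<close>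

fun prism :: "('m, 'd) ring_scheme \<Rightarrow> ('g \<Rightarrow> 'g) \<Rightarrow> ('g list \<Rightarrow> 'm) \<Rightarrow> 'g list \<Rightarrow> 'm" where
  "prism A \<rho> f [] = \<zero>\<^bsub>A\<^esub>"
| "prism A \<rho> f (g # gs) =
    f (g # \<rho> g # map \<rho> gs) \<ominus>\<^bsub>A\<^esub> prism A \<rho> (\<lambda>xs. f (g # xs)) gs"

lemma omit_map: "omit i (map f xs) = map f (omit i xs)"
  by (simp add: omit_def take_map drop_map)

lemma omit_in_lists: "xs \<in> lists C \<Longrightarrow> omit i xs \<in> lists C"
  using set_take_subset[of i xs] set_drop_subset[of "Suc i" xs] by (auto simp: omit_def in_lists_conv_set)

lemma length_omit: "i < length xs \<Longrightarrow> length (omit i xs) = length xs - 1"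
  by (simp add: omit_def)

lemma list_coboundary_map:
  "list_coboundary A (\<lambda>xs. f (map \<rho> xs)) gs = list_coboundary A f (map \<rho> gs)"
  by (simp add: list_coboundary_def omit_map cong: if_cong)

lemma map_lists: "\<rho> \<in> C \<rightarrow> C \<Longrightarrow> xs \<in> lists C \<Longrightarrow> map \<rho> xs \<in> lists C"
  by (auto simp: in_lists_conv_set)

lemma (in abelian_group_hom) hom_finsum:
  assumes "f \<in> I \<rightarrow> carrier G"
  shows "h (\<Oplus>\<^bsub>G\<^esub>i\<in>I. f i) = (\<Oplus>\<^bsub>H\<^esub>i\<in>I. h (f i))"
  using assms
proof (induction I rule: infinite_finite_induct)
  case (insert i I)
  have c: "f i \<in> carrier G" "f \<in> I \<rightarrow> carrier G" using insert.prems by auto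
  have "(\<lambda>i. h (f i)) \<in> insert i I \<rightarrow> carrier H" using insert.prems hom_closed by blast
  then have "(\<Oplus>\<^bsub>H\<^esub>i\<in>insert i I. h (f i)) = h (f i) \<oplus>\<^bsub>H\<^esub> (\<Oplus>\<^bsub>H\<^esub>i\<in>I. h (f i))"
    using insert.hyps by (intro H.finsum_insert) auto
  moreover have "(\<Oplus>\<^bsub>G\<^esub>i\<in>insert i I. f i) = f i \<oplus>\<^bsub>G\<^esub> (\<Oplus>\<^bsub>G\<^esub>i\<in>I. f i)"
    using insert.hyps c by (intro G.finsum_insert) auto
  ultimately show ?case using insert.IH[OF c(2)] c by (simp add: G.finsum_closed)
qed simp_all

lemma (in abelian_group) abelian_group_endI:
  assumes "\<And>x. x \<in> carrier G \<Longrightarrow> T x \<in> carrier G"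
    "\<And>x y. x \<in> carrier G \<Longrightarrow> y \<in> carrier G \<Longrightarrow> T (x \<oplus> y) = T x \<oplus> T y"
  shows "abelian_group_hom G G T"
  using assms
  by (intro abelian_group_homI abelian_group_axioms group_hom.intro group_hom_axioms.intro a_group homI) auto

lemma (in abelian_group) abelian_group_hom_a_inv: "abelian_group_hom G G (a_inv G)"
  by (rule abelian_group_endI) (auto simp: minus_add a_comm)

locale list_cochains = abelian_group A for A :: "('m, 'd) ring_scheme" (structure) +
  fixes C :: "'g set"
begin

lemma list_coboundary_closed:
  assumes "f \<in> lists C \<rightarrow> carrier A" "gs \<in> lists C"
  shows "list_coboundary A f gs \<in> carrier A"
  unfolding list_coboundary_def
  using funcset_mem[OF assms(1) omit_in_lists[OF assms(2)]] by (intro finsum_closed) simp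

lemma list_coboundary_cong:
  assumes "\<And>i. i < length gs \<Longrightarrow> f (omit i gs) = f' (omit i gs)" "f' \<in> lists C \<rightarrow> carrier A"
    "gs \<in> lists C"
  shows "list_coboundary A f gs = list_coboundary A f' gs"
  unfolding list_coboundary_def
  using funcset_mem[OF assms(2) omit_in_lists[OF assms(3)]] assms(1)
  by (intro finsum_cong') auto

lemma list_coboundary_Nil [simp]: "list_coboundary A f [] = \<zero>"
  by (simp add: list_coboundary_def)

lemma list_coboundary_additive:
  assumes "abelian_group_hom A A T" "f \<in> lists C \<rightarrow> carrier A" "gs \<in> lists C"
  shows "list_coboundary A (\<lambda>xs. T (f xs)) gs = T (list_coboundary A f gs)"
proof -
  interpret T: abelian_group_hom A A T by fact
  have c: "f (omit i gs) \<in> carrier A" for i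
    using funcset_mem[OF assms(2) omit_in_lists[OF assms(3)]] .
  have "T (list_coboundary A f gs)
      = (\<Oplus>i\<in>{..<length gs}. T (if even i then f (omit i gs) else \<ominus> f (omit i gs)))"
    unfolding list_coboundary_def using c by (intro T.hom_finsum) auto
  also have "\<dots> = list_coboundary A (\<lambda>xs. T (f xs)) gs"
    unfolding list_coboundary_def using c by (intro finsum_cong') auto
  finally show ?thesis by simp
qed

lemma list_coboundary_finsum:
  assumes "finite I" "\<And>s. s \<in> I \<Longrightarrow> f s \<in> lists C \<rightarrow> carrier A" "gs \<in> lists C"
  shows "list_coboundary A (\<lambda>xs. \<Oplus>s\<in>I. f s xs) gs = (\<Oplus>s\<in>I. list_coboundary A (f s) gs)"
  using assms(1,2)
proof (induction I)
  case empty
  then show ?case unfolding list_coboundary_def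
    by (simp cong: if_cong add: add.finprod_one_eqI)
next
  case (insert s I)
  let ?t = "\<lambda>f i. if even i then f (omit i gs) else \<ominus> f (omit i gs)"
  have c: "f s' (omit i gs) \<in> carrier A" if "s' \<in> insert s I" for s' i
    using funcset_mem[OF insert.prems[OF that] omit_in_lists[OF assms(3)]] .
  have cI: "(\<Oplus>s\<in>I. f s (omit i gs)) \<in> carrier A" for i
    using c by (intro finsum_closed) auto
  have "list_coboundary A (\<lambda>xs. \<Oplus>s\<in>insert s I. f s xs) gs
      = (\<Oplus>i\<in>{..<length gs}. ?t (f s) i \<oplus> ?t (\<lambda>xs. \<Oplus>s\<in>I. f s xs) i)"
    unfolding list_coboundary_def
  proof (rule finsum_cong')
    fix i
    have "(\<Oplus>s\<in>insert s I. f s (omit i gs)) = f s (omit i gs) \<oplus> (\<Oplus>s\<in>I. f s (omit i gs))"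
      using insert.hyps c by (intro finsum_insert) auto
    then show "?t (\<lambda>xs. \<Oplus>s\<in>insert s I. f s xs) i = ?t (f s) i \<oplus> ?t (\<lambda>xs. \<Oplus>s\<in>I. f s xs) i"
      using c cI by (simp add: minus_add)
  qed (use c cI in auto)
  also have "\<dots> = list_coboundary A (f s) gs \<oplus> list_coboundary A (\<lambda>xs. \<Oplus>s\<in>I. f s xs) gs"
    unfolding list_coboundary_def using c cI by (intro finsum_addf) auto
  also have "\<dots> = list_coboundary A (f s) gs \<oplus> (\<Oplus>s\<in>I. list_coboundary A (f s) gs)"
    using insert by simp
  also have "\<dots> = (\<Oplus>s\<in>insert s I. list_coboundary A (f s) gs)"
    using insert.hyps insert.prems assms(3)
    by (intro finsum_insert[symmetric]) (auto intro: list_coboundary_closed)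
  finally show ?case .
qed

lemma list_coboundary_minus:
  assumes "f \<in> lists C \<rightarrow> carrier A" "f' \<in> lists C \<rightarrow> carrier A" "gs \<in> lists C"
  shows "list_coboundary A (\<lambda>xs. f xs \<ominus> f' xs) gs = list_coboundary A f gs \<ominus> list_coboundary A f' gs"
proof -
  let ?t = "\<lambda>f i. if even i then f (omit i gs) else \<ominus> f (omit i gs)"
  have c: "f (omit i gs) \<in> carrier A" "f' (omit i gs) \<in> carrier A" for i
    using funcset_mem[OF _ omit_in_lists[OF assms(3)]] assms by auto
  have "list_coboundary A (\<lambda>xs. f xs \<ominus> f' xs) gs
      = (\<Oplus>i\<in>{..<length gs}. ?t f i \<oplus> ?t (\<lambda>xs. \<ominus> f' xs) i)"
    unfolding list_coboundary_def a_minus_def using c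
    by (intro finsum_cong') (auto simp: minus_add)
  also have "\<dots> = list_coboundary A f gs \<oplus> list_coboundary A (\<lambda>xs. \<ominus> f' xs) gs"
    unfolding list_coboundary_def using c by (intro finsum_addf) auto
  also have "list_coboundary A (\<lambda>xs. \<ominus> f' xs) gs = \<ominus> list_coboundary A f' gs"
    using assms by (intro list_coboundary_additive abelian_group_hom_a_inv)
  finally show ?thesis by (simp add: a_minus_def)
qed

text \<open>Omitting entry 0 drops the head; omitting entry \<open>Suc i\<close> keeps the head and
  carries the sign opposite to that of entry \<open>i\<close> of the tail. This recursion replaces
  double sums in the homotopy identity and in the proof that the coboundary squares to zero.\<close>

lemma list_coboundary_Cons:
  assumes "f \<in> lists C \<rightarrow> carrier A" "g \<in> C" "gs \<in> lists C"
  shows "list_coboundary A f (g # gs) = f gs \<ominus> list_coboundary A (\<lambda>xs. f (g # xs)) gs"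
proof -
  let ?t = "\<lambda>i. if even i then f (omit i (g # gs)) else \<ominus> f (omit i (g # gs))"
  have c: "f (omit i (g # gs)) \<in> carrier A" for i
    using funcset_mem[OF assms(1) omit_in_lists[of "g # gs" C i]] assms by simp
  have o: "omit 0 (g # gs) = gs" "omit (Suc i) (g # gs) = g # omit i gs" for i
    by (simp_all add: omit_def)
  have c': "f gs \<in> carrier A" "f (g # omit i gs) \<in> carrier A" for i
    using c[of 0] c[of "Suc i"] by (auto simp: o)
  have "list_coboundary A f (g # gs) = (\<Oplus>i\<in>insert 0 (Suc ` {..<length gs}). ?t i)"
    unfolding list_coboundary_def by (simp add: lessThan_Suc_eq_insert_0)
  also have "\<dots> = ?t 0 \<oplus> (\<Oplus>i\<in>Suc ` {..<length gs}. ?t i)"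
    using c by (intro finsum_insert) auto
  also have "(\<Oplus>i\<in>Suc ` {..<length gs}. ?t i) = (\<Oplus>i\<in>{..<length gs}. ?t (Suc i))"
    using c by (intro add.finprod_reindex) auto
  also have "\<dots> = (\<Oplus>i\<in>{..<length gs}. \<ominus> (if even i then f (g # omit i gs) else \<ominus> f (g # omit i gs)))"
    using c' by (intro finsum_cong') (auto simp: o)
  also have "\<dots> = \<ominus> list_coboundary A (\<lambda>xs. f (g # xs)) gs"
    unfolding list_coboundary_def using c'
    by (intro abelian_group_hom.hom_finsum[OF abelian_group_hom_a_inv, symmetric]) auto
  finally show ?thesis by (simp add: o a_minus_def)
qed

lemma prism_closed:
  assumes "\<rho> \<in> C \<rightarrow> C" "f \<in> lists C \<rightarrow> carrier A" "gs \<in> lists C"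
  shows "prism A \<rho> f gs \<in> carrier A"
  using assms(3,2)
proof (induction gs arbitrary: f rule: lists.induct)
  case (Cons g gs)
  have "map \<rho> gs \<in> lists C" "\<rho> g \<in> C" using Cons.hyps assms(1) map_lists by blast+
  then have "g # \<rho> g # map \<rho> gs \<in> lists C" using Cons.hyps by simp
  then have "f (g # \<rho> g # map \<rho> gs) \<in> carrier A" using Cons.prems by blast
  moreover have "prism A \<rho> (\<lambda>xs. f (g # xs)) gs \<in> carrier A"
    using Cons.hyps by (intro Cons.IH) (auto intro!: funcset_mem[OF Cons.prems])
  ultimately show ?case by simp
qed simp

lemma prism_cong:
  assumes "\<rho> \<in> C \<rightarrow> C" "\<And>xs. xs \<in> lists C \<Longrightarrow> f xs = f' xs" "gs \<in> lists C"
  shows "prism A \<rho> f gs = prism A \<rho> f' gs"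
  using assms(3,2)
proof (induction gs arbitrary: f f' rule: lists.induct)
  case (Cons g gs)
  have "map \<rho> gs \<in> lists C" "\<rho> g \<in> C" using Cons.hyps assms(1) map_lists by blast+
  then have "g # \<rho> g # map \<rho> gs \<in> lists C" using Cons.hyps by simp
  moreover have "prism A \<rho> (\<lambda>xs. f (g # xs)) gs = prism A \<rho> (\<lambda>xs. f' (g # xs)) gs"
    using Cons.prems Cons.hyps by (intro Cons.IH) auto
  ultimately show ?case using Cons.prems by simp
qed simp

lemma prism_zero:
  assumes "\<rho> \<in> C \<rightarrow> C" "\<And>xs. xs \<in> lists C \<Longrightarrow> f xs = \<zero>" "gs \<in> lists C"
  shows "prism A \<rho> f gs = \<zero>"
proof -
  have "prism A \<rho> (\<lambda>xs. \<zero>) ys = \<zero>" for ys :: "'g list"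
    by (induction ys) (simp_all add: a_minus_def r_neg)
  then show ?thesis using prism_cong[OF assms(1), of f "\<lambda>xs. \<zero>"] assms by simp
qed

lemma prism_minus:
  assumes "\<rho> \<in> C \<rightarrow> C" "f \<in> lists C \<rightarrow> carrier A" "f' \<in> lists C \<rightarrow> carrier A" "gs \<in> lists C"
  shows "prism A \<rho> (\<lambda>xs. f xs \<ominus> f' xs) gs = prism A \<rho> f gs \<ominus> prism A \<rho> f' gs"
  using assms(4,2,3)
proof (induction gs arbitrary: f f' rule: lists.induct)
  case Nil
  have "\<zero> \<ominus> \<zero> = \<zero>" using r_neg[OF zero_closed] unfolding a_minus_def .
  then show ?case by simp
next
  case (Cons g gs)
  have "map \<rho> gs \<in> lists C" "\<rho> g \<in> C" using Cons.hyps assms(1) map_lists by blast+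
  then have l: "g # \<rho> g # map \<rho> gs \<in> lists C" using Cons.hyps by simp
  have fg: "(\<lambda>xs. f (g # xs)) \<in> lists C \<rightarrow> carrier A" "(\<lambda>xs. f' (g # xs)) \<in> lists C \<rightarrow> carrier A"
    using Cons.hyps by (auto intro!: funcset_mem[OF Cons.prems(1)] funcset_mem[OF Cons.prems(2)])
  define a where "a = f (g # \<rho> g # map \<rho> gs)"
  define a' where "a' = f' (g # \<rho> g # map \<rho> gs)"
  define b where "b = prism A \<rho> (\<lambda>xs. f (g # xs)) gs"
  define b' where "b' = prism A \<rho> (\<lambda>xs. f' (g # xs)) gs"
  have c: "a \<in> carrier A" "a' \<in> carrier A" "b \<in> carrier A" "b' \<in> carrier A"
    using funcset_mem[OF Cons.prems(1) l] funcset_mem[OF Cons.prems(2) l] prism_closed[OF assms(1) fg(1) Cons.hyps(2)]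
      prism_closed[OF assms(1) fg(2) Cons.hyps(2)]
    unfolding a_def a'_def b_def b'_def by blast+
  have "(a \<ominus> a') \<ominus> (b \<ominus> b') = (a \<ominus> b) \<ominus> (a' \<ominus> b')" using c
    by (simp add: a_minus_def minus_add a_ac)
  then show ?case using Cons.IH[OF fg] by (simp add: a_def a'_def b_def b'_def)
qed

text \<open>Both operators recurse on the head of the list, passing from \<open>f\<close> to
  \<open>f\<close> with its first argument fixed; hence the induction is over all \<open>f\<close>.
  The sign convention makes the homotopy end at the pullback along \<open>\<rho>\<close> minus the
  identity.\<close>

lemma prism_homotopy:
  assumes "\<rho> \<in> C \<rightarrow> C" "f \<in> lists C \<rightarrow> carrier A" "gs \<in> lists C"
  shows "list_coboundary A (prism A \<rho> f) gs \<oplus> prism A \<rho> (list_coboundary A f) gs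
    = f (map \<rho> gs) \<ominus> f gs"
  using assms(3,2)
proof (induction gs arbitrary: f rule: lists.induct)
  case Nil
  then show ?case by (simp add: a_minus_def r_neg funcset_mem)
next
  case (Cons g gs)
  note g = Cons.hyps(1) and gs = Cons.hyps(2) and f = Cons.prems
  have \<rho>: "map \<rho> xs \<in> lists C" if "xs \<in> lists C" for xs using map_lists[OF assms(1) that] .
  have \<rho>g: "\<rho> g \<in> C" using assms(1) g by auto
  define fg where "fg = (\<lambda>xs. f (g # xs))"
  \<comment> \<open>The first term of the prism doubles the head into \<open>g\<close> and
    \<open>\<rho> g\<close>; \<open>fgg\<close> is \<open>f\<close> with both fixed. Its coboundary
    \<open>e\<close> arises from both summands and cancels.\<close>
  define fgg where "fgg = (\<lambda>xs. f (g # \<rho> g # xs))"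
  have fgc: "fg \<in> lists C \<rightarrow> carrier A" and fggc: "fgg \<in> lists C \<rightarrow> carrier A"
    using g \<rho>g by (auto simp: fg_def fgg_def intro!: funcset_mem[OF f])
  have fgg\<rho>: "(\<lambda>xs. fgg (map \<rho> xs)) \<in> lists C \<rightarrow> carrier A" using fggc \<rho> by blast
  have pc: "prism A \<rho> f \<in> lists C \<rightarrow> carrier A" "prism A \<rho> fg \<in> lists C \<rightarrow> carrier A"
    using prism_closed[OF assms(1)] f fgc by auto
  have dc: "list_coboundary A f \<in> lists C \<rightarrow> carrier A" "list_coboundary A fg \<in> lists C \<rightarrow> carrier A"
    using list_coboundary_closed f fgc by auto
  define a where "a = prism A \<rho> f gs"
  define e where "e = list_coboundary A fgg (map \<rho> gs)"
  define u where "u = list_coboundary A (prism A \<rho> fg) gs"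
  define v where "v = f (map \<rho> (g # gs))"
  define w where "w = fg (map \<rho> gs)"
  define x where "x = prism A \<rho> (list_coboundary A fg) gs"
  define y where "y = f (g # gs)"
  have c: "a \<in> carrier A" "e \<in> carrier A" "u \<in> carrier A" "v \<in> carrier A" "w \<in> carrier A"
    "x \<in> carrier A" "y \<in> carrier A"
  proof -
    have l: "map \<rho> (g # gs) \<in> lists C" "g # gs \<in> lists C" "map \<rho> gs \<in> lists C"
      using g gs \<rho> \<rho>g by auto
    show "a \<in> carrier A" "w \<in> carrier A" "v \<in> carrier A" "y \<in> carrier A"
      unfolding a_def w_def v_def y_def
      using funcset_mem[OF pc(1) gs] funcset_mem[OF fgc l(3)] funcset_mem[OF f l(1)]
        funcset_mem[OF f l(2)] by blast+
    show "e \<in> carrier A" "u \<in> carrier A" "x \<in> carrier A"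
      unfolding e_def u_def x_def
      using list_coboundary_closed[OF fggc l(3)] list_coboundary_closed[OF pc(2) gs]
        prism_closed[OF assms(1) dc(2) gs] by blast+
  qed
  have "list_coboundary A (prism A \<rho> f) (g # gs)
      = a \<ominus> list_coboundary A (\<lambda>xs. fgg (map \<rho> xs) \<ominus> prism A \<rho> fg xs) gs"
    using list_coboundary_Cons[OF pc(1) g gs] by (simp add: a_def fgg_def fg_def)
  also have "\<dots> = a \<ominus> (e \<ominus> u)"
    using list_coboundary_minus[OF fgg\<rho> pc(2) gs] by (simp add: list_coboundary_map e_def u_def)
  finally have 1: "list_coboundary A (prism A \<rho> f) (g # gs) = a \<ominus> (e \<ominus> u)" .
  have "prism A \<rho> (\<lambda>xs. list_coboundary A f (g # xs)) gs
      = prism A \<rho> (\<lambda>xs. f xs \<ominus> list_coboundary A fg xs) gs"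
    using list_coboundary_Cons[OF f g] gs by (intro prism_cong[OF assms(1)]) (simp_all add: fg_def)
  also have "\<dots> = a \<ominus> x" using prism_minus[OF assms(1) f dc(2) gs] by (simp add: a_def x_def)
  finally have 2: "prism A \<rho> (\<lambda>xs. list_coboundary A f (g # xs)) gs = a \<ominus> x" .
  have "list_coboundary A f (g # \<rho> g # map \<rho> gs) = v \<ominus> list_coboundary A fg (\<rho> g # map \<rho> gs)"
    using list_coboundary_Cons[OF f g, of "\<rho> g # map \<rho> gs"] \<rho>[OF gs] \<rho>g by (simp add: v_def fg_def)
  also have "list_coboundary A fg (\<rho> g # map \<rho> gs) = w \<ominus> e"
    using list_coboundary_Cons[OF fgc \<rho>g \<rho>[OF gs]] by (simp add: w_def e_def fg_def fgg_def)
  finally have 3: "prism A \<rho> (list_coboundary A f) (g # gs) = (v \<ominus> (w \<ominus> e)) \<ominus> (a \<ominus> x)"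
    using 2 by simp
  have IH: "u \<oplus> x = w \<ominus> fg gs" using Cons.IH[OF fgc] by (simp add: u_def x_def w_def)
  have y: "fg gs = y" by (simp add: fg_def y_def)
  \<comment> \<open>The terms are ordered so that \<open>a\<close> and \<open>e\<close> meet their
    negatives, leaving \<open>u\<close> and \<open>x\<close> together for the induction
    hypothesis.\<close>
  have "(a \<ominus> (e \<ominus> u)) \<oplus> ((v \<ominus> (w \<ominus> e)) \<ominus> (a \<ominus> x))
      = u \<oplus> (\<ominus> e \<oplus> (a \<oplus> (\<ominus> a \<oplus> (e \<oplus> (x \<oplus> (v \<ominus> w))))))"
    using c by (simp add: a_minus_def minus_add a_ac del: r_neg1 r_neg2)
  also have "\<dots> = (u \<oplus> x) \<oplus> (v \<ominus> w)"
    using c by (simp add: r_neg1 r_neg2 a_assoc)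
  also have "\<dots> = w \<oplus> (\<ominus> w \<oplus> (v \<ominus> y))"
    unfolding IH y using c by (simp add: a_minus_def a_ac del: r_neg1 r_neg2)
  also have "\<dots> = v \<ominus> y" using c by (simp add: r_neg2)
  finally show ?case unfolding 1 3 v_def y_def .
qed

end

section \<open>Transfer\<close>

lemma tuples_iff: "gs \<in> tuples G n \<longleftrightarrow> length gs = Suc n \<and> gs \<in> lists (carrier G)"
  by (auto simp: tuples_def)

lemma tuples_lists: "gs \<in> tuples G n \<Longrightarrow> gs \<in> lists (carrier G)"
  by (simp add: tuples_iff)

lemma omit_in_tuples:
  assumes "gs \<in> tuples G (Suc n)" "i < length gs"
  shows "omit i gs \<in> tuples G n"
proof -
  have "gs \<in> lists (carrier G)" "length gs = Suc (Suc n)" using assms(1) by (auto simp: tuples_def)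
  then show ?thesis using omit_in_lists length_omit[OF assms(2)] by (simp add: tuples_iff del: lists_eq_set)
qed

lemma coboundary_map_eq:
  assumes "gs \<in> tuples G (Suc n)"
  shows "coboundary_map G A n f gs = list_coboundary A f gs"
proof -
  have "{..Suc n} = {..<length gs}" using assms by (auto simp: tuples_def)
  then show ?thesis using assms by (simp add: coboundary_map_def list_coboundary_def)
qed

lemma coboundary_map_extensional: "coboundary_map G A n f \<in> extensional (tuples G (Suc n))"
  by (simp add: coboundary_map_def)

locale group_module = G: group G + list_cochains A "carrier G"
  for G :: "('g, 'c) monoid_scheme" and A :: "('m, 'd) ring_scheme" (structure) +
  fixes act :: "'g \<Rightarrow> 'm \<Rightarrow> 'm"
  assumes act_hom: "g \<in> carrier G \<Longrightarrow> abelian_group_hom A A (act g)"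
    and act_one: "m \<in> carrier A \<Longrightarrow> act \<one>\<^bsub>G\<^esub> m = m"
    and act_mult: "g \<in> carrier G \<Longrightarrow> h \<in> carrier G \<Longrightarrow> m \<in> carrier A \<Longrightarrow>
      act (g \<otimes>\<^bsub>G\<^esub> h) m = act g (act h m)"
begin

lemma act_closed: "g \<in> carrier G \<Longrightarrow> m \<in> carrier A \<Longrightarrow> act g m \<in> carrier A"
  by (rule abelian_group_hom.hom_closed[OF act_hom])

lemma group_module_subgroup:
  assumes "subgroup P G"
  shows "group_module (G\<lparr>carrier := P\<rparr>) A act"
proof -
  interpret P: subgroup P G by fact
  show ?thesis
    by (intro group_module.intro group_module_axioms.intro list_cochains.intro
        P.subgroup_is_group G.group_axioms abelian_group_axioms)
      (auto simp: act_hom act_one act_mult)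
qed

lemma cochains_iff:
  "f \<in> carrier (cochains G A act n) \<longleftrightarrow> f \<in> extensional (tuples G n) \<and>
    (\<forall>gs\<in>tuples G n. f gs \<in> carrier A) \<and>
    (\<forall>g\<in>carrier G. \<forall>gs\<in>tuples G n. f (map (\<lambda>h. g \<otimes>\<^bsub>G\<^esub> h) gs) = act g (f gs))"
  by (auto simp: cochains_def PiE_def Pi_def)

lemma cochain_closed: "f \<in> carrier (cochains G A act n) \<Longrightarrow> gs \<in> tuples G n \<Longrightarrow> f gs \<in> carrier A"
  by (simp add: cochains_iff)

lemma cochains_ops [simp]:
  "f \<otimes>\<^bsub>cochains G A act n\<^esub> f' = (\<lambda>gs\<in>tuples G n. f gs \<oplus> f' gs)"
  "\<one>\<^bsub>cochains G A act n\<^esub> = (\<lambda>gs\<in>tuples G n. \<zero>)"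
  by (simp_all add: cochains_def)

lemma cocycles_iff:
  "f \<in> carrier (cocycles G A act n) \<longleftrightarrow> f \<in> carrier (cochains G A act n) \<and>
    (\<forall>gs\<in>tuples G (Suc n). list_coboundary A f gs = \<zero>)"
proof -
  have "coboundary_map G A n f = (\<lambda>gs\<in>tuples G (Suc n). \<zero>) \<longleftrightarrow>
    (\<forall>gs\<in>tuples G (Suc n). list_coboundary A f gs = \<zero>)"
  proof
    assume eq: "coboundary_map G A n f = (\<lambda>gs\<in>tuples G (Suc n). \<zero>)"
    show "\<forall>gs\<in>tuples G (Suc n). list_coboundary A f gs = \<zero>"
      using coboundary_map_eq[where A = A and f = f and G = G and n = n] fun_cong[OF eq] by auto
  next
    assume "\<forall>gs\<in>tuples G (Suc n). list_coboundary A f gs = \<zero>"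
    then show "coboundary_map G A n f = (\<lambda>gs\<in>tuples G (Suc n). \<zero>)"
      using coboundary_map_eq[where A = A and f = f and G = G and n = n]
      by (intro extensionalityI[of _ "tuples G (Suc n)"]) (auto simp: coboundary_map_def)
  qed
  then show ?thesis by (simp add: cocycles_def kernel_def)
qed

text \<open>Cochains are \<open>undefined\<close> outside \<open>tuples G n\<close>, while the
  operators on lists need values in \<open>A\<close> on every list.\<close>

definition zero_extend :: "nat \<Rightarrow> ('g list \<Rightarrow> 'm) \<Rightarrow> 'g list \<Rightarrow> 'm" where
  "zero_extend n f gs = (if gs \<in> tuples G n then f gs else \<zero>)"

lemma zero_extend_closed:
  "f \<in> carrier (cochains G A act n) \<Longrightarrow> zero_extend n f \<in> lists (carrier G) \<rightarrow> carrier A"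
  by (auto simp: zero_extend_def cochain_closed)

lemma list_coboundary_zero_extend:
  assumes "f \<in> carrier (cochains G A act n)" "gs \<in> tuples G (Suc n)"
  shows "list_coboundary A (zero_extend n f) gs = list_coboundary A f gs"
proof (rule list_coboundary_cong[symmetric])
  show "f (omit i gs) = zero_extend n f (omit i gs)" if "i < length gs" for i
    using omit_in_tuples[OF assms(2) that] by (simp add: zero_extend_def)
qed (rule zero_extend_closed[OF assms(1)], rule tuples_lists[OF assms(2)])

text \<open>On a list of any other length all faces have the wrong length, so every term is zero.
  Vanishing on all lists is what \<open>prism_zero\<close> asks for.\<close>

lemma list_coboundary_zero_extend_cocycle:
  assumes "f \<in> carrier (cocycles G A act n)" "gs \<in> lists (carrier G)"
  shows "list_coboundary A (zero_extend n f) gs = \<zero>"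
proof (cases "gs \<in> tuples G (Suc n)")
  case True
  then show ?thesis using assms list_coboundary_zero_extend[of f n gs] by (simp add: cocycles_iff)
next
  case False
  then have len: "length gs \<noteq> Suc (Suc n)" using assms(2) by (simp add: tuples_iff del: lists_eq_set)
  have "zero_extend n f (omit i gs) = \<zero>" if "i < length gs" for i
    using len length_omit[OF that] that by (auto simp: zero_extend_def tuples_def)
  then have "list_coboundary A (zero_extend n f) gs = list_coboundary A (\<lambda>_. \<zero>) gs"
    using assms(2) by (intro list_coboundary_cong) auto
  \<comment> \<open>The zero function is treated as an empty sum of functions.\<close>
  also have "\<dots> = \<zero>"
    using list_coboundary_finsum[of "{}" "\<lambda>_ _. \<zero>" gs] assms(2) by simp
  finally show ?thesis .
qed

lemma translate_tuples:
  "g \<in> carrier G \<Longrightarrow> gs \<in> tuples G n \<Longrightarrow> map (\<lambda>h. g \<otimes>\<^bsub>G\<^esub> h) gs \<in> tuples G n"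
  by (auto simp: tuples_def)

lemma translate_lists:
  "g \<in> carrier G \<Longrightarrow> gs \<in> lists (carrier G) \<Longrightarrow> map (\<lambda>h. g \<otimes>\<^bsub>G\<^esub> h) gs \<in> lists (carrier G)"
  by (rule map_lists) auto

text \<open>Two functions occur because the induction fixes the head \<open>g\<close> on one side
  and its translate on the other, which turns even a single equivariant \<open>f\<close> into two
  different functions.\<close>

lemma prism_translate:
  assumes "h \<in> carrier G" "\<rho> \<in> carrier G \<rightarrow> carrier G"
    "\<And>g. g \<in> carrier G \<Longrightarrow> \<rho> (h \<otimes>\<^bsub>G\<^esub> g) = h \<otimes>\<^bsub>G\<^esub> \<rho> g"
    "f \<in> lists (carrier G) \<rightarrow> carrier A"
    "\<And>xs. xs \<in> lists (carrier G) \<Longrightarrow> f' (map (\<lambda>g. h \<otimes>\<^bsub>G\<^esub> g) xs) = act h (f xs)"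
    "gs \<in> lists (carrier G)"
  shows "prism A \<rho> f' (map (\<lambda>g. h \<otimes>\<^bsub>G\<^esub> g) gs) = act h (prism A \<rho> f gs)"
  using assms(6,4,5)
proof (induction gs arbitrary: f f' rule: lists.induct)
  case Nil
  then show ?case using abelian_group_hom.hom_zero[OF act_hom[OF assms(1)]] by simp
next
  case (Cons g gs)
  interpret h: abelian_group_hom A A "act h" by (rule act_hom[OF assms(1)])
  note g = Cons.hyps(1) and gs = Cons.hyps(2) and f = Cons.prems(1)
  let ?h = "map (\<lambda>g. h \<otimes>\<^bsub>G\<^esub> g)"
  have \<rho>gs: "map \<rho> gs \<in> lists (carrier G)" using map_lists[OF assms(2) gs] .
  have l: "g # \<rho> g # map \<rho> gs \<in> lists (carrier G)" using g assms(2) \<rho>gs by auto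
  have "map \<rho> (?h gs) = ?h (map \<rho> gs)" using gs assms(3) by auto
  then have "f' (h \<otimes>\<^bsub>G\<^esub> g # \<rho> (h \<otimes>\<^bsub>G\<^esub> g) # map \<rho> (?h gs)) = f' (?h (g # \<rho> g # map \<rho> gs))"
    using assms(3)[OF g] by (simp del: map_map)
  also have "\<dots> = act h (f (g # \<rho> g # map \<rho> gs))" using Cons.prems(2) l by blast
  finally have 1: "f' (h \<otimes>\<^bsub>G\<^esub> g # \<rho> (h \<otimes>\<^bsub>G\<^esub> g) # map \<rho> (?h gs)) = \<dots>" .
  have fg: "(\<lambda>xs. f (g # xs)) \<in> lists (carrier G) \<rightarrow> carrier A"
    using g by (auto intro!: funcset_mem[OF f])
  have 2: "prism A \<rho> (\<lambda>xs. f' (h \<otimes>\<^bsub>G\<^esub> g # xs)) (?h gs) = act h (prism A \<rho> (\<lambda>xs. f (g # xs)) gs)"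
  proof (rule Cons.IH[OF fg])
    fix xs assume "xs \<in> lists (carrier G)"
    then show "f' (h \<otimes>\<^bsub>G\<^esub> g # ?h xs) = act h (f (g # xs))"
      using Cons.prems(2)[of "g # xs"] g by simp
  qed
  have c: "f (g # \<rho> g # map \<rho> gs) \<in> carrier A" "prism A \<rho> (\<lambda>xs. f (g # xs)) gs \<in> carrier A"
    using funcset_mem[OF f l] prism_closed[OF assms(2) fg gs] by auto
  show ?case using c 1 2 by (simp add: a_minus_def)
qed

text \<open>Retract \<open>G\<close> onto \<open>P\<close> and correct by the prism.\<close>

lemma restriction_primitive:
  assumes P: "subgroup P G" "finite (carrier G)" and f: "f \<in> carrier (cocycles G A act (Suc n))"
    and res: "restrict f (tuples (G\<lparr>carrier := P\<rparr>) (Suc n))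
      \<in> coboundaries (G\<lparr>carrier := P\<rparr>) A act (Suc n)"
  obtains \<beta> where "\<beta> \<in> lists (carrier G) \<rightarrow> carrier A"
    "\<And>h gs. h \<in> P \<Longrightarrow> gs \<in> lists (carrier G) \<Longrightarrow> \<beta> (map (\<lambda>g. h \<otimes>\<^bsub>G\<^esub> g) gs) = act h (\<beta> gs)"
    "\<And>gs. gs \<in> tuples G (Suc n) \<Longrightarrow> list_coboundary A \<beta> gs = f gs"
proof -
  interpret P: finite_index_pair G P
    using P G.group_axioms by (intro finite_index_pair.intro finite_index_pair_axioms.intro)
  let ?P = "G\<lparr>carrier := P\<rparr>"
  interpret MP: group_module ?P A act using P(1) by (rule group_module_subgroup)
  have fc: "f \<in> carrier (cochains G A act (Suc n))" using f by (simp add: cocycles_iff)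
  obtain b where b: "b \<in> carrier (cochains ?P A act n)"
    and fb: "restrict f (tuples ?P (Suc n)) = coboundary_map ?P A n b"
    using res by auto
  \<comment> \<open>The \<open>P\<close>-part of \<open>g\<close> in the factorization of
    \<open>g\<close> as an element of \<open>P\<close> times its representative; it commutes with
    left translation by \<open>P\<close>.\<close>
  define \<rho> where "\<rho> g = g \<otimes>\<^bsub>G\<^esub> inv\<^bsub>G\<^esub> (coset_rep G P g)" for g
  have \<rho>P: "\<rho> \<in> carrier G \<rightarrow> P" using P.coset_rep_div by (auto simp: \<rho>_def)
  then have \<rho>: "\<rho> \<in> carrier G \<rightarrow> carrier G" using P.subset by blast
  have \<rho>h: "\<rho> (h \<otimes>\<^bsub>G\<^esub> g) = h \<otimes>\<^bsub>G\<^esub> \<rho> g" if "h \<in> P" "g \<in> carrier G" for h g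
  proof -
    have "coset_rep G P g \<in> carrier G" using that by (intro P.coset_rep_closed)
    then show ?thesis
      unfolding \<rho>_def P.coset_rep_mult[OF that] using that P.mem_carrier by (simp add: G.m_assoc)
  qed
  have \<rho>t: "map \<rho> gs \<in> tuples ?P m" if "gs \<in> tuples G m" for gs m
    using that \<rho>P by (auto simp: tuples_def)
  \<comment> \<open>The pullback along \<open>\<rho>\<close> of a primitive \<open>b\<close> on
    \<open>P\<close>; its coboundary at a tuple \<open>gs\<close> is \<open>f\<close> at
    \<open>map \<rho> gs\<close>.\<close>
  define b' where "b' gs = (if gs \<in> tuples G n then b (map \<rho> gs) else \<zero>)" for gs
  have b'c: "b' \<in> lists (carrier G) \<rightarrow> carrier A"
    using MP.cochain_closed[OF b] \<rho>t by (auto simp: b'_def)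
  define H where "H = prism A \<rho> (zero_extend (Suc n) f)"
  have fz: "zero_extend (Suc n) f \<in> lists (carrier G) \<rightarrow> carrier A"
    using fc by (rule zero_extend_closed)
  have Hc: "H \<in> lists (carrier G) \<rightarrow> carrier A"
    unfolding H_def using prism_closed[OF \<rho> fz] by blast
  show thesis
  \<comment> \<open>The coboundary of \<open>H\<close> is the pullback of \<open>f\<close> minus
    \<open>f\<close>, so subtracting \<open>H\<close> from \<open>b'\<close> leaves
    \<open>f\<close>. Equivariance holds for \<open>P\<close> only, as it does for
    \<open>\<rho>\<close>.\<close>
  proof (rule that[of "\<lambda>gs. b' gs \<ominus> H gs"])
    show "(\<lambda>gs. b' gs \<ominus> H gs) \<in> lists (carrier G) \<rightarrow> carrier A"
      by (intro Pi_I minus_closed funcset_mem[OF b'c] funcset_mem[OF Hc])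
  next
    fix h gs assume h: "h \<in> P" and gs: "gs \<in> lists (carrier G)"
    let ?h = "map (\<lambda>g. h \<otimes>\<^bsub>G\<^esub> g)"
    have hG: "h \<in> carrier G" using h by (rule P.mem_carrier)
    interpret h: abelian_group_hom A A "act h" by (rule act_hom[OF hG])
    have tr: "?h xs \<in> tuples G m \<longleftrightarrow> xs \<in> tuples G m" if "xs \<in> lists (carrier G)" for xs m
      using translate_lists[OF hG that] that by (simp add: tuples_iff del: lists_eq_set)
    have 1: "b' (?h gs) = act h (b' gs)"
    proof (cases "gs \<in> tuples G n")
      case True
      have "map \<rho> (?h gs) = ?h (map \<rho> gs)" using gs \<rho>h[OF h] by auto
      then have "b (map \<rho> (?h gs)) = act h (b (map \<rho> gs))"
        using b h \<rho>t[OF True] by (simp add: MP.cochains_iff del: map_map)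
      then show ?thesis using True tr[OF gs] by (simp add: b'_def)
    next
      case False
      then show ?thesis using tr[OF gs] by (simp add: b'_def)
    qed
    have 2: "H (?h gs) = act h (H gs)"
      unfolding H_def
    proof (rule prism_translate[OF hG \<rho> \<rho>h[OF h] fz _ gs])
      fix xs assume xs: "xs \<in> lists (carrier G)"
      show "zero_extend (Suc n) f (?h xs) = act h (zero_extend (Suc n) f xs)"
        using fc hG tr[OF xs] by (auto simp: zero_extend_def cochains_iff)
    qed
    show "b' (?h gs) \<ominus> H (?h gs) = act h (b' gs \<ominus> H gs)"
      unfolding 1 2 using funcset_mem[OF b'c gs] funcset_mem[OF Hc gs] by (simp add: a_minus_def)
  next
    fix gs assume gs: "gs \<in> tuples G (Suc n)"
    then have gsl: "gs \<in> lists (carrier G)" by (rule tuples_lists)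
    have \<rho>gs: "map \<rho> gs \<in> tuples ?P (Suc n)" using gs by (rule \<rho>t)
    have \<rho>gs': "map \<rho> gs \<in> tuples G (Suc n)" using gs \<rho> by (auto simp: tuples_def)
    have bP: "MP.zero_extend n b \<in> lists P \<rightarrow> carrier A" using MP.zero_extend_closed[OF b] by simp
    have "list_coboundary A b' gs = list_coboundary A (\<lambda>xs. MP.zero_extend n b (map \<rho> xs)) gs"
    proof (rule list_coboundary_cong)
      show "b' (omit i gs) = MP.zero_extend n b (map \<rho> (omit i gs))" if "i < length gs" for i
        using omit_in_tuples[OF gs that] \<rho>t by (simp add: b'_def MP.zero_extend_def)
      show "(\<lambda>xs. MP.zero_extend n b (map \<rho> xs)) \<in> lists (carrier G) \<rightarrow> carrier A"
      proof
        fix xs assume "xs \<in> lists (carrier G)"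
        then have "map \<rho> xs \<in> lists P" using \<rho>P by (auto simp: in_lists_conv_set)
        then show "MP.zero_extend n b (map \<rho> xs) \<in> carrier A" by (rule funcset_mem[OF bP])
      qed
    qed (rule gsl)
    also have "\<dots> = list_coboundary A (MP.zero_extend n b) (map \<rho> gs)"
      by (rule list_coboundary_map)
    also have "\<dots> = coboundary_map ?P A n b (map \<rho> gs)"
      using MP.list_coboundary_zero_extend[OF b \<rho>gs] coboundary_map_eq[OF \<rho>gs] by metis
    also have "\<dots> = f (map \<rho> gs)" using fun_cong[OF fb, of "map \<rho> gs"] \<rho>gs by simp
    finally have 1: "list_coboundary A b' gs = f (map \<rho> gs)" .
    \<comment> \<open>The cocycle condition removes the second term of the homotopy
      identity.\<close>
    have "prism A \<rho> (list_coboundary A (zero_extend (Suc n) f)) gs = \<zero>"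
      by (rule prism_zero[OF \<rho> list_coboundary_zero_extend_cocycle[OF f] gsl])
    then have 2: "list_coboundary A H gs \<oplus> \<zero> = f (map \<rho> gs) \<ominus> f gs"
      using prism_homotopy[OF \<rho> fz gsl] gs \<rho>gs' by (simp add: H_def zero_extend_def)
    have c: "f gs \<in> carrier A" "f (map \<rho> gs) \<in> carrier A" "list_coboundary A H gs \<in> carrier A"
      using cochain_closed[OF fc] gs \<rho>gs' list_coboundary_closed[OF Hc gsl] by auto
    have "list_coboundary A (\<lambda>gs. b' gs \<ominus> H gs) gs = f (map \<rho> gs) \<ominus> (f (map \<rho> gs) \<ominus> f gs)"
      using list_coboundary_minus[OF b'c Hc gsl] 1 2 c by simp
    also have "\<dots> = f (map \<rho> gs) \<oplus> (\<ominus> f (map \<rho> gs) \<oplus> f gs)"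
      using c by (simp add: a_minus_def minus_add)
    also have "\<dots> = f gs" using c by (simp add: r_neg2)
    finally show "list_coboundary A (\<lambda>gs. b' gs \<ominus> H gs) gs = f gs" .
  qed
qed

text \<open>Summing a \<open>P\<close>-equivariant primitive \<open>\<beta>\<close> of
  \<open>f\<close>, twisted by \<open>T\<close>, over the cosets of \<open>P\<close> gives a
  \<open>G\<close>-equivariant cochain; its coboundary is the given function because
  \<open>f\<close> itself is equivariant. At cochain level this is the transfer of the image under
  \<open>T\<close> of the restricted class.\<close>

lemma transfer:
  assumes P: "subgroup P G" "finite (carrier G)" and T: "abelian_group_hom A A T"
    and TP: "\<And>h m. h \<in> P \<Longrightarrow> m \<in> carrier A \<Longrightarrow> T (act h m) = act h (T m)"
    and f: "f \<in> carrier (cocycles G A act n)"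
    and res: "restrict f (tuples (G\<lparr>carrier := P\<rparr>) n) \<in> coboundaries (G\<lparr>carrier := P\<rparr>) A act n"
  shows "(\<lambda>gs\<in>tuples G n. \<Oplus>s\<in>transversal G P. act (inv\<^bsub>G\<^esub> s) (T (act s (f gs))))
    \<in> coboundaries G A act n"
proof -
  interpret P: finite_index_pair G P
    using P G.group_axioms by (intro finite_index_pair.intro finite_index_pair_axioms.intro)
  interpret T: abelian_group_hom A A T by fact
  let ?P = "G\<lparr>carrier := P\<rparr>" and ?S = "transversal G P"
  interpret MP: group_module ?P A act using P(1) by (rule group_module_subgroup)
  note S = P.transversal_subset[THEN subsetD]
  have fc: "f \<in> carrier (cochains G A act n)" using f by (simp add: cocycles_iff)
  show ?thesis
  proof (cases n)
    \<comment> \<open>In degree 0 the only coboundary is zero, so there is no primitive; instead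
      \<open>f\<close> vanishes at the identity and then everywhere by equivariance.\<close>
    case 0
    have "f gs = \<zero>" if gs: "gs \<in> tuples G 0" for gs
    proof -
      obtain g where g: "gs = [g]" "g \<in> carrier G"
        using gs by (auto simp: tuples_def length_Suc_conv)
      have "[\<one>\<^bsub>G\<^esub>] \<in> tuples ?P 0" using P.one_closed by (simp add: tuples_def)
      moreover have "restrict f (tuples ?P 0) = (\<lambda>gs\<in>tuples ?P 0. \<zero>)" using res 0 by simp
      ultimately have "f [\<one>\<^bsub>G\<^esub>] = \<zero>" by (metis restrict_apply')
      moreover have "f (map (\<lambda>h. g \<otimes>\<^bsub>G\<^esub> h) [\<one>\<^bsub>G\<^esub>]) = act g (f [\<one>\<^bsub>G\<^esub>])"
      proof -
        have "[\<one>\<^bsub>G\<^esub>] \<in> tuples G n" using 0 by (simp add: tuples_def)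
        then show ?thesis using fc g(2) unfolding cochains_iff by blast
      qed
      ultimately show ?thesis using g abelian_group_hom.hom_zero[OF act_hom] by simp
    qed
    then have "(\<Oplus>s\<in>?S. act (inv\<^bsub>G\<^esub> s) (T (act s (f gs)))) = \<zero>" if "gs \<in> tuples G 0" for gs
      using that abelian_group_hom.hom_zero[OF act_hom] S by (intro add.finprod_one_eqI) simp
    then have "(\<lambda>gs\<in>tuples G 0. \<Oplus>s\<in>?S. act (inv\<^bsub>G\<^esub> s) (T (act s (f gs)))) = (\<lambda>gs\<in>tuples G 0. \<zero>)"
      by (intro restrict_ext)
    then show ?thesis using 0 by simp
  next
    case (Suc k)
    obtain \<beta> where \<beta>: "\<beta> \<in> lists (carrier G) \<rightarrow> carrier A"
      and \<beta>P: "\<And>h gs. h \<in> P \<Longrightarrow> gs \<in> lists (carrier G) \<Longrightarrow> \<beta> (map (\<lambda>g. h \<otimes>\<^bsub>G\<^esub> g) gs) = act h (\<beta> gs)"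
      and d\<beta>: "\<And>gs. gs \<in> tuples G (Suc k) \<Longrightarrow> list_coboundary A \<beta> gs = f gs"
      using restriction_primitive[OF P, of f k] f res Suc by metis
    let ?tr = "\<lambda>u. map (\<lambda>h. u \<otimes>\<^bsub>G\<^esub> h)"
    define w where "w gs u = act (inv\<^bsub>G\<^esub> u) (T (\<beta> (?tr u gs)))" for gs u
    have \<beta>c: "\<beta> (?tr u gs) \<in> carrier A" if "u \<in> carrier G" "gs \<in> lists (carrier G)" for u gs
      using funcset_mem[OF \<beta> translate_lists[OF that]] .
    have wc: "w gs u \<in> carrier A" if "gs \<in> lists (carrier G)" "u \<in> carrier G" for gs u
      unfolding w_def using \<beta>c[OF that(2,1)] that by (intro act_closed) auto
    have tr_mult: "?tr (u \<otimes>\<^bsub>G\<^esub> g) gs = ?tr u (?tr g gs)"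
      if "u \<in> carrier G" "g \<in> carrier G" "gs \<in> lists (carrier G)" for u g gs
      using that by (auto simp: G.m_assoc)
    \<comment> \<open>Since \<open>\<beta>\<close> and \<open>T\<close> are
      \<open>P\<close>-equivariant, the summand depends on the right coset of \<open>u\<close> only,
      which makes the sum independent of the transversal.\<close>
    have w_inv: "w gs (h \<otimes>\<^bsub>G\<^esub> u) = w gs u" if "h \<in> P" "u \<in> carrier G" "gs \<in> lists (carrier G)" for gs h u
    proof -
      have hG: "h \<in> carrier G" using that by simp
      have "\<beta> (?tr (h \<otimes>\<^bsub>G\<^esub> u) gs) = act h (\<beta> (?tr u gs))"
        unfolding tr_mult[OF hG that(2,3)] using that translate_lists by (intro \<beta>P)
      then have "w gs (h \<otimes>\<^bsub>G\<^esub> u)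
          = act (inv\<^bsub>G\<^esub> u) (act (inv\<^bsub>G\<^esub> h) (act h (T (\<beta> (?tr u gs)))))"
        unfolding w_def using that hG \<beta>c[OF that(2,3)]
        by (simp add: TP G.inv_mult_group act_mult act_closed)
      also have "act (inv\<^bsub>G\<^esub> h) (act h (T (\<beta> (?tr u gs)))) = T (\<beta> (?tr u gs))"
        using hG \<beta>c[OF that(2,3)] act_mult[of "inv\<^bsub>G\<^esub> h" h] by (simp add: act_one)
      finally show ?thesis by (simp add: w_def)
    qed
    define c where "c = (\<lambda>gs\<in>tuples G k. \<Oplus>s\<in>?S. w gs s)"
    have c_cochain: "c \<in> carrier (cochains G A act k)"
      unfolding cochains_iff
    proof (intro conjI ballI)
      show "c \<in> extensional (tuples G k)" by (simp add: c_def)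
      fix gs assume gs: "gs \<in> tuples G k"
      then have gsl: "gs \<in> lists (carrier G)" by (rule tuples_lists)
      show "c gs \<in> carrier A"
        using gs wc[OF gsl] S by (auto simp: c_def intro!: finsum_closed)
      fix g assume g: "g \<in> carrier G"
      interpret g: abelian_group_hom A A "act g" by (rule act_hom[OF g])
      have "c (?tr g gs) = (\<Oplus>s\<in>?S. w (?tr g gs) s)"
        using translate_tuples[OF g gs] by (simp add: c_def)
      also have "\<dots> = (\<Oplus>s\<in>?S. act g (w gs (s \<otimes>\<^bsub>G\<^esub> g)))"
      proof (rule finsum_cong')
        show "(\<lambda>s. act g (w gs (s \<otimes>\<^bsub>G\<^esub> g))) \<in> ?S \<rightarrow> carrier A"
          using g wc[OF gsl] S by (intro Pi_I act_closed) auto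
        fix s assume "s \<in> ?S"
        then have s: "s \<in> carrier G" by (rule S)
        have "act g (w gs (s \<otimes>\<^bsub>G\<^esub> g)) = act (g \<otimes>\<^bsub>G\<^esub> inv\<^bsub>G\<^esub> (s \<otimes>\<^bsub>G\<^esub> g)) (T (\<beta> (?tr (s \<otimes>\<^bsub>G\<^esub> g) gs)))"
          unfolding w_def using g s gsl \<beta>c by (simp add: act_mult)
        \<comment> \<open>Translating the tuple by \<open>g\<close> thus amounts to moving the coset
          by \<open>g\<close> and acting by \<open>g\<close> outside.\<close>
        also have "g \<otimes>\<^bsub>G\<^esub> inv\<^bsub>G\<^esub> (s \<otimes>\<^bsub>G\<^esub> g) = inv\<^bsub>G\<^esub> s"
          using g s by (simp add: G.inv_mult_group G.m_assoc[symmetric])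
        finally show "w (?tr g gs) s = act g (w gs (s \<otimes>\<^bsub>G\<^esub> g))"
          unfolding tr_mult[OF s g gsl] w_def by simp
      qed simp
      also have "\<dots> = act g (\<Oplus>s\<in>?S. w gs (s \<otimes>\<^bsub>G\<^esub> g))"
        using g wc[OF gsl] S by (intro g.hom_finsum[symmetric]) auto
      also have "(\<Oplus>s\<in>?S. w gs (s \<otimes>\<^bsub>G\<^esub> g)) = (\<Oplus>s\<in>?S. w gs s)"
        by (rule P.finprod_transversal_translate[of "add_monoid A" "w gs", folded finsum_def])
          (use wc[OF gsl] w_inv[OF _ _ gsl] g add.comm_monoid_axioms in auto)
      finally show "c (?tr g gs) = act g (c gs)" using gs by (simp add: c_def)
    qed
    have "coboundary_map G A k c
        = (\<lambda>gs\<in>tuples G (Suc k). \<Oplus>s\<in>?S. act (inv\<^bsub>G\<^esub> s) (T (act s (f gs))))"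
    proof (rule extensionalityI[of _ "tuples G (Suc k)"])
      fix gs assume gs: "gs \<in> tuples G (Suc k)"
      then have gsl: "gs \<in> lists (carrier G)" by (rule tuples_lists)
      have wS: "(\<lambda>gs. w gs s) \<in> lists (carrier G) \<rightarrow> carrier A" if "s \<in> ?S" for s
        using wc S[OF that] by blast
      have "coboundary_map G A k c gs = list_coboundary A c gs" using gs by (rule coboundary_map_eq)
      also have "\<dots> = list_coboundary A (\<lambda>gs. \<Oplus>s\<in>?S. w gs s) gs"
      proof (rule list_coboundary_cong)
        show "c (omit i gs) = (\<Oplus>s\<in>?S. w (omit i gs) s)" if "i < length gs" for i
          using omit_in_tuples[OF gs that] by (simp add: c_def)
        show "(\<lambda>gs. \<Oplus>s\<in>?S. w gs s) \<in> lists (carrier G) \<rightarrow> carrier A"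
          using wc S by (intro Pi_I finsum_closed) blast
      qed (rule gsl)
      also have "\<dots> = (\<Oplus>s\<in>?S. list_coboundary A (\<lambda>gs. w gs s) gs)"
        using P.transversal_finite wS gsl by (intro list_coboundary_finsum)
      also have "\<dots> = (\<Oplus>s\<in>?S. act (inv\<^bsub>G\<^esub> s) (T (act s (f gs))))"
      proof (rule finsum_cong')
        show "(\<lambda>s. act (inv\<^bsub>G\<^esub> s) (T (act s (f gs)))) \<in> ?S \<rightarrow> carrier A"
          using S cochain_closed[OF fc] gs Suc by (auto intro!: act_closed T.hom_closed)
        fix s assume "s \<in> ?S"
        then have s: "s \<in> carrier G" "inv\<^bsub>G\<^esub> s \<in> carrier G" using S by auto
        have \<beta>s: "(\<lambda>xs. \<beta> (?tr s xs)) \<in> lists (carrier G) \<rightarrow> carrier A" using \<beta>c[OF s(1)] by blast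
        have T\<beta>s: "(\<lambda>xs. T (\<beta> (?tr s xs))) \<in> lists (carrier G) \<rightarrow> carrier A"
          using T.hom_closed[OF funcset_mem[OF \<beta>s]] by blast
        have "list_coboundary A (\<lambda>gs. w gs s) gs
            = act (inv\<^bsub>G\<^esub> s) (list_coboundary A (\<lambda>xs. T (\<beta> (?tr s xs))) gs)"
          unfolding w_def by (rule list_coboundary_additive[OF act_hom[OF s(2)] T\<beta>s gsl])
        also have "list_coboundary A (\<lambda>xs. T (\<beta> (?tr s xs))) gs
            = T (list_coboundary A (\<lambda>xs. \<beta> (?tr s xs)) gs)"
          by (rule list_coboundary_additive[OF T \<beta>s gsl])
        also have "list_coboundary A (\<lambda>xs. \<beta> (?tr s xs)) gs = f (?tr s gs)"
          unfolding list_coboundary_map using d\<beta> translate_tuples[OF s(1) gs] by simp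
        also have "f (?tr s gs) = act s (f gs)" using fc s gs Suc by (simp add: cochains_iff)
        finally show "list_coboundary A (\<lambda>gs. w gs s) gs = act (inv\<^bsub>G\<^esub> s) (T (act s (f gs)))" .
      qed simp
      finally show "coboundary_map G A k c gs
        = (\<lambda>gs\<in>tuples G (Suc k). \<Oplus>s\<in>?S. act (inv\<^bsub>G\<^esub> s) (T (act s (f gs)))) gs"
        using gs by simp
    qed (rule coboundary_map_extensional, rule restrict_extensional)
    then show ?thesis unfolding Suc coboundaries.simps by (rule image_eqI[OF sym c_cochain])
  qed
qed

end

section \<open>Cohomology classes\<close>

text \<open>By \<open>list_coboundary_Cons\<close> and induction, the part of the sum that keeps the
  head equals the coboundary of \<open>f\<close> at the tail, which is also the term that drops the
  head; the two occur with opposite signs.\<close>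

lemma (in list_cochains) list_coboundary_list_coboundary:
  assumes "f \<in> lists C \<rightarrow> carrier A" "gs \<in> lists C"
  shows "list_coboundary A (list_coboundary A f) gs = \<zero>"
  using assms(2,1)
proof (induction gs arbitrary: f rule: lists.induct)
  case (Cons g gs)
  note g = Cons.hyps(1) and gs = Cons.hyps(2) and f = Cons.prems
  define fg where "fg = (\<lambda>xs. f (g # xs))"
  have fgc: "fg \<in> lists C \<rightarrow> carrier A"
    using g by (auto simp: fg_def intro!: funcset_mem[OF f])
  have dc: "list_coboundary A f \<in> lists C \<rightarrow> carrier A" "list_coboundary A fg \<in> lists C \<rightarrow> carrier A"
    using list_coboundary_closed[OF f] list_coboundary_closed[OF fgc] by blast+
  have c: "list_coboundary A f gs \<in> carrier A" by (rule funcset_mem[OF dc(1) gs])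
  have "list_coboundary A (\<lambda>xs. list_coboundary A f (g # xs)) gs
      = list_coboundary A (\<lambda>xs. f xs \<ominus> list_coboundary A fg xs) gs"
  proof (rule list_coboundary_cong)
    show "list_coboundary A f (g # omit i gs) = f (omit i gs) \<ominus> list_coboundary A fg (omit i gs)" for i
      unfolding fg_def by (rule list_coboundary_Cons[OF f g omit_in_lists[OF gs]])
    show "(\<lambda>xs. f xs \<ominus> list_coboundary A fg xs) \<in> lists C \<rightarrow> carrier A"
      by (intro Pi_I minus_closed funcset_mem[OF f] funcset_mem[OF dc(2)])
  qed (rule gs)
  also have "\<dots> = list_coboundary A f gs \<ominus> list_coboundary A (list_coboundary A fg) gs"
    by (rule list_coboundary_minus[OF f dc(2) gs])
  also have "\<dots> = list_coboundary A f gs \<ominus> \<zero>" using Cons.IH[OF fgc] by simp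
  also have "\<dots> = list_coboundary A f gs"
    using c abelian_group_hom.hom_zero[OF abelian_group_hom_a_inv] by (simp only: a_minus_def r_zero)
  finally show ?case
    using list_coboundary_Cons[OF dc(1) g gs] r_neg[OF c] by (simp add: a_minus_def)
qed simp

context group_module
begin

lemma coboundary_closed: "b \<in> coboundaries G A act n \<Longrightarrow> gs \<in> tuples G n \<Longrightarrow> b gs \<in> carrier A"
proof (cases n)
  case (Suc k)
  assume "b \<in> coboundaries G A act n" and gs: "gs \<in> tuples G n"
  then obtain c where c: "c \<in> carrier (cochains G A act k)" "b = coboundary_map G A k c"
    using Suc by auto
  have "b gs = list_coboundary A (zero_extend k c) gs"
    using c gs Suc coboundary_map_eq list_coboundary_zero_extend by metis
  then show ?thesis
    using list_coboundary_closed[OF zero_extend_closed[OF c(1)] tuples_lists[OF gs]] by simp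
qed auto

lemma coboundary_extensional: "b \<in> coboundaries G A act n \<Longrightarrow> b \<in> extensional (tuples G n)"
  by (cases n) (auto simp: coboundary_map_def)

text \<open>An equivariant \<open>T\<close> carries cochains to cochains and commutes with the
  coboundary. This makes multiplication by an invariant scalar independent of the
  representative.\<close>

lemma coboundaries_additive:
  assumes T: "abelian_group_hom A A T"
    and TG: "\<And>g m. g \<in> carrier G \<Longrightarrow> m \<in> carrier A \<Longrightarrow> T (act g m) = act g (T m)"
    and b: "b \<in> coboundaries G A act n"
  shows "(\<lambda>gs\<in>tuples G n. T (b gs)) \<in> coboundaries G A act n"
proof (cases n)
  case 0
  interpret T: abelian_group_hom A A T by fact
  have "(\<lambda>gs\<in>tuples G 0. T (b gs)) = (\<lambda>gs\<in>tuples G 0. \<zero>)"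
    using b 0 by (intro restrict_ext) simp
  then show ?thesis using 0 by simp
next
  case (Suc k)
  interpret T: abelian_group_hom A A T by fact
  obtain c where c: "c \<in> carrier (cochains G A act k)" "b = coboundary_map G A k c"
    using b Suc by auto
  let ?c = "\<lambda>gs\<in>tuples G k. T (c gs)"
  have c': "?c \<in> carrier (cochains G A act k)"
    using c(1) TG translate_tuples unfolding cochains_iff by (auto simp: T.hom_closed)
  have "coboundary_map G A k ?c = (\<lambda>gs\<in>tuples G (Suc k). T (b gs))"
  proof (rule extensionalityI[of _ "tuples G (Suc k)"])
    fix gs assume gs: "gs \<in> tuples G (Suc k)"
    note gsl = tuples_lists[OF gs]
    have "coboundary_map G A k ?c gs = list_coboundary A ?c gs" using gs by (rule coboundary_map_eq)
    also have "\<dots> = list_coboundary A (\<lambda>xs. T (zero_extend k c xs)) gs"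
    proof (rule list_coboundary_cong)
      show "?c (omit i gs) = T (zero_extend k c (omit i gs))" if "i < length gs" for i
        using omit_in_tuples[OF gs that] by (simp add: zero_extend_def)
      show "(\<lambda>xs. T (zero_extend k c xs)) \<in> lists (carrier G) \<rightarrow> carrier A"
        using T.hom_closed[OF funcset_mem[OF zero_extend_closed[OF c(1)]]] by blast
    qed (rule gsl)
    also have "\<dots> = T (list_coboundary A (zero_extend k c) gs)"
      by (rule list_coboundary_additive[OF T zero_extend_closed[OF c(1)] gsl])
    also have "list_coboundary A (zero_extend k c) gs = b gs"
      unfolding c(2) coboundary_map_eq[OF gs] by (rule list_coboundary_zero_extend[OF c(1) gs])
    finally show "coboundary_map G A k ?c gs = (\<lambda>gs\<in>tuples G (Suc k). T (b gs)) gs"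
      unfolding restrict_apply'[OF gs] .
  qed (rule coboundary_map_extensional, rule restrict_extensional)
  then show ?thesis unfolding Suc coboundaries.simps by (rule image_eqI[OF sym c'])
qed

lemma cochains_minus:
  assumes "f \<in> carrier (cochains G A act n)" "f' \<in> carrier (cochains G A act n)"
  shows "(\<lambda>gs\<in>tuples G n. f gs \<ominus> f' gs) \<in> carrier (cochains G A act n)"
  unfolding cochains_iff
proof (intro conjI ballI)
  let ?f = "\<lambda>gs\<in>tuples G n. f gs \<ominus> f' gs"
  fix gs assume gs: "gs \<in> tuples G n"
  have cl: "f gs \<in> carrier A" "f' gs \<in> carrier A" using cochain_closed assms gs by auto
  then show "?f gs \<in> carrier A" using gs by simp
  fix g assume g: "g \<in> carrier G"
  interpret g: abelian_group_hom A A "act g" by (rule act_hom[OF g])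
  show "?f (map (\<lambda>h. g \<otimes>\<^bsub>G\<^esub> h) gs) = act g (?f gs)"
    using assms cl g gs translate_tuples[OF g gs] unfolding cochains_iff by (simp add: a_minus_def)
qed simp

lemma list_coboundary_cochains_minus:
  assumes f: "f \<in> carrier (cochains G A act n)" and f': "f' \<in> carrier (cochains G A act n)"
    and gs: "gs \<in> tuples G (Suc n)"
  shows "list_coboundary A (\<lambda>gs\<in>tuples G n. f gs \<ominus> f' gs) gs
    = list_coboundary A f gs \<ominus> list_coboundary A f' gs"
proof -
  let ?f = "\<lambda>gs\<in>tuples G n. f gs \<ominus> f' gs"
  note gsl = tuples_lists[OF gs]
  note z = zero_extend_closed[OF f] zero_extend_closed[OF f']
  have "list_coboundary A ?f gs = list_coboundary A (\<lambda>xs. zero_extend n f xs \<ominus> zero_extend n f' xs) gs"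
  proof (rule list_coboundary_cong)
    show "?f (omit i gs) = zero_extend n f (omit i gs) \<ominus> zero_extend n f' (omit i gs)"
      if "i < length gs" for i
      using omit_in_tuples[OF gs that] by (simp add: zero_extend_def)
    show "(\<lambda>xs. zero_extend n f xs \<ominus> zero_extend n f' xs) \<in> lists (carrier G) \<rightarrow> carrier A"
      by (intro Pi_I minus_closed funcset_mem[OF z(1)] funcset_mem[OF z(2)])
  qed (rule gsl)
  also have "\<dots> = list_coboundary A (zero_extend n f) gs \<ominus> list_coboundary A (zero_extend n f') gs"
    by (rule list_coboundary_minus[OF z gsl])
  finally show ?thesis
    by (simp only: list_coboundary_zero_extend[OF f gs] list_coboundary_zero_extend[OF f' gs])
qed

lemma coboundaries_minus:
  assumes b: "b \<in> coboundaries G A act n" and b': "b' \<in> coboundaries G A act n"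
  shows "(\<lambda>gs\<in>tuples G n. b gs \<ominus> b' gs) \<in> coboundaries G A act n"
proof (cases n)
  case 0
  have "(\<lambda>gs\<in>tuples G 0. b gs \<ominus> b' gs) = (\<lambda>gs\<in>tuples G 0. \<zero>)"
    using b b' 0 r_neg[OF zero_closed] by (intro restrict_ext) (simp add: a_minus_def)
  then show ?thesis using 0 by simp
next
  case (Suc k)
  obtain c where c: "c \<in> carrier (cochains G A act k)" "b = coboundary_map G A k c"
    using b Suc by auto
  obtain c' where c': "c' \<in> carrier (cochains G A act k)" "b' = coboundary_map G A k c'"
    using b' Suc by auto
  let ?c = "\<lambda>gs\<in>tuples G k. c gs \<ominus> c' gs"
  have "coboundary_map G A k ?c = (\<lambda>gs\<in>tuples G (Suc k). b gs \<ominus> b' gs)"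
  proof (rule extensionalityI[of _ "tuples G (Suc k)"])
    fix gs assume gs: "gs \<in> tuples G (Suc k)"
    show "coboundary_map G A k ?c gs = (\<lambda>gs\<in>tuples G (Suc k). b gs \<ominus> b' gs) gs"
      unfolding restrict_apply'[OF gs] c(2) c'(2) coboundary_map_eq[OF gs]
      by (rule list_coboundary_cochains_minus[OF c(1) c'(1) gs])
  qed (rule coboundary_map_extensional, rule restrict_extensional)
  then show ?thesis
    unfolding Suc coboundaries.simps by (rule image_eqI[OF sym cochains_minus[OF c(1) c'(1)]])
qed

lemma cocycles_minus:
  assumes "f \<in> carrier (cocycles G A act n)" "f' \<in> carrier (cocycles G A act n)"
  shows "(\<lambda>gs\<in>tuples G n. f gs \<ominus> f' gs) \<in> carrier (cocycles G A act n)"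
  using assms cochains_minus list_coboundary_cochains_minus r_neg[OF zero_closed]
  by (simp add: cocycles_iff a_minus_def)

lemma cochains_zero: "(\<lambda>gs\<in>tuples G n. \<zero>) \<in> carrier (cochains G A act n)"
  unfolding cochains_iff using translate_tuples abelian_group_hom.hom_zero[OF act_hom] by simp

lemma coboundaries_zero: "(\<lambda>gs\<in>tuples G n. \<zero>) \<in> coboundaries G A act n"
proof -
  obtain b where b: "b \<in> coboundaries G A act n"
    using cochains_zero by (cases n) auto
  have "(\<lambda>gs\<in>tuples G n. b gs \<ominus> b gs) = (\<lambda>gs\<in>tuples G n. \<zero>)"
    using coboundary_closed[OF b] by (intro restrict_ext) (simp add: a_minus_def r_neg)
  then show ?thesis using coboundaries_minus[OF b b] by simp
qed

text \<open>In positive degree, omission commutes with translating all entries, so a coboundary is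
  equivariant, and the coboundary squares to zero.\<close>

lemma coboundaries_cocycles: "coboundaries G A act n \<subseteq> carrier (cocycles G A act n)"
proof
  fix b assume b: "b \<in> coboundaries G A act n"
  show "b \<in> carrier (cocycles G A act n)"
  proof (cases n)
    case 0
    \<comment> \<open>Writing zero as zero minus zero shows that its coboundary is a difference of
      equal terms.\<close>
    have "(\<lambda>gs\<in>tuples G 0. (\<lambda>gs\<in>tuples G 0. \<zero>) gs \<ominus> (\<lambda>gs\<in>tuples G 0. \<zero>) gs) = (\<lambda>gs\<in>tuples G 0. \<zero>)"
      using r_neg[OF zero_closed] by (intro restrict_ext) (simp add: a_minus_def)
    moreover have "list_coboundary A (\<lambda>gs\<in>tuples G 0. \<zero>) gs = \<zero>" if gs: "gs \<in> tuples G (Suc 0)" for gs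
      using list_coboundary_cochains_minus[OF cochains_zero cochains_zero gs] calculation
        list_coboundary_zero_extend[OF cochains_zero gs]
        list_coboundary_closed[OF zero_extend_closed[OF cochains_zero[of 0]] tuples_lists[OF gs]]
      by (simp add: r_neg a_minus_def)
    ultimately show ?thesis using b 0 cochains_zero by (simp add: cocycles_iff)
  next
    case (Suc k)
    obtain c where c: "c \<in> carrier (cochains G A act k)" "b = coboundary_map G A k c"
      using b Suc by auto
    let ?z = "zero_extend k c"
    note z = zero_extend_closed[OF c(1)]
    have bz: "b gs = list_coboundary A ?z gs" if "gs \<in> tuples G n" for gs
      using c(2) coboundary_map_eq list_coboundary_zero_extend[OF c(1)] that Suc by metis
    have "b \<in> carrier (cochains G A act n)"
      unfolding cochains_iff
    proof (intro conjI ballI)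
      show "b \<in> extensional (tuples G n)" using b by (rule coboundary_extensional)
      fix gs assume gs: "gs \<in> tuples G n"
      show "b gs \<in> carrier A" using b gs by (rule coboundary_closed)
      fix g assume g: "g \<in> carrier G"
      let ?g = "map (\<lambda>h. g \<otimes>\<^bsub>G\<^esub> h)"
      have "b (?g gs) = list_coboundary A (\<lambda>xs. ?z (?g xs)) gs"
        using bz[OF translate_tuples[OF g gs]] list_coboundary_map by metis
      also have "\<dots> = list_coboundary A (\<lambda>xs. act g (?z xs)) gs"
      proof (rule list_coboundary_cong)
        fix i assume "i < length gs"
        then have o: "omit i gs \<in> tuples G k" using omit_in_tuples gs Suc by blast
        then show "?z (?g (omit i gs)) = act g (?z (omit i gs))"
          using c(1) g translate_tuples[OF g o] by (simp add: zero_extend_def cochains_iff)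
      next
        show "(\<lambda>xs. act g (?z xs)) \<in> lists (carrier G) \<rightarrow> carrier A"
          by (intro Pi_I act_closed[OF g] funcset_mem[OF z])
      qed (rule tuples_lists[OF gs])
      also have "\<dots> = act g (list_coboundary A ?z gs)"
        by (rule list_coboundary_additive[OF act_hom[OF g] z tuples_lists[OF gs]])
      finally show "b (?g gs) = act g (b gs)" using bz[OF gs] by simp
    qed
    moreover have "list_coboundary A b gs = \<zero>" if gs: "gs \<in> tuples G (Suc n)" for gs
    proof -
      have "list_coboundary A b gs = list_coboundary A (list_coboundary A ?z) gs"
      proof (rule list_coboundary_cong)
        show "b (omit i gs) = list_coboundary A ?z (omit i gs)" if "i < length gs" for i
          by (rule bz[OF omit_in_tuples[OF gs that]])
        show "list_coboundary A ?z \<in> lists (carrier G) \<rightarrow> carrier A"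
          using list_coboundary_closed[OF z] by blast
      qed (rule tuples_lists[OF gs])
      then show ?thesis using list_coboundary_list_coboundary[OF z tuples_lists[OF gs]] by simp
    qed
    ultimately show ?thesis by (simp add: cocycles_iff)
  qed
qed

lemma cocycles_ops [simp]:
  "f \<otimes>\<^bsub>cocycles G A act n\<^esub> f' = (\<lambda>gs\<in>tuples G n. f gs \<oplus> f' gs)"
  "\<one>\<^bsub>cocycles G A act n\<^esub> = (\<lambda>gs\<in>tuples G n. \<zero>)"
  by (simp_all add: cocycles_def cochains_def)

text \<open>Closure under sums follows from closure under differences by subtracting the
  negative.\<close>

lemma minus_zero_minus:
  assumes "\<And>gs. gs \<in> tuples G n \<Longrightarrow> f gs \<in> carrier A" "\<And>gs. gs \<in> tuples G n \<Longrightarrow> f' gs \<in> carrier A"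
  shows "(\<lambda>gs\<in>tuples G n. f gs \<ominus> (\<lambda>gs\<in>tuples G n. (\<lambda>gs\<in>tuples G n. \<zero>) gs \<ominus> f' gs) gs)
    = (\<lambda>gs\<in>tuples G n. f gs \<oplus> f' gs)"
  using assms by (intro restrict_ext) (simp add: a_minus_def)

lemma comm_group_cocycles: "comm_group (cocycles G A act n)"
proof (rule comm_groupI)
  let ?Z = "cocycles G A act n"
  have zero: "(\<lambda>gs\<in>tuples G n. \<zero>) \<in> carrier ?Z" using coboundaries_cocycles coboundaries_zero by blast
  have cl: "f gs \<in> carrier A" if "f \<in> carrier ?Z" "gs \<in> tuples G n" for f gs
    using that cochain_closed[of f n gs] by (simp add: cocycles_iff)
  show "\<one>\<^bsub>?Z\<^esub> \<in> carrier ?Z" using zero by simp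
  fix f assume f: "f \<in> carrier ?Z"
  have ext: "f \<in> extensional (tuples G n)" using f by (simp add: cocycles_iff cochains_iff)
  show "\<one>\<^bsub>?Z\<^esub> \<otimes>\<^bsub>?Z\<^esub> f = f"
    using cl[OF f] ext by (intro extensionalityI[of _ "tuples G n"]) simp_all
  show "\<exists>f'\<in>carrier ?Z. f' \<otimes>\<^bsub>?Z\<^esub> f = \<one>\<^bsub>?Z\<^esub>"
  proof (rule bexI)
    let ?n = "\<lambda>gs\<in>tuples G n. (\<lambda>gs\<in>tuples G n. \<zero>) gs \<ominus> f gs"
    show "?n \<otimes>\<^bsub>?Z\<^esub> f = \<one>\<^bsub>?Z\<^esub>"
      unfolding cocycles_ops using cl[OF f] by (intro restrict_ext) (simp add: a_minus_def l_neg)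
    show "?n \<in> carrier ?Z" by (rule cocycles_minus[OF zero f])
  qed
  fix f' assume f': "f' \<in> carrier ?Z"
  show "f \<otimes>\<^bsub>?Z\<^esub> f' \<in> carrier ?Z"
    using cocycles_minus[OF f cocycles_minus[OF zero f']] minus_zero_minus[of n f f'] cl[OF f] cl[OF f']
    by (simp only: cocycles_ops)
  show "f \<otimes>\<^bsub>?Z\<^esub> f' = f' \<otimes>\<^bsub>?Z\<^esub> f"
    unfolding cocycles_ops using cl[OF f] cl[OF f'] by (intro restrict_ext) (simp add: a_comm)
  fix f'' assume f'': "f'' \<in> carrier ?Z"
  show "f \<otimes>\<^bsub>?Z\<^esub> f' \<otimes>\<^bsub>?Z\<^esub> f'' = f \<otimes>\<^bsub>?Z\<^esub> (f' \<otimes>\<^bsub>?Z\<^esub> f'')"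
    unfolding cocycles_ops using cl[OF f] cl[OF f'] cl[OF f''] by (intro restrict_ext) (simp add: a_assoc)
qed

lemma coboundaries_subgroup: "subgroup (coboundaries G A act n) (cocycles G A act n)"
proof -
  let ?Z = "cocycles G A act n" and ?B = "coboundaries G A act n"
  interpret Z: comm_group ?Z by (rule comm_group_cocycles)
  have inv: "inv\<^bsub>?Z\<^esub> b = (\<lambda>gs\<in>tuples G n. (\<lambda>gs\<in>tuples G n. \<zero>) gs \<ominus> b gs)" if b: "b \<in> ?B" for b
  proof (rule Z.inv_equality)
    show "(\<lambda>gs\<in>tuples G n. (\<lambda>gs\<in>tuples G n. \<zero>) gs \<ominus> b gs) \<otimes>\<^bsub>?Z\<^esub> b = \<one>\<^bsub>?Z\<^esub>"
      unfolding cocycles_ops using coboundary_closed[OF b]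
      by (intro restrict_ext) (simp add: a_minus_def l_neg)
    show "(\<lambda>gs\<in>tuples G n. (\<lambda>gs\<in>tuples G n. \<zero>) gs \<ominus> b gs) \<in> carrier ?Z"
      using coboundaries_minus[OF coboundaries_zero b] coboundaries_cocycles by blast
  qed (use b coboundaries_cocycles in blast)
  show ?thesis
  proof (rule Z.subgroupI)
    show "?B \<noteq> {}" using coboundaries_zero by blast
    fix b assume b: "b \<in> ?B"
    show "inv\<^bsub>?Z\<^esub> b \<in> ?B" unfolding inv[OF b] by (rule coboundaries_minus[OF coboundaries_zero b])
    fix b' assume b': "b' \<in> ?B"
    show "b \<otimes>\<^bsub>?Z\<^esub> b' \<in> ?B"
      using coboundaries_minus[OF b coboundaries_minus[OF coboundaries_zero b']]
        minus_zero_minus[of n b b'] coboundary_closed[OF b] coboundary_closed[OF b']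
      by (simp only: cocycles_ops)
  qed (rule coboundaries_cocycles)
qed

lemma coboundaries_rcos:
  "c \<in> coboundaries G A act n \<Longrightarrow>
    coboundaries G A act n #>\<^bsub>cocycles G A act n\<^esub> c = coboundaries G A act n"
  using comm_group_cocycles coboundaries_subgroup
  by (simp add: subgroup.rcos_const comm_group_def)

lemma group_cohomology_group: "group (cohomology_group G A act n)"
  unfolding cohomology_group_def
  by (intro normal.factorgroup_is_group comm_group.subgroup_imp_normal comm_group_cocycles
      coboundaries_subgroup)

lemma one_total_cohomology: "\<one>\<^bsub>total_cohomology G A act\<^esub> = coboundaries G A act"
  by (auto simp: total_cohomology_def cohomology_group_def)

lemma total_cohomology_component:
  assumes "x \<in> carrier (total_cohomology G A act)"
  obtains f where "f \<in> carrier (cocycles G A act n)" "f \<in> x n"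
    "x n = coboundaries G A act n #>\<^bsub>cocycles G A act n\<^esub> f"
proof -
  have "x n \<in> carrier (cohomology_group G A act n)"
    using assms by (auto simp: total_cohomology_def carrier_sum_group group_cohomology_group)
  then obtain f where f: "f \<in> carrier (cocycles G A act n)"
    "x n = coboundaries G A act n #>\<^bsub>cocycles G A act n\<^esub> f"
    by (auto simp: cohomology_group_def FactGroup_def RCOSETS_def)
  have "f \<in> x n"
    unfolding f(2) using f(1) comm_group_cocycles coboundaries_subgroup
    by (intro group.rcos_self) (auto simp: comm_group_def)
  with f show thesis by (intro that)
qed

text \<open>\<open>restriction\<close> is a union of cosets over all representatives; if the union
  is the set of coboundaries, each coset lies in it, and the coset of the restricted
  \<open>f\<close> contains that function as zero plus itself.\<close>

lemma restriction_trivialD: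
  assumes P: "subgroup P G"
    and res: "restriction G A act P x = \<one>\<^bsub>total_cohomology (G\<lparr>carrier := P\<rparr>) A act\<^esub>"
    and f: "f \<in> x n" "f \<in> carrier (cochains G A act n)"
  shows "restrict f (tuples (G\<lparr>carrier := P\<rparr>) n) \<in> coboundaries (G\<lparr>carrier := P\<rparr>) A act n"
proof -
  let ?P = "G\<lparr>carrier := P\<rparr>"
  interpret MP: group_module ?P A act using P by (rule group_module_subgroup)
  let ?f = "restrict f (tuples ?P n)"
  have "restriction G A act P x n = coboundaries ?P A act n"
    using fun_cong[OF res] by (simp add: MP.one_total_cohomology)
  then have "coboundaries ?P A act n #>\<^bsub>cocycles ?P A act n\<^esub> ?f \<subseteq> coboundaries ?P A act n"
    using f(1) by (auto simp: restriction_def induced_map_def)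
  moreover have "(\<lambda>gs\<in>tuples ?P n. \<zero>) \<otimes>\<^bsub>cocycles ?P A act n\<^esub> ?f
      \<in> coboundaries ?P A act n #>\<^bsub>cocycles ?P A act n\<^esub> ?f"
    unfolding r_coset_def using MP.coboundaries_zero[of n] by blast
  moreover have "(\<lambda>gs\<in>tuples ?P n. \<zero>) \<otimes>\<^bsub>cocycles ?P A act n\<^esub> ?f = ?f"
  proof -
    have "f gs \<in> carrier A" if "gs \<in> tuples ?P n" for gs
      using that f(2) subgroup.subset[OF P] by (auto simp: cochains_iff tuples_def)
    then show ?thesis by (intro extensionalityI[of _ "tuples ?P n"]) auto
  qed
  ultimately show ?thesis by auto
qed

end

section \<open>Modules over the skew group ring\<close>

context finite_ring_action
begin

lemma skew_basis_closed [simp]: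
  "r \<in> carrier R \<Longrightarrow> skew_basis G R r g \<in> carrier (skew_group_ring G R \<phi>)"
  by (auto simp: skew_basis_def skew_group_ring_def)

lemma skew_basis_add:
  assumes "r \<in> carrier R" "r' \<in> carrier R"
  shows "skew_basis G R r g \<oplus>\<^bsub>skew_group_ring G R \<phi>\<^esub> skew_basis G R r' g = skew_basis G R (r \<oplus> r') g"
proof -
  have "skew_basis G R r g \<oplus>\<^bsub>skew_group_ring G R \<phi>\<^esub> skew_basis G R r' g
      = (\<lambda>k\<in>carrier G. skew_basis G R r g k \<oplus> skew_basis G R r' g k)"
    by (simp add: skew_group_ring_def)
  also have "\<dots> = skew_basis G R (r \<oplus> r') g"
    unfolding skew_basis_def by (intro restrict_ext) simp
  finally show ?thesis .
qed

text \<open>The convolution collapses to \<open>u = g\<close>, and there the second coefficient is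
  nonzero at most for \<open>k\<close> equal to the product of \<open>g\<close> and
  \<open>g'\<close>.\<close>

lemma skew_basis_mult:
  assumes "r \<in> carrier R" "r' \<in> carrier R" "g \<in> carrier G" "g' \<in> carrier G"
  shows "skew_basis G R r g \<otimes>\<^bsub>skew_group_ring G R \<phi>\<^esub> skew_basis G R r' g'
    = skew_basis G R (r \<otimes> \<phi> g r') (g \<otimes>\<^bsub>G\<^esub> g')"
proof -
  let ?b = "skew_basis G R r g" and ?b' = "skew_basis G R r' g'"
  have b': "?b' k \<in> carrier R" if "k \<in> carrier G" for k using that assms by (simp add: skew_basis_def)
  have "?b \<otimes>\<^bsub>skew_group_ring G R \<phi>\<^esub> ?b'
      = (\<lambda>k\<in>carrier G. \<Oplus>u\<in>carrier G. ?b u \<otimes> \<phi> u (?b' (inv\<^bsub>G\<^esub> u \<otimes>\<^bsub>G\<^esub> k)))"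
    by (simp add: skew_group_ring_def)
  also have "\<dots> = skew_basis G R (r \<otimes> \<phi> g r') (g \<otimes>\<^bsub>G\<^esub> g')"
    unfolding skew_basis_def[of G R "r \<otimes> \<phi> g r'"]
  proof (rule restrict_ext)
    fix k assume k: "k \<in> carrier G"
    have iff: "inv\<^bsub>G\<^esub> g \<otimes>\<^bsub>G\<^esub> k = g' \<longleftrightarrow> k = g \<otimes>\<^bsub>G\<^esub> g'"
      using assms k by (auto simp: G.m_assoc[symmetric])
    let ?f = "\<lambda>u. r \<otimes> \<phi> u (?b' (inv\<^bsub>G\<^esub> u \<otimes>\<^bsub>G\<^esub> k))"
    have f: "?f \<in> carrier G \<rightarrow> carrier R" using assms k b' by auto
    have "(\<Oplus>u\<in>carrier G. ?b u \<otimes> \<phi> u (?b' (inv\<^bsub>G\<^esub> u \<otimes>\<^bsub>G\<^esub> k)))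
        = (\<Oplus>u\<in>carrier G. if g = u then ?f u else \<zero>)"
      using f k b' by (intro finsum_cong') (auto simp: skew_basis_def[of G R r g])
    also have "\<dots> = ?f g"
      using finite_group assms f by (intro add.finprod_singleton) auto
    also have "\<dots> = (if k = g \<otimes>\<^bsub>G\<^esub> g' then r \<otimes> \<phi> g r' else \<zero>)"
      using assms k iff ring_hom_cring.hom_zero[OF act_hom_cring[OF assms(3)]]
      by (simp add: skew_basis_def)
    finally show "(\<Oplus>u\<in>carrier G. ?b u \<otimes> \<phi> u (?b' (inv\<^bsub>G\<^esub> u \<otimes>\<^bsub>G\<^esub> k)))
      = (if k = g \<otimes>\<^bsub>G\<^esub> g' then r \<otimes> \<phi> g r' else \<zero>)" .
  qed
  finally show ?thesis .
qed

end

locale skew_module = finite_ring_action G R \<phi> + M: left_module "skew_group_ring G R \<phi>" M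
  for G :: "('g, 'c) monoid_scheme" and R :: "('r, 'd) ring_scheme" (structure)
    and \<phi> :: "'g \<Rightarrow> 'r \<Rightarrow> 'r" and M :: "('g \<Rightarrow> 'r, 'm, 'e) module_scheme"
begin

abbreviation "gact \<equiv> group_act G R M"
abbreviation "sact \<equiv> scalar_act G R M"

lemma gact_hom: "g \<in> carrier G \<Longrightarrow> abelian_group_hom M M (gact g)"
  unfolding group_act_def
  by (rule M.abelian_group_endI) (auto intro: M.smult_closed M.smult_r_distr)

lemma sact_hom: "r \<in> carrier R \<Longrightarrow> abelian_group_hom M M (sact r)"
  unfolding scalar_act_def
  by (rule M.abelian_group_endI) (auto intro: M.smult_closed M.smult_r_distr)

lemma sact_scalar_hom:
  assumes "m \<in> carrier M"
  shows "abelian_group_hom R M (\<lambda>r. sact r m)"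
proof (intro abelian_group_homI abelian_group_axioms M.abelian_group_axioms group_hom.intro
    group_hom_axioms.intro a_group M.a_group homI)
  show "sact r m \<in> carrier (add_monoid M)" if "r \<in> carrier (add_monoid R)" for r
    using that assms by (auto simp: scalar_act_def intro: M.smult_closed)
  fix r r' assume "r \<in> carrier (add_monoid R)" "r' \<in> carrier (add_monoid R)"
  then show "sact (r \<otimes>\<^bsub>add_monoid R\<^esub> r') m = sact r m \<otimes>\<^bsub>add_monoid M\<^esub> sact r' m"
    unfolding scalar_act_def using assms M.smult_l_distr
    by (simp add: skew_basis_add[symmetric])
qed

lemma gact_one: "m \<in> carrier M \<Longrightarrow> gact \<one>\<^bsub>G\<^esub> m = m"
  using M.smult_one by (simp add: group_act_def skew_group_ring_def)

lemma gact_mult: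
  assumes "g \<in> carrier G" "h \<in> carrier G" "m \<in> carrier M"
  shows "gact (g \<otimes>\<^bsub>G\<^esub> h) m = gact g (gact h m)"
  unfolding group_act_def using assms
  by (simp add: M.smult_assoc[symmetric] skew_basis_mult ring_hom_one[OF act_hom])

text \<open>The commutation rule \<open>g r = g(r) g\<close> of the skew group ring. It makes
  scalars invariant under a subgroup act equivariantly for that subgroup.\<close>

lemma gact_sact:
  assumes "g \<in> carrier G" "r \<in> carrier R" "m \<in> carrier M"
  shows "gact g (sact r m) = sact (\<phi> g r) (gact g m)"
  unfolding group_act_def scalar_act_def using assms
  by (simp add: M.smult_assoc[symmetric] skew_basis_mult ring_hom_one[OF act_hom])

lemma group_module: "group_module G M gact"
  by (intro group_module.intro list_cochains.intro group_module_axioms.intro G.group_axioms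
      M.abelian_group_axioms gact_hom gact_one gact_mult)

sublocale group_module G M gact
  by (rule group_module)

text \<open>The transfer is applied with \<open>T\<close> multiplication by \<open>r\<close>, which
  is \<open>P\<close>-equivariant as \<open>r\<close> is \<open>P\<close>-invariant. Conjugating
  \<open>r\<close> through the action collects the sum over cosets into multiplication by the
  relative trace.\<close>

lemma rel_trace_mem_annihilator:
  assumes x: "x \<in> carrier (total_cohomology G M gact)" and P: "subgroup P G"
    and res: "restriction G M gact P x = \<one>\<^bsub>total_cohomology (G\<lparr>carrier := P\<rparr>) M gact\<^esub>"
    and r: "r \<in> carrier R" and rP: "\<And>h. h \<in> P \<Longrightarrow> \<phi> h r = r"
  shows "rel_trace P r \<in> cohomology_annihilator G R \<phi> M x"
proof -
  let ?t = "rel_trace P r"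
  have t: "?t \<in> fixed" using P r rP by (rule rel_trace_fixed)
  then have tR: "?t \<in> carrier R" by (simp add: fixed_iff)
  interpret P: finite_index_pair G P using P by (rule finite_index_pairI)
  note S = P.transversal_subset[THEN subsetD]
  have tG: "sact ?t (gact g m) = gact g (sact ?t m)" if "g \<in> carrier G" "m \<in> carrier M" for g m
    using gact_sact[OF that(1) tR that(2)] t that by (simp add: fixed_iff)
  interpret t: abelian_group_hom M M "sact ?t" using tR by (rule sact_hom)
  have tr: "(\<Oplus>\<^bsub>M\<^esub>s\<in>transversal G P. gact (inv\<^bsub>G\<^esub> s) (sact r (gact s m))) = sact ?t m"
    if m: "m \<in> carrier M" for m
  proof -
    interpret m: abelian_group_hom R M "\<lambda>r. sact r m" using m by (rule sact_scalar_hom)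
    have "sact ?t m = (\<Oplus>\<^bsub>M\<^esub>s\<in>transversal G P. sact (\<phi> (inv\<^bsub>G\<^esub> s) r) m)"
      unfolding rel_trace_def using S r by (intro m.hom_finsum) auto
    also have "\<dots> = (\<Oplus>\<^bsub>M\<^esub>s\<in>transversal G P. gact (inv\<^bsub>G\<^esub> s) (sact r (gact s m)))"
    proof (rule M.finsum_cong')
      fix s assume "s \<in> transversal G P"
      then have s: "s \<in> carrier G" by (rule S)
      then have sm: "gact s m \<in> carrier M" using m act_closed by simp
      have "gact (inv\<^bsub>G\<^esub> s) (sact r (gact s m)) = sact (\<phi> (inv\<^bsub>G\<^esub> s) r) (gact (inv\<^bsub>G\<^esub> s) (gact s m))"
        using s r sm by (intro gact_sact) auto
      also have "gact (inv\<^bsub>G\<^esub> s) (gact s m) = m"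
        using gact_mult[of "inv\<^bsub>G\<^esub> s" s m] s m gact_one by simp
      finally show "sact (\<phi> (inv\<^bsub>G\<^esub> s) r) m = gact (inv\<^bsub>G\<^esub> s) (sact r (gact s m))" by simp
    next
      show "(\<lambda>s. gact (inv\<^bsub>G\<^esub> s) (sact r (gact s m))) \<in> transversal G P \<rightarrow> carrier M"
        using S m by (intro Pi_I act_closed abelian_group_hom.hom_closed[OF sact_hom[OF r]]) auto
    qed simp
    finally show ?thesis by simp
  qed
  have "cohomology_scalar G R M ?t x n = coboundaries G M gact n" for n
  proof -
    let ?B = "coboundaries G M gact n" and ?Z = "cocycles G M gact n"
    obtain f where f: "f \<in> carrier ?Z" "f \<in> x n" "x n = ?B #>\<^bsub>?Z\<^esub> f"
      using total_cohomology_component[OF x] by blast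
    have fc: "f \<in> carrier (cochains G M gact n)" using f(1) by (simp add: cocycles_iff)
    have fP: "restrict f (tuples (G\<lparr>carrier := P\<rparr>) n) \<in> coboundaries (G\<lparr>carrier := P\<rparr>) M gact n"
      by (rule restriction_trivialD[OF P res f(2) fc])
    have "(\<lambda>gs\<in>tuples G n. \<Oplus>\<^bsub>M\<^esub>s\<in>transversal G P. gact (inv\<^bsub>G\<^esub> s) (sact r (gact s (f gs)))) \<in> ?B"
    proof (rule transfer[OF P finite_group sact_hom[OF r] _ f(1) fP])
      show "sact r (gact h m) = gact h (sact r m)" if "h \<in> P" "m \<in> carrier M" for h m
        using gact_sact[OF P.mem_carrier[OF that(1)] r that(2)] rP[OF that(1)] by simp
    qed
    moreover have "(\<lambda>gs\<in>tuples G n. \<Oplus>\<^bsub>M\<^esub>s\<in>transversal G P. gact (inv\<^bsub>G\<^esub> s) (sact r (gact s (f gs))))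
        = (\<lambda>gs\<in>tuples G n. sact ?t (f gs))"
      by (intro restrict_ext) (rule tr[OF cochain_closed[OF fc]])
    ultimately have tf: "(\<lambda>gs\<in>tuples G n. sact ?t (f gs)) \<in> ?B" by simp
    \<comment> \<open>The scalar action on a class unites cosets over all representatives, so each
      of them must be checked; they differ from \<open>f\<close> by coboundaries, which an invariant
      scalar preserves.\<close>
    have "(\<lambda>gs\<in>tuples G n. sact ?t (f' gs)) \<in> ?B" if f': "f' \<in> x n" for f'
    proof -
      obtain b where b: "b \<in> ?B" "f' = b \<otimes>\<^bsub>?Z\<^esub> f" using f' unfolding f(3) r_coset_def by blast
      have tb: "(\<lambda>gs\<in>tuples G n. sact ?t (b gs)) \<in> ?B"
        using tG b(1) by (rule coboundaries_additive[OF sact_hom[OF tR]])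
      have "(\<lambda>gs\<in>tuples G n. sact ?t (f' gs))
          = (\<lambda>gs\<in>tuples G n. sact ?t (b gs)) \<otimes>\<^bsub>?Z\<^esub> (\<lambda>gs\<in>tuples G n. sact ?t (f gs))"
        unfolding b(2) cocycles_ops using coboundary_closed[OF b(1)] cochain_closed[OF fc]
        by (intro restrict_ext) simp
      then show ?thesis using subgroup.m_closed[OF coboundaries_subgroup tb tf] by simp
    qed
    then show ?thesis
      unfolding cohomology_scalar_def induced_map_def using f(2) coboundaries_rcos by auto
  qed
  then show ?thesis using t by (auto simp: cohomology_annihilator_def one_total_cohomology)
qed

end

section \<open>The height inequality\<close>

text \<open>The additive group of \<open>F\<close> has order \<open>p\<close>, so \<open>p\<close>
  times any of its elements is zero; 1 is one of them.\<close>

lemma (in ring) char_of_subfield: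
  assumes "subfield F R" "card F = p"
  shows "[p] \<cdot>\<^bsub>R\<^esub> \<one> = \<zero>"
proof -
  have F: "subring F R" using assms(1) by (simp add: subfield_def subdomain_def subcring_def)
  then have sg: "subgroup F (add_monoid R)" by (simp add: subring_def)
  interpret F: group "(add_monoid R)\<lparr>carrier := F\<rparr>"
    using sg a_group by (rule subgroup.subgroup_is_group)
  have "\<one> \<in> carrier ((add_monoid R)\<lparr>carrier := F\<rparr>)" using subringE(3)[OF F] by simp
  from F.pow_order_eq_1[OF this] show ?thesis
    using assms(2) by (simp add: order_def add_pow_def nat_pow_def)
qed

theorem proposition1p4:
  fixes G :: "('g, 'c) monoid_scheme"
    and R :: "('r, 'd) ring_scheme"
    and \<phi> :: "'g \<Rightarrow> 'r \<Rightarrow> 'r"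
    and M :: "('g \<Rightarrow> 'r, 'm, 'e) module_scheme"
    and F :: "'r set"
    and p :: nat
    and x :: "nat \<Rightarrow> ('g list \<Rightarrow> 'm) set"
  assumes "group G" and "finite (carrier G)"
    and "cring R"
    and "group_action G (carrier R) \<phi>"
    and "\<And>g. g \<in> carrier G \<Longrightarrow> \<phi> g \<in> ring_iso R R"
    and "Factorial_Ring.prime p"
    and "subfield F R" and "card F = p"
    and "left_module (skew_group_ring G R \<phi>) M"
    and "x \<in> carrier (total_cohomology G M (group_act G R M))"
  shows "height (invariant_ring G R \<phi>) (cohomology_annihilator G R \<phi> M x) \<ge>
    (INF P \<in> {P. subgroup P G \<and> (\<exists>k. card P = p ^ k) \<and>
        restriction G M (group_act G R M) P x \<noteq>
          \<one>\<^bsub>total_cohomology (G\<lparr>carrier := P\<rparr>) M (group_act G R M)\<^esub>}.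
      height R (moving_ideal R \<phi> P))"
proof -
  interpret action: group_action G "carrier R" \<phi> by fact
  interpret skew_module G R \<phi> M
  proof (intro skew_module.intro finite_ring_action.intro finite_ring_action_axioms.intro assms(1-3,9))
    show "\<phi> g \<in> ring_hom R R" if "g \<in> carrier G" for g
      using assms(5)[OF that] by (simp add: ring_iso_def)
    show "\<phi> \<one>\<^bsub>G\<^esub> r = r" if "r \<in> carrier R" for r
      using fun_cong[OF action.id_eq_one, of r] that by simp
    show "\<phi> (g \<otimes>\<^bsub>G\<^esub> h) r = \<phi> g (\<phi> h r)"
      if "g \<in> carrier G" "h \<in> carrier G" "r \<in> carrier R" for g h r
      using action.composition_rule that by simp
  qed
  let ?\<P> = "{P. subgroup P G \<and> (\<exists>k. card P = p ^ k) \<and>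
    restriction G M gact P x \<noteq> \<one>\<^bsub>total_cohomology (G\<lparr>carrier := P\<rparr>) M gact\<^esub>}"
  have char: "[p] \<cdot>\<^bsub>R\<^esub> \<one>\<^bsub>R\<^esub> = \<zero>\<^bsub>R\<^esub>" using assms(7,8) by (rule char_of_subfield)
  show ?thesis
    unfolding height_def[of "invariant_ring G R \<phi>"]
  \<comment> \<open>Each prime over the annihilator is bounded separately, so \<open>P\<close> may
    depend on it; if there is none, the left height is infinite.\<close>
  proof (rule INF_greatest)
    fix q assume "q \<in> {Q. primeideal Q (invariant_ring G R \<phi>) \<and> cohomology_annihilator G R \<phi> M x \<subseteq> Q}"
    then have q: "primeideal q (invariant_ring G R \<phi>)" "cohomology_annihilator G R \<phi> M x \<subseteq> q" by auto
    obtain Q where Q: "primeideal Q R" "Q \<inter> fixed = q" using lying_over[OF q(1)] .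
    have ideal_Q: "ideal Q R" using Q(1) by (rule primeideal.axioms(1))
    obtain P k r where P: "subgroup P G" "card P = p ^ k" "P \<subseteq> inertia Q"
      and r: "r \<in> carrier R" "\<And>h. h \<in> P \<Longrightarrow> \<phi> h r = r" "rel_trace P r \<notin> Q"
      using exists_rel_trace_notin[OF Q(1) assms(6) char] by metis
    \<comment> \<open>Otherwise the trace of \<open>r\<close> would annihilate \<open>x\<close> and
      lie in \<open>q\<close>, hence in \<open>Q\<close>.\<close>
    have "restriction G M gact P x \<noteq> \<one>\<^bsub>total_cohomology (G\<lparr>carrier := P\<rparr>) M gact\<^esub>"
      using rel_trace_mem_annihilator[OF assms(10) P(1) _ r(1,2)] r(3) q(2) Q(2) by blast
    then have "P \<in> ?\<P>" using P by blast
    then have "(INF P \<in> ?\<P>. height R (moving_ideal R \<phi> P)) \<le> height R (moving_ideal R \<phi> P)"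
      by (rule INF_lower)
    also have "\<dots> \<le> prime_height R Q"
      unfolding height_def using Q(1) moving_ideal_subset[OF ideal_Q P(3)] by (intro INF_lower) simp
    also have "\<dots> \<le> prime_height (invariant_ring G R \<phi>) q"
      using prime_height_le_contract[OF Q(1)] Q(2) by simp
    finally show "(INF P \<in> ?\<P>. height R (moving_ideal R \<phi> P)) \<le> prime_height (invariant_ring G R \<phi>) q" .
  qed
qed

end
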